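(* Let $F$ be a local field, let $a_1,\dots,a_n\in\mathbb Z^m$ span $\mathbb Q^m$ (so the central arrangement $\mathcal A$ is essential of rank $m$), and assume the residue characteristic of $F$ exceeds the absolute value of every minor of the $n\times m$ matrix with rows $a_i$. Then, for $\mathrm{Re}(s)>0$, $$\mathcal I_{\mathcal A}(s)=\frac{q^m-1}{q^m-q^{-s}}+\frac{1-q^s}{1-q^{-(s+m)}}\sum_{\infty=I_0\supsetneq I_1\supsetneq\dots\supsetneq I_r}q^{-(m-\mathrm{rk}(I_r))}\prod_{i=1}^r\frac{\chi_{\mathcal A^{I_i}_{I_{i-1}}}(q)}{q^{s+\delta_{I_i}}-1},$$ where the sum runs over all strictly decreasing chains of flats of length $r\ge1$ starting at $\infty$.
   Context: Local field $F$ (locally compact non-discrete totally disconnected), ring of integers $\mathcal O$, maximal ideal $\mathfrak m$, residue field $\mathbb F_q$, normalized absolute value $|\cdot|$ with $|\pi|=q^{-1}$ for a uniformizer $\pi$, $\|y\|=\max_j|y_j|$, Haar measure on $F^N$ normalized so $\mathcal O^N$ has volume $1$. The hypertoric moment map is $\mu:\mathcal O^n\times\mathcal O^n\to\mathcal O^m$, $\mu(x,y)=\sum_{i=1}^nx_iy_ia_i$, and $\mathcal I_{\mathcal A}(s)=\int_{\mathcal O^{2n}}\|\mu(x,y)\|^s\,dx\,dy$. Arrangement: $\mathcal A$ consists of the hyperplanes $H_i=\{v:\langle v,a_i\rangle=0\}$ in $F^m$. For $J\subset\{1,\dots,n\}$, $H_J=\bigcap_{i\in J}H_i$; $J$ is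 a flat if $J=\{i:H_J\subset H_i\}$; $L(\mathcal A)$ is the poset of flats under inclusion, $\infty=\{1,\dots,n\}$ (so $H_\infty=0$). $\mathrm{rk}(J)=\dim\mathrm{span}\{a_i:i\in J\}$. Möbius function: $\nu(J,J)=1$, $\sum_{J\le G\le J'}\nu(J,G)=0$ for $J<J'$. For flats $J\subseteq I$, $\mathcal A^J_I$ is the arrangement in $H_J/H_I$ of the hyperplanes $(H_i\cap H_J)/H_I$, $i\in I\setminus J$; its characteristic polynomial is $\chi_{\mathcal A^J_I}(t)=\sum_{G\in L(\mathcal A),\,J\subseteq G\subseteq I}\nu(J,G)\,t^{\dim H_G-\dim H_I}$. For a flat $I$, $\delta_I=n-|I|+\mathrm{rk}(I)$. *)

theory Defs
  imports "HOL-Analysis.Analysis"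
begin

definition ringO :: "('a::field \<Rightarrow> real) \<Rightarrow> 'a set" where
  "ringO absF = {x. absF x \<le> 1}"

definition maxideal :: "('a::field \<Rightarrow> real) \<Rightarrow> 'a set" where
  "maxideal absF = {x. absF x < 1}"

definition residue_field :: "('a::field \<Rightarrow> real) \<Rightarrow> 'a set set" where
  "residue_field absF = (\<lambda>x. {y \<in> ringO absF. x - y \<in> maxideal absF}) ` ringO absF"

definition res_card :: "('a::field \<Rightarrow> real) \<Rightarrow> nat" where
  "res_card absF = card (residue_field absF)"

definition res_char :: "('a::field \<Rightarrow> real) \<Rightarrow> nat" where
  "res_char absF = (LEAST p. p > 0 \<and> (of_nat p :: 'a) \<in> maxideal absF)"

text \<open>A (non-archimedean) local field together with its normalized absolute value:
  complete w.r.t. a non-trivial discrete ultrametric absolute value with finite residue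
  field of cardinality q, normalized so that its nonzero values are exactly q^k, k in Z
  (so a uniformizer has absolute value q^-1).\<close>
definition local_field :: "('a::field \<Rightarrow> real) \<Rightarrow> bool" where
  "local_field absF \<longleftrightarrow>
     (\<forall>x. absF x \<ge> 0 \<and> (absF x = 0 \<longleftrightarrow> x = 0)) \<and>
     (\<forall>x y. absF (x * y) = absF x * absF y) \<and>
     (\<forall>x y. absF (x + y) \<le> max (absF x) (absF y)) \<and>
     finite (residue_field absF) \<and> res_card absF \<ge> 2 \<and>
     absF ` (UNIV - {0}) = range (\<lambda>k::int. real (res_card absF) powi k) \<and>
     (\<forall>X::nat \<Rightarrow> 'a. (\<forall>e>0. \<exists>N. \<forall>i\<ge>N. \<forall>j\<ge>N. absF (X i - X j) < e) \<longrightarrow>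
         (\<exists>L. \<forall>e>0. \<exists>N. \<forall>i\<ge>N. absF (X i - L) < e))"

definition haar_O :: "('a::field \<Rightarrow> real) \<Rightarrow> 'a measure \<Rightarrow> bool" where
  "haar_O absF nu \<longleftrightarrow>
     space nu = ringO absF \<and>
     sets nu = sigma_sets (ringO absF)
        {{y \<in> ringO absF. absF (y - x) \<le> r} | x r. x \<in> ringO absF} \<and>
     emeasure nu (ringO absF) = 1 \<and>
     (\<forall>A\<in>sets nu. \<forall>b\<in>ringO absF.
        (\<lambda>x. x + b) ` A \<in> sets nu \<and> emeasure nu ((\<lambda>x. x + b) ` A) = emeasure nu A)"

text \<open>Vectors a_i in Z^m are given by a i j (i < n, j < m); x, y in O^n as x i, i < n.\<close>
definition mu_norm :: "('a::field \<Rightarrow> real) \<Rightarrow> (nat \<Rightarrow> nat \<Rightarrow> int) \<Rightarrow> nat \<Rightarrow> nat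
     \<Rightarrow> (nat \<Rightarrow> 'a) \<Rightarrow> (nat \<Rightarrow> 'a) \<Rightarrow> real" where
  "mu_norm absF a n m x y =
     Max (insert 0 ((\<lambda>j. absF (\<Sum>i<n. x i * y i * of_int (a i j))) ` {..<m}))"

definition hypertoric_integral :: "('a::field \<Rightarrow> real) \<Rightarrow> 'a measure \<Rightarrow> (nat \<Rightarrow> nat \<Rightarrow> int)
     \<Rightarrow> nat \<Rightarrow> nat \<Rightarrow> complex \<Rightarrow> complex" where
  "hypertoric_integral absF nu a n m s =
     integral\<^sup>L (PiM {..<n} (\<lambda>_. nu) \<Otimes>\<^sub>M PiM {..<n} (\<lambda>_. nu))
       (\<lambda>(x, y). complex_of_real (mu_norm absF a n m x y) powr s)"

definition minor :: "(nat \<Rightarrow> nat \<Rightarrow> int) \<Rightarrow> nat set \<Rightarrow> nat set \<Rightarrow> int" where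
  "minor a R C = (let k = card R; rs = sorted_list_of_set R; cs = sorted_list_of_set C in
     (\<Sum>p | p permutes {..<k}. of_int (sign p) * (\<Prod>i<k. a (rs ! i) (cs ! p i))))"

definition lin_indepF :: "(nat \<Rightarrow> 'a::field) set \<Rightarrow> bool" where
  "lin_indepF V \<longleftrightarrow> (\<forall>c. (\<forall>j. (\<Sum>v\<in>V. c v * v j) = 0) \<longrightarrow> (\<forall>v\<in>V. c v = 0))"

definition spanF :: "(nat \<Rightarrow> 'a::field) set \<Rightarrow> (nat \<Rightarrow> 'a) set" where
  "spanF V = {(\<lambda>j. \<Sum>v\<in>V. c v * v j) | c. True}"

text \<open>Dimension of a subspace (all subspaces here live in F^m, coordinates j < m).\<close>
definition dimF :: "(nat \<Rightarrow> 'a::field) set \<Rightarrow> nat" where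
  "dimF S = Max {card V | V. finite V \<and> V \<subseteq> S \<and> lin_indepF V}"

definition vecA :: "'a::field itself \<Rightarrow> (nat \<Rightarrow> nat \<Rightarrow> int) \<Rightarrow> nat \<Rightarrow> nat \<Rightarrow> (nat \<Rightarrow> 'a)" where
  "vecA _ a m i = (\<lambda>j. if j < m then of_int (a i j) else 0)"

definition HJ :: "'a::field itself \<Rightarrow> (nat \<Rightarrow> nat \<Rightarrow> int) \<Rightarrow> nat \<Rightarrow> nat set \<Rightarrow> (nat \<Rightarrow> 'a) set" where
  "HJ _ a m J = {v. (\<forall>j\<ge>m. v j = 0) \<and> (\<forall>i\<in>J. (\<Sum>j<m. v j * of_int (a i j)) = 0)}"

definition rk :: "'a::field itself \<Rightarrow> (nat \<Rightarrow> nat \<Rightarrow> int) \<Rightarrow> nat \<Rightarrow> nat set \<Rightarrow> nat" where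
  "rk T a m J = dimF (spanF (vecA T a m ` J))"

definition is_flat :: "'a::field itself \<Rightarrow> (nat \<Rightarrow> nat \<Rightarrow> int) \<Rightarrow> nat \<Rightarrow> nat \<Rightarrow> nat set \<Rightarrow> bool" where
  "is_flat T a n m J \<longleftrightarrow> J \<subseteq> {..<n} \<and> J = {i \<in> {..<n}. HJ T a m J \<subseteq> HJ T a m {i}}"

definition flats :: "'a::field itself \<Rightarrow> (nat \<Rightarrow> nat \<Rightarrow> int) \<Rightarrow> nat \<Rightarrow> nat \<Rightarrow> nat set set" where
  "flats T a n m = {J. is_flat T a n m J}"

function mobius :: "nat set set \<Rightarrow> nat set \<Rightarrow> nat set \<Rightarrow> int" where
  "mobius L J J' =
     (if J \<notin> L \<or> J' \<notin> L \<or> \<not> J \<subseteq> J' \<or> \<not> finite J' then 0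
      else if J = J' then 1
      else - (\<Sum>G\<in>{G\<in>L. J \<subseteq> G \<and> G \<subset> J'}. mobius L J G))"
  by auto
termination
  by (relation "Wellfounded.measure (\<lambda>(L, J, J'). card J')")
     (auto intro: psubset_card_mono)

definition charpoly :: "'a::field itself \<Rightarrow> (nat \<Rightarrow> nat \<Rightarrow> int) \<Rightarrow> nat \<Rightarrow> nat
     \<Rightarrow> nat set \<Rightarrow> nat set \<Rightarrow> real \<Rightarrow> real" where
  "charpoly T a n m J I t =
     (\<Sum>G\<in>{G\<in>flats T a n m. J \<subseteq> G \<and> G \<subseteq> I}.
        of_int (mobius (flats T a n m) J G) * t ^ (dimF (HJ T a m G) - dimF (HJ T a m I)))"

definition deltaF :: "'a::field itself \<Rightarrow> (nat \<Rightarrow> nat \<Rightarrow> int) \<Rightarrow> nat \<Rightarrow> nat \<Rightarrow> nat set \<Rightarrow> nat" where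
  "deltaF T a n m I = n - card I + rk T a m I"

text \<open>Strictly decreasing chains infinity = I_0 > I_1 > ... > I_r of flats, r >= 1,
  represented by the list [I_1, ..., I_r].\<close>
definition chains :: "'a::field itself \<Rightarrow> (nat \<Rightarrow> nat \<Rightarrow> int) \<Rightarrow> nat \<Rightarrow> nat \<Rightarrow> nat set list set" where
  "chains T a n m = {cs. cs \<noteq> [] \<and> set cs \<subseteq> flats T a n m \<and>
                         sorted_wrt (\<lambda>A B. B \<subset> A) ({..<n} # cs)}"

end

theory Submission
  imports Defs "Jordan_Normal_Form.Determinant" "HOL-Library.Function_Algebras"
begin

text \<open>
  Let \<open>V k\<close> be the volume of the set where \<open>\<mu>(x, y)\<close> vanishes modulo \<open>M^k\<close>; then the integral is the
  sum of \<open>q^(-ks) (V k - V (k+1))\<close>. For fixed \<open>y\<close> the map \<open>\<mu>\<close> is linear in \<open>x\<close>, and a matrix over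
  \<open>O/M^k\<close> and its transpose have kernels of the same density (eliminate with a pivot of
  largest absolute value). Hence \<open>V k\<close> is the average over \<open>\<xi> \<in> (O/M^k)^m\<close> of the product over \<open>i\<close> of
  \<open>min 1 (q^(-k) / |\<langle>\<xi>, a i\<rangle>|)\<close>.

  The bound on the minors makes the arrangement over the residue field combinatorially equal to
  the one over \<open>F\<close>. Reducing \<open>\<xi>\<close> modulo \<open>M\<close>, the indices \<open>i \<in> I\<close> with \<open>\<langle>\<xi>, a i\<rangle> \<in> M\<close> form a flat \<open>J\<close>, each
  flat \<open>J\<close> occurs with density \<open>q^(-rk I) \<chi>(q)\<close> by Moebius inversion, and on such a residue class the
  pairings with \<open>a j\<close>, \<open>j \<in> J\<close>, divided by the uniformizer, are distributed as before.
  This expresses level \<open>k+1\<close> for \<open>I\<close> through level \<open>k\<close> for the flats \<open>J \<subseteq> I\<close>; the generating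
  functions in \<open>q^(-s)\<close> therefore satisfy a triangular linear system, which unrolls to the sum over
  chains of flats.
\<close>

section \<open>Fraction-free echelon forms\<close>

text \<open>The obstacle is that flats, ranks and dimensions are taken over \<open>F\<close>, while
  the volumes count points modulo powers of the maximal ideal. Linear algebra over the field
  therefore has to be done with integral coefficients: every set of rows gets an echelon basis
  obtained by dividing integer data by a single determinant \<open>D\<close>, which the residue
  characteristic makes a unit. The same integer data serve over the rationals, which transfers the
  spanning hypothesis to \<open>F\<close>. Transposition is needed because the \<open>m\<close>
  congruences in \<open>x\<close> are coupled, whereas after it each coordinate \<open>y i\<close>
  meets only one congruence. It stands in for Fourier analysis on \<open>O/M^k\<close>. The
  recursion from level \<open>k+1\<close> to level \<open>k\<close> has coefficients depending on
  \<open>k\<close>. Weighting the average for \<open>I\<close> by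
  \<open>p ^ (k * (n - card I))\<close> makes them constant, so that it passes to generating
  functions. The diagonal coefficient is then \<open>p\<close> to the power delta_I, which is where
  the exponent delta of the formula comes from.\<close>

definition submat :: "(nat \<Rightarrow> nat \<Rightarrow> int) \<Rightarrow> nat list \<Rightarrow> nat list \<Rightarrow> int mat" where
  "submat a rs cs = Matrix.mat (length rs) (length rs) (\<lambda>(i, j). a (rs ! i) (cs ! j))"

lemma submat_carrier [simp]: "submat a rs cs \<in> carrier_mat (length rs) (length rs)"
  by (simp add: submat_def)

lemma minor_eq_det:
  assumes "card R = card C" "finite R" "finite C"
  shows "minor a R C = Determinant.det (submat a (sorted_list_of_set R) (sorted_list_of_set C))"
proof -
  have l: "length (sorted_list_of_set R) = card R" by simp
  show ?thesis
    unfolding minor_def Let_def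
    by (subst det_def'[OF submat_carrier], unfold l)
       (auto simp: submat_def lessThan_atLeast0 assms intro!: sum.cong prod.cong dest: permutes_in_image)
qed

text \<open>Indices are lists, so they can be extended at the end and may repeat; a nonzero
  determinant by itself excludes repetitions, since two equal rows give zero.\<close>

lemma submat_distinct_rows:
  assumes "Determinant.det (submat a rs cs) \<noteq> 0"
  shows "distinct rs"
proof (rule ccontr)
  assume "\<not> distinct rs"
  then obtain i j where ij: "i < length rs" "j < length rs" "i \<noteq> j" "rs ! i = rs ! j"
    by (auto simp: distinct_conv_nth)
  have "row (submat a rs cs) i = row (submat a rs cs) j"
    using ij by (auto simp: submat_def)
  with det_identical_rows[OF submat_carrier ij(3,1,2)] assms show False by blast
qed

lemma submat_distinct_cols:
  assumes "Determinant.det (submat a rs cs) \<noteq> 0" "length cs = length rs"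
  shows "distinct cs"
proof (rule ccontr)
  assume "\<not> distinct cs"
  then obtain i j where ij: "i < length rs" "j < length rs" "i \<noteq> j" "cs ! i = cs ! j"
    using assms by (auto simp: distinct_conv_nth)
  have "col (submat a rs cs) i = col (submat a rs cs) j"
    using ij by (auto simp: submat_def)
  with det_identical_columns[OF submat_carrier ij(3,1,2)] assms show False by blast
qed

text \<open>Sorting costs only the sign of a permutation, so determinants and minors are compared in
  absolute value.\<close>

lemma abs_det_submat_permute_rows:
  assumes "mset rs = mset rs'"
  shows "\<bar>Determinant.det (submat a rs cs)\<bar> = \<bar>Determinant.det (submat a rs' cs)\<bar>"
proof -
  obtain p where p: "p permutes {..<length rs'}" "permute_list p rs' = rs"
    using mset_eq_permutation[OF assms] .
  have len: "length rs = length rs'" using assms by (rule mset_eq_length)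
  have "submat a rs cs = Matrix.mat (length rs') (length rs')
      (\<lambda>(i, j). submat a rs' cs $$ (p i, j))"
  proof (intro eq_matI, goal_cases)
    case (1 i j)
    then have i: "i < length rs'" and j: "j < length rs'" by auto
    have "p i < length rs'" using permutes_in_image[OF p(1)] i by auto
    moreover have "rs ! i = rs' ! p i" using permute_list_nth[OF p(1) i] p(2) by simp
    ultimately show ?case using i j len by (simp add: submat_def)
  qed (simp_all add: submat_def len)
  then have "Determinant.det (submat a rs cs) = of_int (sign p) * Determinant.det (submat a rs' cs)"
    using det_permute_rows[OF submat_carrier, of p rs' a cs] p(1)
    by (simp add: lessThan_atLeast0)
  then show ?thesis by (auto simp: sign_def)
qed

lemma submat_transpose:
  assumes "length cs = length rs"
  shows "transpose_mat (submat a rs cs) = submat (\<lambda>i j. a j i) cs rs"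
  using assms by (intro eq_matI) (auto simp: submat_def)

lemma det_submat_flip:
  assumes "length cs = length rs"
  shows "Determinant.det (submat (\<lambda>i j. a j i) cs rs) = Determinant.det (submat a rs cs)"
  using det_transpose[OF submat_carrier, of a rs cs] submat_transpose[OF assms] by metis

lemma abs_det_submat_eq_minor:
  assumes "distinct rs" "distinct cs" "length cs = length rs"
  shows "\<bar>Determinant.det (submat a rs cs)\<bar> = \<bar>minor a (set rs) (set cs)\<bar>"
proof -
  let ?rs = "sorted_list_of_set (set rs)" and ?cs = "sorted_list_of_set (set cs)"
  have r: "mset rs = mset ?rs" and c: "mset cs = mset ?cs"
    using assms by (metis distinct_sorted_list_of_set set_eq_iff_mset_eq_distinct
        set_sorted_list_of_set List.finite_set)+
  have lr: "length ?rs = length rs" and lc: "length ?cs = length rs"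
    using mset_eq_length[OF r] mset_eq_length[OF c] assms by simp_all
  have "\<bar>Determinant.det (submat a rs cs)\<bar> = \<bar>Determinant.det (submat a ?rs cs)\<bar>"
    by (rule abs_det_submat_permute_rows[OF r])
  \<comment> \<open>Columns are sorted by transposing, sorting rows, and transposing back.\<close>
  also have "\<dots> = \<bar>Determinant.det (submat (\<lambda>i j. a j i) cs ?rs)\<bar>"
    by (subst det_submat_flip) (use assms lr in auto)
  also have "\<dots> = \<bar>Determinant.det (submat (\<lambda>i j. a j i) ?cs ?rs)\<bar>"
    by (rule abs_det_submat_permute_rows[OF c])
  also have "\<dots> = \<bar>Determinant.det (submat a ?rs ?cs)\<bar>"
    by (subst det_submat_flip) (use lc lr in auto)
  finally show ?thesis
    using assms by (simp add: minor_eq_det distinct_card)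
qed

text \<open>The empty determinant is 1, and distinct columns bound the size by \<open>m\<close>;
  hence a nonzero determinant of largest size exists, and every bordered one, being larger by one,
  vanishes.\<close>

lemma maximal_submat:
  fixes J :: "nat set"
  obtains rs cs where "set rs \<subseteq> J" "set cs \<subseteq> {..<m}" "length cs = length rs"
    "Determinant.det (submat a rs cs) \<noteq> 0"
    "\<And>j l. j \<in> J \<Longrightarrow> l < m \<Longrightarrow> Determinant.det (submat a (rs @ [j]) (cs @ [l])) = 0"
proof -
  define P where "P k \<longleftrightarrow> (\<exists>rs cs. set rs \<subseteq> J \<and> set cs \<subseteq> {..<m} \<and> length cs = length rs
    \<and> length rs = k \<and> Determinant.det (submat a rs cs) \<noteq> 0)" for k
  have P0: "P 0"
    unfolding P_def by (intro exI[of _ "[]"]) (simp add: submat_def)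
  have bound: "k \<le> m" if Pk: "P k" for k
  proof -
    obtain rs cs where *: "set cs \<subseteq> {..<m}" "length cs = length rs" "length rs = k"
      "Determinant.det (submat a rs cs) \<noteq> 0" using Pk unfolding P_def by blast
    have "distinct cs" using submat_distinct_cols * by blast
    then have "k = card (set cs)" using * by (simp add: distinct_card)
    also have "\<dots> \<le> m" using card_mono[OF _ *(1)] by simp
    finally show ?thesis .
  qed
  obtain k where k: "P k" "\<And>l. P l \<Longrightarrow> l \<le> k"
    using GreatestI_nat[of P, OF P0, of m] Greatest_le_nat[of P _ m] bound by blast
  then obtain rs cs where *: "set rs \<subseteq> J" "set cs \<subseteq> {..<m}" "length cs = length rs"
      "length rs = k" "Determinant.det (submat a rs cs) \<noteq> 0" unfolding P_def by blast
  show ?thesis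
  proof (rule that[OF *(1,2,3,5)])
    fix j l assume jl: "j \<in> J" "l < m"
    show "Determinant.det (submat a (rs @ [j]) (cs @ [l])) = 0"
    proof (rule ccontr)
      assume "Determinant.det (submat a (rs @ [j]) (cs @ [l])) \<noteq> 0"
      then have "P (Suc k)" unfolding P_def
        by (intro exI[of _ "rs @ [j]"] exI[of _ "cs @ [l]"]) (use * jl in auto)
      then show False using k(2) by fastforce
    qed
  qed
qed

text \<open>Laplace expansion along the appended column: its cofactors do not see that column, so
  the same coefficients \<open>y\<close> serve for every \<open>l\<close>. Once the bordered
  determinants vanish, a multiple of row \<open>j\<close> becomes a combination of the chosen
  rows.\<close>

lemma bordered_expansion:
  assumes len: "length cs = length rs"
  obtains y where "\<And>l. Determinant.det (submat a (rs @ [j]) (cs @ [l])) =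
    Determinant.det (submat a rs cs) * a j l + (\<Sum>i<length rs. y i * a (rs ! i) l)"
proof -
  let ?r = "length rs"
  define B where "B l = submat a (rs @ [j]) (cs @ [l])" for l
  have del: "mat_delete (B l) i ?r = mat_delete (B 0) i ?r" for l i
    by (intro eq_matI) (auto simp: mat_delete_def B_def submat_def nth_append len)
  have cof: "cofactor (B l) i ?r = cofactor (B 0) i ?r" for l i
    unfolding cofactor_def del[of l] ..
  have last: "mat_delete (B 0) ?r ?r = submat a rs cs"
    by (intro eq_matI) (auto simp: mat_delete_def B_def submat_def nth_append len)
  show ?thesis
  proof (rule that[of "\<lambda>i. cofactor (B 0) i ?r"])
    fix l
    have c: "B l \<in> carrier_mat (Suc ?r) (Suc ?r)" unfolding B_def using submat_carrier[of a "rs @ [j]"] by simp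
    have "Determinant.det (B l) = (\<Sum>i<Suc ?r. B l $$ (i, ?r) * cofactor (B l) i ?r)"
      by (rule laplace_expansion_column[OF c]) simp
    also have "\<dots> = (\<Sum>i<?r. cofactor (B 0) i ?r * a (rs ! i) l)
        + a j l * cofactor (B 0) ?r ?r"
      by (subst cof) (auto simp: B_def submat_def nth_append len intro!: sum.cong)
    also have "cofactor (B 0) ?r ?r = Determinant.det (submat a rs cs)"
      by (simp add: cofactor_def last)
    finally show "Determinant.det (submat a (rs @ [j]) (cs @ [l])) =
        Determinant.det (submat a rs cs) * a j l + (\<Sum>i<?r. cofactor (B 0) i ?r * a (rs ! i) l)"
      by (simp add: B_def mult.commute)
  qed
qed

text \<open>The rows \<open>Z c / D\<close> form the reduced basis, with pivot columns \<open>C\<close>, of the span of the rows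
  \<open>a j\<close>, \<open>j \<in> J\<close>; they come from a nonzero minor \<open>D\<close> of maximal size, all larger minors vanishing.\<close>
lemma integer_echelon:
  assumes J: "J \<subseteq> {..<n}"
  obtains C :: "nat set" and D :: int and Z T where "C \<subseteq> {..<m}" "D \<noteq> 0"
    "\<bar>D\<bar> = 1 \<or> (\<exists>R C. R \<subseteq> {..<n} \<and> C \<subseteq> {..<m} \<and> card R = card C \<and> card R \<ge> 1 \<and> \<bar>D\<bar> = \<bar>minor a R C\<bar>)"
    "\<And>c c'. c \<in> C \<Longrightarrow> c' \<in> C \<Longrightarrow> Z c c' = (if c = c' then D else 0)"
    "\<And>j l. j \<in> J \<Longrightarrow> l < m \<Longrightarrow> D * a j l = (\<Sum>c\<in>C. a j c * Z c l)"
    "\<And>c l. c \<in> C \<Longrightarrow> Z c l = (\<Sum>j\<in>J. T c j * a j l)"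
proof -
  obtain rs cs where mx: "set rs \<subseteq> J" "set cs \<subseteq> {..<m}" "length cs = length rs"
    "Determinant.det (submat a rs cs) \<noteq> 0"
    "\<And>j l. j \<in> J \<Longrightarrow> l < m \<Longrightarrow> Determinant.det (submat a (rs @ [j]) (cs @ [l])) = 0"
    by (rule maximal_submat[of J m a]) blast
  have fJ: "finite J" using J finite_subset by blast
  have dr: "distinct rs" and dc: "distinct cs"
    using submat_distinct_rows submat_distinct_cols mx by blast+
  define r where "r = length rs"
  define D where "D = Determinant.det (submat a rs cs)"
  define M where "M = submat a rs cs"
  \<comment> \<open>The adjugate replaces the inverse: \<open>M * W\<close> and \<open>W * M\<close>
    are \<open>D\<close> times the identity, and all entries stay integers.\<close>
  define W where "W = adj_mat M"
  have Mc: "M \<in> carrier_mat r r" by (simp add: M_def r_def)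
  note adj = adj_mat[OF Mc, folded W_def]
  have MW: "(\<Sum>k<r. a (rs ! i) (cs ! k) * W $$ (k, j)) = (if i = j then D else 0)"
    if "i < r" "j < r" for i j
  proof -
    have "(M * W) $$ (i, j) = (\<Sum>k<r. M $$ (i, k) * W $$ (k, j))"
      using that adj(1) Mc by (auto simp: scalar_prod_def lessThan_atLeast0)
    also have "\<dots> = (\<Sum>k<r. a (rs ! i) (cs ! k) * W $$ (k, j))"
      using that by (intro sum.cong) (auto simp: M_def submat_def r_def)
    finally show ?thesis using that adj(2) by (auto simp: D_def M_def split: if_splits)
  qed
  have WM: "(\<Sum>k<r. W $$ (i, k) * a (rs ! k) (cs ! j)) = (if i = j then D else 0)"
    if "i < r" "j < r" for i j
  proof -
    have "(W * M) $$ (i, j) = (\<Sum>k<r. W $$ (i, k) * M $$ (k, j))"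
      using that adj(1) Mc by (auto simp: scalar_prod_def lessThan_atLeast0)
    also have "\<dots> = (\<Sum>k<r. W $$ (i, k) * a (rs ! k) (cs ! j))"
      using that by (intro sum.cong) (auto simp: M_def submat_def r_def)
    finally show ?thesis using that adj(3) by (auto simp: D_def M_def split: if_splits)
  qed
  define C where "C = set cs"
  have bij: "bij_betw ((!) cs) {..<r} C"
    using bij_betw_nth[OF dc] mx(3) by (simp add: C_def r_def)
  define ix where "ix = the_inv_into {..<r} ((!) cs)"
  have ix: "ix (cs ! k) = k" if "k < r" for k
    unfolding ix_def using that bij by (intro the_inv_into_f_f) (auto simp: bij_betw_def)
  \<comment> \<open>Multiplying the chosen rows by the adjugate turns the pivot block into
    \<open>D\<close> times the identity; \<open>T\<close> records the coefficients, spread over all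
    of \<open>J\<close>.\<close>
  define Z where "Z c l = (\<Sum>b<r. W $$ (ix c, b) * a (rs ! b) l)" for c l
  define T where "T c j = (\<Sum>b<r. if rs ! b = j then W $$ (ix c, b) else 0)" for c j
  have CE: "\<exists>k<r. c = cs ! k" if "c \<in> C" for c
    using that bij unfolding bij_betw_def by auto
  have row: "D * a (rs ! i) l = (\<Sum>c\<in>C. a (rs ! i) c * Z c l)" if "i < r" for i l
  proof -
    have "(\<Sum>c\<in>C. a (rs ! i) c * Z c l) = (\<Sum>k<r. a (rs ! i) (cs ! k) * Z (cs ! k) l)"
      by (rule sum.reindex_bij_betw[OF bij, symmetric])
    also have "\<dots> = (\<Sum>k<r. \<Sum>b<r. a (rs ! i) (cs ! k) * W $$ (k, b) * a (rs ! b) l)"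
      by (intro sum.cong) (auto simp: Z_def ix sum_distrib_left mult.assoc)
    also have "\<dots> = (\<Sum>b<r. (\<Sum>k<r. a (rs ! i) (cs ! k) * W $$ (k, b)) * a (rs ! b) l)"
      by (subst sum.swap) (simp add: sum_distrib_right)
    also have "\<dots> = (\<Sum>b<r. (if i = b then D else 0) * a (rs ! b) l)"
      using that MW by (intro sum.cong) auto
    also have "\<dots> = (\<Sum>b<r. if i = b then D * a (rs ! b) l else 0)"
      by (intro sum.cong) auto
    also have "\<dots> = D * a (rs ! i) l" using that by simp
    finally show ?thesis by simp
  qed
  show ?thesis
  proof (rule that[of C D Z T])
    show "C \<subseteq> {..<m}" using mx by (simp add: C_def)
    show "D \<noteq> 0" using mx by (simp add: D_def)
    show "\<bar>D\<bar> = 1 \<or> (\<exists>R C. R \<subseteq> {..<n} \<and> C \<subseteq> {..<m} \<and> card R = card C \<and> card R \<ge> 1 \<and> \<bar>D\<bar> = \<bar>minor a R C\<bar>)"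
    \<comment> \<open>Size zero is separate: the empty determinant is 1 and is not among the minors
      of size at least 1.\<close>
    proof (cases "rs = []")
      case True
      then show ?thesis by (simp add: D_def submat_def)
    next
      case False
      have "card (set rs) = card (set cs)" "card (set rs) \<ge> 1"
        using dr dc mx(3) False by (simp_all add: distinct_card Suc_leI)
      moreover have "\<bar>D\<bar> = \<bar>minor a (set rs) (set cs)\<bar>"
        unfolding D_def by (rule abs_det_submat_eq_minor[OF dr dc mx(3)])
      ultimately show ?thesis using mx(1,2) J by blast
    qed
    show "Z c c' = (if c = c' then D else 0)" if cc: "c \<in> C" "c' \<in> C" for c c'
    proof -
      obtain k k' where k: "k < r" "c = cs ! k" "k' < r" "c' = cs ! k'"
        using CE[OF cc(1)] CE[OF cc(2)] by blast
      then have "c = c' \<longleftrightarrow> k = k'" using ix by metis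
      then show ?thesis using WM[OF k(1,3)] by (simp add: Z_def k(2,4) ix[OF k(1)])
    qed
    show "Z c l = (\<Sum>j\<in>J. T c j * a j l)" if "c \<in> C" for c l
    proof -
      have "(\<Sum>j\<in>J. T c j * a j l) = (\<Sum>b<r. \<Sum>j\<in>J. if rs ! b = j then W $$ (ix c, b) * a j l else 0)"
        unfolding T_def sum_distrib_right by (subst sum.swap) (auto intro!: sum.cong)
      also have "\<dots> = Z c l" unfolding Z_def
        using fJ mx(1) by (intro sum.cong) (auto simp: r_def subset_eq)
      finally show ?thesis by simp
    qed
    show "D * a j l = (\<Sum>c\<in>C. a j c * Z c l)" if j: "j \<in> J" and l: "l < m" for j l
    proof -
      obtain y where y: "\<And>l. Determinant.det (submat a (rs @ [j]) (cs @ [l])) =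
          D * a j l + (\<Sum>i<r. y i * a (rs ! i) l)"
        using bordered_expansion[OF mx(3), where j=j and a=a, folded D_def r_def] by metis
      have rel: "D * a j l = - (\<Sum>i<r. y i * a (rs ! i) l)" if "l < m" for l
        using y[of l] mx(5)[OF j that] by simp
      \<comment> \<open>One factor \<open>D\<close> turns row \<open>j\<close> into the chosen rows,
        a second one turns these into the rows \<open>Z\<close>. The vanishing bordered determinants
        then turn the coefficients back into \<open>D * a j c\<close>, and one \<open>D\<close>
        cancels.\<close>
      have "D * (D * a j l) = - (\<Sum>i<r. y i * (D * a (rs ! i) l))"
        by (simp add: rel[OF l] sum_distrib_left mult.left_commute)
      also have "\<dots> = - (\<Sum>i<r. \<Sum>c\<in>C. y i * a (rs ! i) c * Z c l)"
        using row by (simp add: sum_distrib_left mult.assoc)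
      also have "\<dots> = (\<Sum>c\<in>C. - (\<Sum>i<r. y i * a (rs ! i) c) * Z c l)"
        by (subst sum.swap) (simp add: sum_distrib_right sum_negf)
      also have "\<dots> = (\<Sum>c\<in>C. (D * a j c) * Z c l)"
        using rel mx(2) by (intro sum.cong) (auto simp: C_def)
      also have "\<dots> = D * (\<Sum>c\<in>C. a j c * Z c l)"
        by (simp add: sum_distrib_left mult.assoc)
      finally show ?thesis using mx(4) by (simp add: D_def)
    qed
  qed
qed

section \<open>Ranks and dimensions via reduced bases\<close>

lemma sum_fun_apply: "(\<Sum>x\<in>A. f x) j = (\<Sum>x\<in>A. f x j)"
  for f :: "'b \<Rightarrow> 'c \<Rightarrow> 'a::comm_monoid_add"
  by (induction A rule: infinite_finite_induct) auto

text \<open>A vector of \<open>S\<close> is recovered from its coordinates in \<open>X\<close>, and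
  evaluation at \<open>x\<close> is dual to \<open>w x\<close>: this gives independence, while the
  exchange lemma gives the upper bound. It serves the row space, with \<open>X\<close> the pivot
  columns, and the kernel, with \<open>X\<close> the free ones.\<close>

lemma dimF_reduced_basis:
  fixes S :: "(nat \<Rightarrow> 'a::field) set"
  assumes fin: "finite X"
    and mem: "\<And>x. x \<in> X \<Longrightarrow> w x \<in> S"
    and delta: "\<And>x x'. x \<in> X \<Longrightarrow> x' \<in> X \<Longrightarrow> w x x' = (if x = x' then 1 else 0)"
    and expand: "\<And>v. v \<in> S \<Longrightarrow> v = (\<lambda>j. \<Sum>x\<in>X. v x * w x j)"
  shows "dimF S = card X"
proof -
  interpret fs: vector_space "\<lambda>(c::'a) (v::nat \<Rightarrow> 'a) j. c * v j"
    by unfold_locales (auto simp: fun_eq_iff algebra_simps)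
  have inj: "inj_on w X"
    using delta by (intro inj_onI) (metis zero_neq_one)
  have bound: "card V \<le> card X" if V: "finite V" "V \<subseteq> S" "lin_indepF V" for V
  proof -
    have "fs.independent V"
      unfolding fs.dependent_finite[OF V(1)]
      using V(3) by (auto simp: lin_indepF_def fun_eq_iff sum_fun_apply)
    moreover have "V \<subseteq> fs.span (w ` X)"
    proof
      fix v assume "v \<in> V"
      then have "v = (\<Sum>x\<in>X. (\<lambda>j. v x * w x j))"
        using expand[of v] V(2) by (auto simp: fun_eq_iff sum_fun_apply)
      also have "\<dots> \<in> fs.span (w ` X)"
        by (intro fs.span_sum fs.span_scale fs.span_base) auto
      finally show "v \<in> fs.span (w ` X)" .
    qed
    ultimately have "card V \<le> card (w ` X)"
      using fs.independent_span_bound[of "w ` X" V] fin by auto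
    then show ?thesis using card_image_le[OF fin] by (rule le_trans)
  qed
  have "lin_indepF (w ` X)"
    unfolding lin_indepF_def
  proof (intro allI impI ballI)
    fix c v assume c: "\<forall>j. (\<Sum>v\<in>w ` X. c v * v j) = 0" and "v \<in> w ` X"
    then obtain x where x: "x \<in> X" "v = w x" by blast
    have "0 = (\<Sum>y\<in>X. c (w y) * w y x)"
      using c by (simp add: sum.reindex[OF inj])
    also have "\<dots> = (\<Sum>y\<in>X. if y = x then c (w y) else 0)"
      using x delta by (intro sum.cong) auto
    also have "\<dots> = c v" using x fin by simp
    finally show "c v = 0" by simp
  qed
  moreover have "w ` X \<subseteq> S" using mem by blast
  ultimately have "card X \<in> {card V | V. finite V \<and> V \<subseteq> S \<and> lin_indepF V}"
    using fin card_image[OF inj, symmetric] by blast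
  moreover have "{card V | V. finite V \<and> V \<subseteq> S \<and> lin_indepF V} \<subseteq> {..card X}"
    using bound by blast
  ultimately show ?thesis
    unfolding dimF_def by (intro Max_eqI) (auto intro: finite_subset)
qed

text \<open>\<open>C\<close> is the set of pivot columns, \<open>E c\<close> the reduced row with pivot \<open>c\<close>, and \<open>T c\<close> its
  coefficients with respect to the rows \<open>a j\<close>, \<open>j \<in> J\<close>.\<close>
definition echelon ::
  "(nat \<Rightarrow> nat \<Rightarrow> int) \<Rightarrow> nat \<Rightarrow> nat set \<Rightarrow> nat set \<Rightarrow> (nat \<Rightarrow> nat \<Rightarrow> 'a::field) \<Rightarrow> (nat \<Rightarrow> nat \<Rightarrow> 'a) \<Rightarrow> bool" where
  "echelon a m J C E T \<longleftrightarrow> C \<subseteq> {..<m} \<and>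
     (\<forall>c\<in>C. \<forall>c'\<in>C. E c c' = (if c = c' then 1 else 0)) \<and>
     (\<forall>c\<in>C. \<forall>l\<ge>m. E c l = 0) \<and>
     (\<forall>j\<in>J. \<forall>l<m. of_int (a j l) = (\<Sum>c\<in>C. of_int (a j c) * E c l)) \<and>
     (\<forall>c\<in>C. \<forall>l<m. E c l = (\<Sum>j\<in>J. T c j * of_int (a j l)))"

definition pair :: "(nat \<Rightarrow> nat \<Rightarrow> int) \<Rightarrow> nat \<Rightarrow> (nat \<Rightarrow> 'a::field) \<Rightarrow> nat \<Rightarrow> 'a" where
  "pair a m \<xi> i = (\<Sum>l<m. \<xi> l * of_int (a i l))"

text \<open>Stated for a single row because it is also applied to rows outside \<open>J\<close> that
  lie in the closure of \<open>J\<close>.\<close>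

lemma pair_eq_of_row_eq:
  assumes "\<And>l. l < m \<Longrightarrow> of_int (a j l) = (\<Sum>c\<in>C. of_int (a j c) * E c l)"
  shows "pair a m \<xi> j = (\<Sum>c\<in>C. of_int (a j c) * (\<Sum>l<m. \<xi> l * E c l))"
proof -
  have "pair a m \<xi> j = (\<Sum>l<m. \<xi> l * (\<Sum>c\<in>C. of_int (a j c) * E c l))"
    unfolding pair_def by (intro sum.cong) (auto simp flip: assms)
  also have "\<dots> = (\<Sum>c\<in>C. of_int (a j c) * (\<Sum>l<m. \<xi> l * E c l))"
    unfolding sum_distrib_left by (subst sum.swap) (simp add: mult_ac)
  finally show ?thesis .
qed

text \<open>The standard null-space basis: the free column \<open>l\<close> gets 1, the other free
  columns 0, and the pivot columns are solved for.\<close>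

definition kernel_vec :: "nat set \<Rightarrow> (nat \<Rightarrow> nat \<Rightarrow> 'a::field) \<Rightarrow> nat \<Rightarrow> nat \<Rightarrow> 'a" where
  "kernel_vec C E l = (\<lambda>j. if j = l then 1 else if j \<in> C then - E j l else 0)"

context
  fixes a :: "nat \<Rightarrow> nat \<Rightarrow> int" and m :: nat and J C :: "nat set"
    and E T :: "nat \<Rightarrow> nat \<Rightarrow> 'a::field"
  assumes ech: "echelon a m J C E T"
begin

lemma ech_pivots: "C \<subseteq> {..<m}"
  and ech_delta: "c \<in> C \<Longrightarrow> c' \<in> C \<Longrightarrow> E c c' = (if c = c' then 1 else 0)"
  and ech_outside: "c \<in> C \<Longrightarrow> m \<le> l \<Longrightarrow> E c l = 0"
  and ech_row: "j \<in> J \<Longrightarrow> l < m \<Longrightarrow> of_int (a j l) = (\<Sum>c\<in>C. of_int (a j c) * E c l)"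
  and ech_comb: "c \<in> C \<Longrightarrow> l < m \<Longrightarrow> E c l = (\<Sum>j\<in>J. T c j * of_int (a j l))"
  by (insert ech[unfolded echelon_def]) meson+

lemma ech_pair:
  "j \<in> J \<Longrightarrow> pair a m \<xi> j = (\<Sum>c\<in>C. of_int (a j c) * (\<Sum>l<m. \<xi> l * E c l))"
  by (rule pair_eq_of_row_eq) (rule ech_row)

text \<open>Counterpart of \<open>ech_pair\<close>: the pairings with \<open>J\<close> and those
  with the pivot rows are combinations of each other. When \<open>T\<close> is integral, bounds by
  \<open>p\<close> carry over as well as vanishing, which is how \<open>F\<close> and the residue
  field get compared.\<close>

lemma ech_row_pair:
  assumes "c \<in> C"
  shows "(\<Sum>l<m. \<xi> l * E c l) = (\<Sum>j\<in>J. T c j * pair a m \<xi> j)"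
proof -
  have "(\<Sum>l<m. \<xi> l * E c l) = (\<Sum>l<m. \<xi> l * (\<Sum>j\<in>J. T c j * of_int (a j l)))"
    using assms by (intro sum.cong) (auto simp flip: ech_comb)
  also have "\<dots> = (\<Sum>j\<in>J. T c j * pair a m \<xi> j)"
    unfolding pair_def sum_distrib_left by (subst sum.swap) (simp add: mult_ac)
  finally show ?thesis .
qed

lemma ech_pivot_finite: "finite C"
  using ech_pivots finite_subset by blast

lemma ech_split:
  assumes "c \<in> C"
  shows "(\<Sum>l<m. \<xi> l * E c l) = \<xi> c + (\<Sum>l\<in>{..<m} - C. \<xi> l * E c l)"
proof -
  have "(\<Sum>l<m. \<xi> l * E c l) = (\<Sum>l\<in>{..<m} - C. \<xi> l * E c l) + (\<Sum>l\<in>C. \<xi> l * E c l)"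
    using ech_pivots by (intro sum.subset_diff) auto
  also have "(\<Sum>l\<in>C. \<xi> l * E c l) = (\<Sum>l\<in>C. if l = c then \<xi> c else 0)"
    using assms by (intro sum.cong) (auto simp: ech_delta)
  also have "\<dots> = \<xi> c" using assms ech_pivot_finite by simp
  finally show ?thesis by simp
qed

lemma ech_HJ:
  "HJ TYPE('a) a m J = {v. (\<forall>j\<ge>m. v j = 0) \<and> (\<forall>c\<in>C. (\<Sum>l<m. v l * E c l) = 0)}"
proof -
  have "(\<forall>i\<in>J. pair a m v i = 0) \<longleftrightarrow> (\<forall>c\<in>C. (\<Sum>l<m. v l * E c l) = 0)" for v
  proof
    assume "\<forall>i\<in>J. pair a m v i = 0"
    then show "\<forall>c\<in>C. (\<Sum>l<m. v l * E c l) = 0" by (simp add: ech_row_pair)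
  next
    assume "\<forall>c\<in>C. (\<Sum>l<m. v l * E c l) = 0"
    then show "\<forall>i\<in>J. pair a m v i = 0" by (simp add: ech_pair)
  qed
  then show ?thesis by (simp add: HJ_def pair_def)
qed

lemma kernel_vec_in_HJ:
  assumes "l \<in> {..<m} - C"
  shows "kernel_vec C E l \<in> HJ TYPE('a) a m J"
proof -
  have "(\<Sum>l'\<in>{..<m} - C. kernel_vec C E l l' * E c l') = E c l" for c
  proof -
    have "(\<Sum>l'\<in>{..<m} - C. kernel_vec C E l l' * E c l') = (\<Sum>l'\<in>{..<m} - C. if l' = l then E c l else 0)"
      by (intro sum.cong) (auto simp: kernel_vec_def)
    then show ?thesis using assms by simp
  qed
  then have "(\<Sum>l'<m. kernel_vec C E l l' * E c l') = 0" if "c \<in> C" for c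
    using assms that by (subst ech_split) (auto simp: kernel_vec_def)
  then show ?thesis
    using assms ech_pivots unfolding ech_HJ by (auto simp: kernel_vec_def)
qed

lemma ech_dim_HJ: "dimF (HJ TYPE('a) a m J) = m - card C"
proof -
  have "dimF (HJ TYPE('a) a m J) = card ({..<m} - C)"
  proof (rule dimF_reduced_basis[where w = "kernel_vec C E"])
    fix v :: "nat \<Rightarrow> 'a" assume v: "v \<in> HJ TYPE('a) a m J"
    have "v j = (\<Sum>x\<in>{..<m} - C. v x * kernel_vec C E x j)" for j
    proof (cases "j \<in> C")
      case True
      then have "(\<Sum>l<m. v l * E j l) = 0" using v unfolding ech_HJ by auto
      then have "v j = - (\<Sum>x\<in>{..<m} - C. v x * E j x)"
        using ech_split[OF True, of v] by (simp add: add_eq_0_iff2)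
      also have "\<dots> = (\<Sum>x\<in>{..<m} - C. v x * kernel_vec C E x j)"
        unfolding sum_negf[symmetric] using True by (intro sum.cong) (auto simp: kernel_vec_def)
      finally show ?thesis .
    next
      case False
      have "(\<Sum>x\<in>{..<m} - C. v x * kernel_vec C E x j) = (\<Sum>x\<in>{..<m} - C. if x = j then v j else 0)"
        using False by (intro sum.cong) (auto simp: kernel_vec_def)
      also have "\<dots> = v j" using False v by (auto simp: HJ_def)
      finally show ?thesis by simp
    qed
    then show "v = (\<lambda>j. \<Sum>x\<in>{..<m} - C. v x * kernel_vec C E x j)" by blast
  qed (auto simp: kernel_vec_in_HJ, auto simp: kernel_vec_def)
  also have "\<dots> = m - card C"
    using ech_pivots by (subst card_Diff_subset[OF ech_pivot_finite]) auto
  finally show ?thesis .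
qed

lemma ech_rk:
  assumes "finite J"
  shows "rk TYPE('a) a m J = card C"
  unfolding rk_def
proof (rule dimF_reduced_basis[where w = E])
  let ?V = "vecA TYPE('a) a m ` J"
  show "E c \<in> spanF ?V" if "c \<in> C" for c
  proof -
    \<comment> \<open>Sums in \<open>spanF\<close> run over the set of vectors, where equal rows
      coincide; \<open>t\<close> collects the coefficients of all indices giving the same
      vector.\<close>
    define t where "t v = (\<Sum>j\<in>{j \<in> J. vecA TYPE('a) a m j = v}. T c j)" for v
    have "(\<Sum>v\<in>?V. t v * v l) = E c l" for l
    proof -
      have "(\<Sum>v\<in>?V. t v * v l) =
          (\<Sum>v\<in>?V. \<Sum>j\<in>{j \<in> J. vecA TYPE('a) a m j = v}. T c j * vecA TYPE('a) a m j l)"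
        unfolding t_def sum_distrib_right by (intro sum.cong) auto
      also have "\<dots> = (\<Sum>j\<in>J. T c j * vecA TYPE('a) a m j l)"
        by (rule sum.image_gen[OF assms, symmetric])
      also have "\<dots> = E c l"
        using that ech_comb ech_outside by (cases "l < m") (simp_all add: vecA_def)
      finally show ?thesis .
    qed
    then show ?thesis unfolding spanF_def by (auto simp: fun_eq_iff intro!: exI[of _ t])
  qed
  show "v = (\<lambda>j. \<Sum>x\<in>C. v x * E x j)" if v: "v \<in> spanF ?V" for v
  proof
    fix l
    obtain t where t: "v = (\<lambda>j. \<Sum>v\<in>?V. t v * v j)" using v unfolding spanF_def by blast
    have row: "w l = (\<Sum>x\<in>C. w x * E x l)" if w: "w \<in> ?V" for w
    proof (cases "l < m")
      case True
      obtain j where j: "j \<in> J" "w = vecA TYPE('a) a m j" using w by blast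
      have "w l = of_int (a j l)" using True j by (simp add: vecA_def)
      also have "\<dots> = (\<Sum>c\<in>C. of_int (a j c) * E c l)"
        using ech_row True j by blast
      also have "\<dots> = (\<Sum>x\<in>C. w x * E x l)"
        using ech_pivots j by (intro sum.cong) (auto simp: vecA_def)
      finally show ?thesis .
    next
      case False
      then show ?thesis using w by (auto simp: vecA_def ech_outside)
    qed
    have "v l = (\<Sum>w\<in>?V. \<Sum>x\<in>C. t w * w x * E x l)"
    proof -
      have "v l = (\<Sum>w\<in>?V. t w * w l)" by (simp add: t)
      also have "\<dots> = (\<Sum>w\<in>?V. t w * (\<Sum>x\<in>C. w x * E x l))"
        using row by (intro sum.cong) auto
      finally show ?thesis by (simp add: sum_distrib_left mult.assoc)
    qed
    also have "\<dots> = (\<Sum>x\<in>C. v x * E x l)"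
      unfolding t by (subst sum.swap) (simp add: sum_distrib_right)
    finally show "v l = (\<Sum>x\<in>C. v x * E x l)" .
  qed
qed (auto simp: ech_delta ech_pivot_finite)

text \<open>The kernel vector of a free column \<open>l\<close> lies in the hyperplane of
  \<open>i\<close>, and its pairing with \<open>a i\<close> is exactly the difference of the two
  sides. For a pivot column the identity is trivial.\<close>

lemma ech_closure_row:
  assumes "HJ TYPE('a) a m J \<subseteq> HJ TYPE('a) a m {i}" "l < m"
  shows "of_int (a i l) = (\<Sum>c\<in>C. of_int (a i c) * E c l)"
proof (cases "l \<in> C")
  case True
  have "(\<Sum>c\<in>C. of_int (a i c) * E c l) = (\<Sum>c\<in>C. if c = l then of_int (a i l) else 0)"
    using True by (intro sum.cong) (auto simp: ech_delta)
  then show ?thesis using True ech_pivot_finite by simp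
next
  case False
  then have "kernel_vec C E l \<in> HJ TYPE('a) a m {i}"
    using kernel_vec_in_HJ assms by auto
  then have "0 = (\<Sum>j<m. kernel_vec C E l j * of_int (a i j))" by (simp add: HJ_def)
  also have "\<dots> = (\<Sum>j\<in>{..<m} - C. kernel_vec C E l j * of_int (a i j))
      + (\<Sum>j\<in>C. kernel_vec C E l j * of_int (a i j))"
    using ech_pivots by (intro sum.subset_diff) auto
  also have "(\<Sum>j\<in>C. kernel_vec C E l j * of_int (a i j)) = - (\<Sum>c\<in>C. of_int (a i c) * E c l)"
    unfolding sum_negf[symmetric] using False by (intro sum.cong) (auto simp: kernel_vec_def)
  also have "(\<Sum>j\<in>{..<m} - C. kernel_vec C E l j * of_int (a i j))
      = (\<Sum>j\<in>{..<m} - C. if j = l then of_int (a i l) else 0)"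
    by (intro sum.cong) (auto simp: kernel_vec_def)
  also have "\<dots> = of_int (a i l)" using False assms by simp
  finally show ?thesis by simp
qed

end

section \<open>Arithmetic of the local field\<close>

locale nonarch_local_field =
  fixes v :: "'a::field \<Rightarrow> real"
  assumes local_field: "local_field v"
begin

definition q :: real where "q = real (res_card v)"

lemma v_ge_0 [simp]: "v x \<ge> 0"
  and v_eq_0_iff [simp]: "v x = 0 \<longleftrightarrow> x = 0"
  and v_mult: "v (x * y) = v x * v y"
  and v_add: "v (x + y) \<le> max (v x) (v y)"
  and finite_residue_field: "finite (residue_field v)"
  and q_ge_2: "q \<ge> 2"
  and v_values: "v ` (UNIV - {0}) = range (\<lambda>k::int. q powi k)"
proof -
  note lf = local_field[unfolded local_field_def, folded q_def]
  note c1 = conjunct2[OF lf] note c2 = conjunct2[OF c1] note c3 = conjunct2[OF c2]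
  note c4 = conjunct2[OF c3] note c5 = conjunct2[OF c4]
  show "v x \<ge> 0" "v x = 0 \<longleftrightarrow> x = 0" using conjunct1[OF lf] by blast+
  show "v (x * y) = v x * v y" using conjunct1[OF c1] by simp
  show "v (x + y) \<le> max (v x) (v y)" using conjunct1[OF c2] by blast
  show "finite (residue_field v)" by (rule conjunct1[OF c3])
  show "q \<ge> 2" using conjunct1[OF c4] by (simp add: q_def)
  show "v ` (UNIV - {0}) = range (\<lambda>k::int. q powi k)" by (rule conjunct1[OF c5])
qed

lemma v_0 [simp]: "v 0 = 0" by simp

lemma v_1 [simp]: "v 1 = 1"
  using v_mult[of 1 1] v_eq_0_iff[of 1] by auto

lemma v_uminus [simp]: "v (- x) = v x"
proof -
  have "v (-1) * v (-1) = 1" using v_mult[of "-1" "-1"] by simp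
  then have "v (-1) = 1"
    using v_ge_0[of "-1"] by (metis abs_of_nonneg abs_square_eq_1 power2_eq_square)
  then show ?thesis using v_mult[of "-1" x] by simp
qed

lemma v_diff: "v (x - y) \<le> max (v x) (v y)"
  using v_add[of x "- y"] by simp

lemma v_minus_commute: "v (x - y) = v (y - x)"
  using v_uminus[of "x - y"] by simp

lemma v_add_le: "v x \<le> r \<Longrightarrow> v y \<le> r \<Longrightarrow> v (x + y) \<le> r"
  using v_add[of x y] by linarith

lemma v_diff_le: "v x \<le> r \<Longrightarrow> v y \<le> r \<Longrightarrow> v (x - y) \<le> r"
  using v_diff[of x y] by linarith

lemma v_diff_trans: "v (x - y) \<le> r \<Longrightarrow> v (y - z) \<le> r \<Longrightarrow> v (x - z) \<le> r"
  using v_add_le[of "x - y" r "y - z"] by simp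

lemma v_mult_le: "v x \<le> 1 \<Longrightarrow> v y \<le> r \<Longrightarrow> v (x * y) \<le> r"
  unfolding v_mult using mult_mono[of "v x" 1 "v y" r] by simp

lemma v_mult_le': "v x \<le> r \<Longrightarrow> v y \<le> 1 \<Longrightarrow> v (x * y) \<le> r"
  using v_mult_le[of y x r] by (simp add: mult.commute)

lemma v_sum_le: "0 \<le> r \<Longrightarrow> (\<And>i. i \<in> A \<Longrightarrow> v (f i) \<le> r) \<Longrightarrow> v (\<Sum>i\<in>A. f i) \<le> r"
  by (induction A rule: infinite_finite_induct) (auto intro!: v_add_le)

lemma v_of_nat: "v (of_nat n) \<le> 1"
  by (induction n) (auto intro: v_add_le)

lemma v_of_int: "v (of_int k) \<le> 1"
  by (cases k rule: int_cases2) (auto simp: v_of_nat)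

lemma v_divide: "v (x / y) = v x / v y"
proof (cases "y = 0")
  case False
  then have "v (x / y) * v y = v x" using v_mult[of "x / y" y] by simp
  then show ?thesis using False by (simp add: field_simps)
qed simp

lemma v_eq_of_close: "v (x - y) < v x \<Longrightarrow> v y = v x"
  using v_add[of "x - y" y] v_diff[of x "x - y"] by (simp split: if_splits add: max_def)

text \<open>\<open>p\<close> is the absolute value of a uniformizer, so \<open>v x \<le> p ^ k\<close> expresses membership in the
  \<open>k\<close>-th power of the maximal ideal.\<close>
definition p :: real where "p = 1 / q"

lemma p_pos [simp]: "p > 0" and p_nonzero [simp]: "p \<noteq> 0" and p_less_1 [simp]: "p < 1"
  using q_ge_2 by (simp_all add: p_def)

lemma q_pos [simp]: "q > 0" using q_ge_2 by simp

lemma q_nonzero [simp]: "q \<noteq> 0" using q_ge_2 by simp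

lemma q_gt_1 [simp]: "q > 1" using q_ge_2 by simp

lemma p_power_pos [simp]: "p ^ k > 0" by simp

lemma p_power_le_1 [simp]: "p ^ k \<le> 1"
  by (rule power_le_one) (simp_all add: less_imp_le)

lemma q_power_p_power [simp]: "q ^ k * p ^ k = 1" "p ^ k * q ^ k = 1"
  by (simp_all add: p_def power_one_over)

lemma v_cases_integral:
  assumes "v x \<le> 1" "x \<noteq> 0"
  obtains k where "v x = p ^ k"
proof -
  obtain i :: int where i: "v x = q powi i"
    using v_values assms(2) by (metis DiffI UNIV_I image_eqI imageE singletonD)
  have "i \<le> 0"
  proof (rule ccontr)
    assume "\<not> i \<le> 0"
    then have "q powi i > 1" by (simp add: power_int_def)
    then show False using assms i by simp
  qed
  then have "v x = p ^ nat (- i)"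
    using i by (simp add: power_int_def p_def power_one_over inverse_eq_divide split: if_splits)
  then show thesis by (rule that)
qed

text \<open>Discreteness: no value lies strictly between \<open>p\<close> and 1. Membership in the
  maximal ideal thus becomes a bound by a power of \<open>p\<close>.\<close>

lemma v_less_1_iff: "v x < 1 \<longleftrightarrow> v x \<le> p"
proof
  assume *: "v x < 1"
  show "v x \<le> p"
  proof (cases "x = 0")
    case False
    then obtain k where k: "v x = p ^ k" using v_cases_integral[of x] * by auto
    then have "k \<noteq> 0" using * by (cases k) auto
    then show ?thesis using k power_decreasing[of 1 k p] by (simp add: less_imp_le)
  qed (simp add: less_imp_le)
next
  assume "v x \<le> p"
  then show "v x < 1" using p_less_1 by linarith
qed

definition uniformizer :: 'a where "uniformizer = (SOME x. v x = p)"

lemma v_uniformizer [simp]: "v uniformizer = p"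
proof -
  have "p \<in> range (\<lambda>k::int. q powi k)"
    by (rule image_eqI[of _ _ "-1"]) (auto simp: p_def inverse_eq_divide)
  then obtain x where "v x = p" using v_values by (metis imageE)
  then show ?thesis unfolding uniformizer_def by (rule someI)
qed

lemma uniformizer_nonzero [simp]: "uniformizer \<noteq> 0"
  using v_uniformizer p_pos by (metis less_irrefl v_0)

section \<open>Digits and representatives modulo powers of the maximal ideal\<close>

definition digits :: "'a set" where "digits = (\<lambda>S. SOME x. x \<in> S) ` residue_field v"

lemma digits_props:
  shows finite_digits: "finite digits" and card_digits: "real (card digits) = q"
    and v_digit: "d \<in> digits \<Longrightarrow> v d \<le> 1"
    and digit_unique: "d \<in> digits \<Longrightarrow> d' \<in> digits \<Longrightarrow> v (d - d') \<le> p \<Longrightarrow> d = d'"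
    and digit_exists: "v x \<le> 1 \<Longrightarrow> \<exists>d\<in>digits. v (x - d) \<le> p"
proof -
  define cls where "cls x = {y \<in> ringO v. x - y \<in> maxideal v}" for x
  have R: "residue_field v = cls ` ringO v" by (simp add: residue_field_def cls_def)
  have mem: "y \<in> cls x \<longleftrightarrow> v y \<le> 1 \<and> v (x - y) \<le> p" for x y
    by (auto simp: cls_def ringO_def maxideal_def v_less_1_iff)
  have eq: "cls x = cls y" if "v (x - y) \<le> p" for x y
    using that v_diff_trans[of x y p] v_diff_trans[of y x p]
    by (auto simp: mem set_eq_iff v_minus_commute)
  have rep: "(SOME y. y \<in> cls x) \<in> cls x" if "v x \<le> 1" for x
    by (rule someI[of _ x]) (use that in \<open>simp add: mem less_imp_le\<close>)
  define f where "f S = (SOME x. x \<in> S)" for S :: "'a set"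
  have D: "digits = f ` cls ` ringO v" by (simp add: digits_def R f_def)
  have cf: "cls (f (cls x)) = cls x" if "v x \<le> 1" for x
    using rep[OF that, folded f_def] eq[of x "f (cls x)"] mem[of "f (cls x)" x] by simp
  have inj: "inj_on f (residue_field v)"
    unfolding R by (rule inj_onI) (auto simp: ringO_def, (metis cf)+)
  show "finite digits" using finite_residue_field by (simp add: digits_def)
  show "real (card digits) = q"
    using card_image[OF inj] by (simp add: digits_def q_def res_card_def f_def)
  show "v d \<le> 1" if "d \<in> digits"
    using that rep by (auto simp: D f_def ringO_def mem)
  show "d = d'" if dd: "d \<in> digits" "d' \<in> digits" "v (d - d') \<le> p"
  proof -
    obtain x x' where x: "v x \<le> 1" "d = f (cls x)" "v x' \<le> 1" "d' = f (cls x')"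
      using dd(1,2) by (auto simp: D ringO_def)
    then have "cls x = cls x'" using cf eq[OF dd(3)] by metis
    then show ?thesis using x by simp
  qed
  show "\<exists>d\<in>digits. v (x - d) \<le> p" if "v x \<le> 1"
    using rep[OF that, folded f_def] that mem[of "f (cls x)" x]
    by (intro bexI[of _ "f (cls x)"]) (auto simp: D ringO_def)
qed

text \<open>Representatives of the integers modulo the \<open>k\<close>-th power of the maximal ideal.\<close>
primrec reps :: "nat \<Rightarrow> 'a set" where
  "reps 0 = {0}"
| "reps (Suc k) = (\<lambda>(d, e). d + uniformizer * e) ` (digits \<times> reps k)"

lemma reps_1: "reps (Suc 0) = digits" by (auto simp: image_iff)

lemma finite_reps [simp]: "finite (reps k)"
  by (induction k) (auto simp: finite_digits)

lemma v_reps: "d \<in> reps k \<Longrightarrow> v d \<le> 1"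
  by (induction k arbitrary: d)
     (auto intro!: v_add_le v_mult_le dest: v_digit simp: less_imp_le)

lemma v_uniformizer_mult_le: "v (uniformizer * x) \<le> p ^ Suc k \<longleftrightarrow> v x \<le> p ^ k"
  by (simp add: v_mult)

text \<open>Reduction modulo the maximal ideal kills both remainders, so closeness forces equal
  digits; these cancel, and dividing by the uniformizer lowers the level by one.\<close>

lemma digit_split_close:
  assumes "d \<in> digits" "d' \<in> digits" "v e \<le> 1" "v e' \<le> 1"
  shows "v ((d + uniformizer * e) - (d' + uniformizer * e')) \<le> p ^ Suc k
    \<longleftrightarrow> d = d' \<and> v (e - e') \<le> p ^ k"
proof
  let ?x = "(d + uniformizer * e) - (d' + uniformizer * e')"
  assume L: "v ?x \<le> p ^ Suc k"
  have "p ^ Suc k \<le> p" using power_decreasing[of 1 "Suc k" p] by (simp add: less_imp_le)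
  then have "v ?x \<le> p" using L by linarith
  moreover have "v (uniformizer * (e - e')) \<le> p"
    using v_diff_le[OF assms(3,4)] by (intro v_mult_le') (simp_all)
  ultimately have "v (?x - uniformizer * (e - e')) \<le> p" by (rule v_diff_le)
  moreover have "?x - uniformizer * (e - e') = d - d'" by (simp add: algebra_simps)
  ultimately have d: "d = d'" using digit_unique assms by simp
  have "v (uniformizer * (e - e')) \<le> p ^ Suc k" using L d by (simp add: algebra_simps)
  then show "d = d' \<and> v (e - e') \<le> p ^ k" using d v_uniformizer_mult_le by blast
next
  assume "d = d' \<and> v (e - e') \<le> p ^ k"
  then show "v ((d + uniformizer * e) - (d' + uniformizer * e')) \<le> p ^ Suc k"
    using v_uniformizer_mult_le[of "e - e'" k] by (simp add: algebra_simps)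
qed

lemma reps_unique: "d \<in> reps k \<Longrightarrow> d' \<in> reps k \<Longrightarrow> v (d - d') \<le> p ^ k \<Longrightarrow> d = d'"
proof (induction k arbitrary: d d')
  case (Suc k)
  obtain c e c' e' where *: "d = c + uniformizer * e" "c \<in> digits" "e \<in> reps k"
    "d' = c' + uniformizer * e'" "c' \<in> digits" "e' \<in> reps k"
    using Suc.prems(1,2) by auto
  have "c = c' \<and> v (e - e') \<le> p ^ k"
    using Suc.prems(3) digit_split_close[of c c' e e' k] * v_reps by blast
  then show ?case using Suc.IH * by blast
qed simp

lemma inj_on_digit_split: "inj_on (\<lambda>(d, e). d + uniformizer * e) (digits \<times> reps k)"
proof (rule inj_onI, clarsimp)
  fix d e d' e' assume *: "d \<in> digits" "e \<in> reps k" "d' \<in> digits" "e' \<in> reps k"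
    "d + uniformizer * e = d' + uniformizer * e'"
  then have "v ((d + uniformizer * e) - (d' + uniformizer * e')) \<le> p ^ Suc k" 
    by (simp add: less_imp_le)
  then have "d = d' \<and> v (e - e') \<le> p ^ k"
    using digit_split_close[of d d' e e' k] * v_reps by blast
  then show "d = d' \<and> e = e'" using reps_unique * by blast
qed

lemma card_reps: "real (card (reps k)) = q ^ k"
  by (induction k)
     (simp_all add: card_image[OF inj_on_digit_split] card_cartesian_product card_digits)

lemma reps_exists: "v x \<le> 1 \<Longrightarrow> \<exists>d\<in>reps k. v (x - d) \<le> p ^ k"
proof (induction k arbitrary: x)
  case (Suc k)
  obtain d where d: "d \<in> digits" "v (x - d) \<le> p" using digit_exists Suc.prems by blast
  define y where "y = (x - d) / uniformizer"
  have "v y \<le> 1" using d by (simp add: y_def v_divide)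
  then obtain e where e: "e \<in> reps k" "v (y - e) \<le> p ^ k" using Suc.IH by blast
  have "x - (d + uniformizer * e) = uniformizer * (y - e)" by (simp add: y_def field_simps)
  then have "v (x - (d + uniformizer * e)) \<le> p ^ Suc k" using e v_uniformizer_mult_le by metis
  then show ?case using d e by force
qed simp

definition rep :: "nat \<Rightarrow> 'a \<Rightarrow> 'a" where
  "rep k x = (SOME d. d \<in> reps k \<and> v (x - d) \<le> p ^ k)"

lemma rep: assumes "v x \<le> 1" shows "rep k x \<in> reps k" "v (x - rep k x) \<le> p ^ k"
  using someI_ex[of "\<lambda>d. d \<in> reps k \<and> v (x - d) \<le> p ^ k"] reps_exists[OF assms]
  unfolding rep_def by blast+

lemma rep_eqI: "d \<in> reps k \<Longrightarrow> v (x - d) \<le> p ^ k \<Longrightarrow> v x \<le> 1 \<Longrightarrow> rep k x = d"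
  using reps_unique rep v_diff_trans v_minus_commute by metis

text \<open>For \<open>j > 0\<close> the leading digit of \<open>d\<close> is forced by
  \<open>c\<close>; removing it leaves the same problem with \<open>k\<close> and \<open>j\<close>
  lowered by one and with the remainder of \<open>c\<close> as centre. At \<open>j = 0\<close> there
  is no condition.\<close>

lemma card_reps_ball:
  "j \<le> k \<Longrightarrow> v c \<le> 1 \<Longrightarrow> real (card {d \<in> reps k. v (d - c) \<le> p ^ j}) = q ^ (k - j)"
proof (induction k arbitrary: j c)
  case 0
  then have "{d \<in> reps 0. v (d - c) \<le> p ^ j} = {0}" by auto
  then show ?case using 0 by simp
next
  case (Suc k)
  show ?case
  proof (cases j)
    case 0
    have "{d \<in> reps (Suc k). v (d - c) \<le> p ^ j} = reps (Suc k)"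
      using Suc.prems v_reps[of _ "Suc k"] 0 by (auto simp del: reps.simps intro: v_diff_le)
    then show ?thesis using card_reps[of "Suc k"] 0 by simp
  next
    case (Suc i)
    obtain d where d: "d \<in> digits" "v (c - d) \<le> p" using digit_exists Suc.prems by blast
    define y where "y = (c - d) / uniformizer"
    have y: "v y \<le> 1" using d by (simp add: y_def v_divide)
    have c: "c = d + uniformizer * y" by (simp add: y_def)
    have "{x \<in> reps (Suc k). v (x - c) \<le> p ^ j}
        = (\<lambda>(d, e). d + uniformizer * e) ` ({d} \<times> {e \<in> reps k. v (e - y) \<le> p ^ i})"
      using d digit_split_close[OF _ d(1) _ y] v_reps unfolding c Suc by (fastforce simp del: power_Suc)
    moreover have "inj_on (\<lambda>(d, e). d + uniformizer * e) ({d} \<times> {e \<in> reps k. v (e - y) \<le> p ^ i})"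
      by (rule inj_on_subset[OF inj_on_digit_split[of k]]) (use d in auto)
    ultimately show ?thesis
      using Suc.IH[of i y] y Suc.prems Suc by (simp add: card_image card_cartesian_product)
  qed
qed

text \<open>For integral \<open>t\<close>, the density of the solutions \<open>d\<close> of
  \<open>t * d \<equiv> 0\<close> modulo level \<open>k\<close>; the maximum in the denominator
  gives 1 at \<open>t = 0\<close> without a case distinction.\<close>

definition phi :: "nat \<Rightarrow> 'a \<Rightarrow> real" where "phi k t = p ^ k / max (v t) (p ^ k)"

text \<open>If \<open>a\<close> vanishes modulo level \<open>k\<close>, so does \<open>b\<close>,
  and every \<open>d\<close> is a solution. Otherwise the solutions form a ball around
  \<open>- b / a\<close>, which is integral because \<open>v b \<le> v a\<close>.\<close>

lemma card_reps_affine: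
  assumes "v a \<le> 1" "v b \<le> v a"
  shows "real (card {d \<in> reps k. v (a * d + b) \<le> p ^ k}) = q ^ k * phi k a"
proof (cases "v a \<le> p ^ k")
  case True
  have "{d \<in> reps k. v (a * d + b) \<le> p ^ k} = reps k"
    using True assms v_reps by (auto intro!: v_add_le v_mult_le')
  then show ?thesis using True by (simp add: card_reps phi_def max_def)
next
  case False
  then have a0: "a \<noteq> 0" by (metis less_imp_le p_power_pos v_0)
  then obtain j where j: "v a = p ^ j" using v_cases_integral assms by blast
  have jk: "j < k" using False j by (metis linorder_not_less less_imp_le p_less_1 p_pos power_decreasing)
  have "v (a * d + b) \<le> p ^ k \<longleftrightarrow> v (d - (- b / a)) \<le> p ^ (k - j)" for d
  proof -
    have "a * d + b = a * (d - (- b / a))" using a0 by (simp add: field_simps)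
    then have "v (a * d + b) = p ^ j * v (d - (- b / a))" using v_mult j by metis
    moreover have "p ^ k = p ^ j * p ^ (k - j)" using jk by (simp flip: power_add)
    ultimately show ?thesis by (simp add: mult_le_cancel_left_pos)
  qed
  moreover have "v (- b / a) \<le> 1"
    using assms(2) a0 order.not_eq_order_implies_strict[of 0 "v a"]
    by (simp add: v_divide divide_le_eq_1_pos)
  ultimately have "real (card {d \<in> reps k. v (a * d + b) \<le> p ^ k}) = q ^ (k - (k - j))"
    using card_reps_ball[of "k - j" k "- b / a"] by simp
  also have "\<dots> = q ^ k * phi k a"
    using jk False j by (simp add: phi_def max_def p_def power_one_over)
  finally show ?thesis .
qed

end

section \<open>Kernels of a matrix and of its transpose\<close>

lemma sum_PiE_insert:
  fixes f :: "('i \<Rightarrow> 'b) \<Rightarrow> 'c::comm_monoid_add"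
  assumes "j \<notin> Y"
  shows "(\<Sum>x\<in>PiE (insert j Y) D. f x) = (\<Sum>x\<in>PiE Y D. \<Sum>d\<in>D j. f (x(j := d)))"
proof -
  have "(\<Sum>x\<in>PiE (insert j Y) D. f x) = (\<Sum>(d, x)\<in>D j \<times> PiE Y D. f (x(j := d)))"
    unfolding PiE_insert_eq
    by (subst sum.reindex) (use inj_combinator[OF assms] in \<open>auto simp: case_prod_unfold\<close>)
  also have "\<dots> = (\<Sum>d\<in>D j. \<Sum>x\<in>PiE Y D. f (x(j := d)))"
    by (rule sum.cartesian_product[symmetric])
  finally show ?thesis by (simp add: sum.swap[of _ "D j"])
qed

context nonarch_local_field
begin

text \<open>Normalising by the number of points makes the count comparable with that for the
  transpose, whose unknowns are indexed by a set of another size.\<close>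

definition kernel_frac :: "nat \<Rightarrow> 'i set \<Rightarrow> 'j set \<Rightarrow> ('i \<Rightarrow> 'j \<Rightarrow> 'a) \<Rightarrow> real" where
  "kernel_frac k X Y A =
     real (card {x \<in> PiE Y (\<lambda>_. reps k). \<forall>i\<in>X. v (\<Sum>j\<in>Y. A i j * x j) \<le> p ^ k}) * p ^ (k * card Y)"

lemma card_cube: "finite Y \<Longrightarrow> real (card (PiE Y (\<lambda>_. reps k))) = q ^ (k * card Y)"
  by (simp add: card_PiE card_reps power_mult)

lemma kernel_frac_eq_1:
  assumes "finite Y" "\<And>i j. i \<in> X \<Longrightarrow> j \<in> Y \<Longrightarrow> A i j = 0"
  shows "kernel_frac k X Y A = 1"
proof -
  have "(\<Sum>j\<in>Y. A i j * x j) = 0" if "i \<in> X" for i x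
    using assms(2) that by (intro sum.neutral) auto
  then have "{x \<in> PiE Y (\<lambda>_. reps k). \<forall>i\<in>X. v (\<Sum>j\<in>Y. A i j * x j) \<le> p ^ k} = PiE Y (\<lambda>_. reps k)"
    by (auto simp: less_imp_le)
  then show ?thesis unfolding kernel_frac_def by (simp only: card_cube[OF assms(1)] q_power_p_power)
qed

text \<open>Since the pivot has the largest absolute value, the multipliers
  \<open>A i j0 / A i0 j0\<close> are integral and elimination is reversible modulo level
  \<open>k\<close>. The pivot row then leaves the proportion \<open>phi k (A i0 j0)\<close> of the
  values of \<open>x j0\<close>, whatever the other coordinates are, and the other rows become the
  Schur complement.\<close>

lemma kernel_frac_pivot:
  assumes fin: "finite Y" and i0: "i0 \<in> X" and j0: "j0 \<in> Y" and nz: "A i0 j0 \<noteq> 0"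
    and int: "v (A i0 j0) \<le> 1"
    and pivot: "\<And>i j. i \<in> X \<Longrightarrow> j \<in> Y \<Longrightarrow> v (A i j) \<le> v (A i0 j0)"
  shows "kernel_frac k X Y A = phi k (A i0 j0) *
    kernel_frac k (X - {i0}) (Y - {j0}) (\<lambda>i j. A i j - A i j0 * A i0 j / A i0 j0)"
proof -
  define a where "a = A i0 j0"
  define Y' where "Y' = Y - {j0}"
  define A' where "A' i j = A i j - A i j0 * A i0 j / a" for i j
  define P where "P x \<longleftrightarrow> (\<forall>i\<in>X. v (\<Sum>j\<in>Y. A i j * x j) \<le> p ^ k)" for x
  define P' where "P' x \<longleftrightarrow> (\<forall>i\<in>X - {i0}. v (\<Sum>j\<in>Y'. A' i j * x j) \<le> p ^ k)" for x
  have Y: "Y = insert j0 Y'" "j0 \<notin> Y'" "finite Y'" using j0 fin by (auto simp: Y'_def)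
  have a: "a \<noteq> 0" "v a > 0" using nz v_ge_0[of a] v_eq_0_iff[of a] by (auto simp: a_def order_less_le)
  have step: "P (x(j0 := d)) \<longleftrightarrow> v (a * d + (\<Sum>j\<in>Y'. A i0 j * x j)) \<le> p ^ k \<and> P' x" for x d
  proof -
    define b where "b = (\<Sum>j\<in>Y'. A i0 j * x j)"
    have row: "(\<Sum>j\<in>Y. A i j * (x(j0 := d)) j) = A i j0 * d + (\<Sum>j\<in>Y'. A i j * x j)" for i
    proof -
      have "(\<Sum>j\<in>Y'. A i j * (x(j0 := d)) j) = (\<Sum>j\<in>Y'. A i j * x j)"
        using Y(2) by (intro sum.cong) auto
      then show ?thesis using Y by simp
    qed
    have elim: "A i j0 * d + (\<Sum>j\<in>Y'. A i j * x j) = A i j0 / a * (a * d + b) + (\<Sum>j\<in>Y'. A' i j * x j)" for i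
    proof -
      have "(\<Sum>j\<in>Y'. A' i j * x j) = (\<Sum>j\<in>Y'. A i j * x j) - A i j0 / a * b"
        by (simp add: A'_def b_def algebra_simps sum_subtractf sum_distrib_left)
      then show ?thesis using a by (simp add: field_simps)
    qed
    have quot: "v (A i j0 / a) \<le> 1" if "i \<in> X" for i
      using pivot[OF that j0] a by (simp add: v_divide a_def)
    have "v (A i j0 * d + (\<Sum>j\<in>Y'. A i j * x j)) \<le> p ^ k \<longleftrightarrow> v (\<Sum>j\<in>Y'. A' i j * x j) \<le> p ^ k"
      if "i \<in> X" "v (a * d + b) \<le> p ^ k" for i
    proof -
      have t: "v (A i j0 / a * (a * d + b)) \<le> p ^ k" using quot that by (intro v_mult_le)
      show ?thesis unfolding elim
        using v_add_le[OF t] v_diff_le[OF _ t, of "A i j0 / a * (a * d + b) + (\<Sum>j\<in>Y'. A' i j * x j)"]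
        by auto
    qed
    then show ?thesis
      unfolding P_def P'_def row b_def[symmetric]
      using i0 by (auto simp: a_def b_def)
  qed
  have count: "real (card {d \<in> reps k. P (x(j0 := d))}) = (if P' x then q ^ k * phi k a else 0)"
    if x: "x \<in> PiE Y' (\<lambda>_. reps k)" for x
  proof -
    have "v (\<Sum>j\<in>Y'. A i0 j * x j) \<le> v a"
    proof (rule v_sum_le)
      fix j assume "j \<in> Y'"
      then show "v (A i0 j * x j) \<le> v a"
        using pivot[OF i0, of j] v_reps[of "x j" k] x Y by (intro v_mult_le') (auto simp: a_def PiE_def)
    qed simp
    then show ?thesis
      using card_reps_affine[of a "\<Sum>j\<in>Y'. A i0 j * x j" k] int by (simp add: step a_def)
  qed
  have "real (card {x \<in> PiE Y (\<lambda>_. reps k). P x}) = (\<Sum>x\<in>PiE Y (\<lambda>_. reps k). if P x then 1 else 0)"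
    using fin by (simp add: sum.If_cases finite_PiE Int_def)
  also have "\<dots> = (\<Sum>x\<in>PiE Y' (\<lambda>_. reps k). \<Sum>d\<in>reps k. if P (x(j0 := d)) then 1 else 0)"
    unfolding Y(1) by (rule sum_PiE_insert[OF Y(2)])
  also have "\<dots> = (\<Sum>x\<in>PiE Y' (\<lambda>_. reps k). real (card {d \<in> reps k. P (x(j0 := d))}))"
    by (simp add: sum.If_cases Int_def)
  also have "\<dots> = (\<Sum>x\<in>PiE Y' (\<lambda>_. reps k). if P' x then q ^ k * phi k a else 0)"
    using count by (rule sum.cong[OF refl])
  also have "\<dots> = q ^ k * phi k a * real (card {x \<in> PiE Y' (\<lambda>_. reps k). P' x})"
    using Y(3) by (simp add: sum.If_cases finite_PiE Int_def)
  finally have "kernel_frac k X Y A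
      = q ^ k * phi k a * real (card {x \<in> PiE Y' (\<lambda>_. reps k). P' x}) * p ^ (k * card Y)"
    by (simp add: kernel_frac_def P_def)
  also have "p ^ (k * card Y) = p ^ k * p ^ (k * card Y')"
    using Y by (simp add: power_add)
  finally have "kernel_frac k X Y A
      = (q ^ k * p ^ k) * (phi k a * (real (card {x \<in> PiE Y' (\<lambda>_. reps k). P' x}) * p ^ (k * card Y')))"
    by (simp only: mult_ac)
  then show ?thesis by (simp add: kernel_frac_def P'_def A'_def a_def Y'_def)
qed

text \<open>Pivoting commutes with transposition: a largest entry is a pivot for both matrices,
  contributes the same factor \<open>phi\<close>, and the Schur complement of the transpose is the
  transpose of the Schur complement.\<close>

lemma kernel_frac_transpose:
  assumes "finite X" "finite Y" "\<And>i j. i \<in> X \<Longrightarrow> j \<in> Y \<Longrightarrow> v (A i j) \<le> 1"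
  shows "kernel_frac k X Y A = kernel_frac k Y X (\<lambda>j i. A i j)"
  using assms
proof (induction "card X" arbitrary: X Y A)
  case 0
  then have "X = {}" by simp
  then show ?case using 0 kernel_frac_eq_1[of Y X A k] kernel_frac_eq_1[of X Y "\<lambda>j i. A i j" k] by simp
next
  case (Suc c)
  show ?case
  proof (cases "\<forall>i\<in>X. \<forall>j\<in>Y. A i j = 0")
    case True
    then show ?thesis using Suc.prems by (simp add: kernel_frac_eq_1)
  next
    case False
    then have ne: "X \<times> Y \<noteq> {}" by blast
    define M where "M = Max ((\<lambda>(i, j). v (A i j)) ` (X \<times> Y))"
    have fin: "finite ((\<lambda>(i, j). v (A i j)) ` (X \<times> Y))" using Suc.prems by simp
    have "M \<in> (\<lambda>(i, j). v (A i j)) ` (X \<times> Y)"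
      unfolding M_def using ne by (intro Max_in[OF fin]) auto
    then obtain i0 j0 where ij: "i0 \<in> X" "j0 \<in> Y" "M = v (A i0 j0)" by auto
    have le: "v (A i j) \<le> v (A i0 j0)" if "i \<in> X" "j \<in> Y" for i j
    proof -
      have "v (A i j) \<le> M" unfolding M_def by (rule Max_ge[OF fin]) (use that in force)
      then show ?thesis using ij by simp
    qed
    have nz: "A i0 j0 \<noteq> 0"
    proof
      assume "A i0 j0 = 0"
      then have "v (A i j) = 0" if "i \<in> X" "j \<in> Y" for i j
        using le[OF that] v_ge_0[of "A i j"] by simp
      then show False using False by simp
    qed
    let ?A' = "\<lambda>i j. A i j - A i j0 * A i0 j / A i0 j0"
    \<comment> \<open>Quotients by the pivot are integral, so the Schur complement has integral
      entries again, as the induction needs.\<close>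
    have "v (?A' i j) \<le> 1" if "i \<in> X" "j \<in> Y" for i j
    proof (rule v_diff_le)
      show "v (A i j) \<le> 1" using Suc.prems that by blast
      have "v (A i0 j / A i0 j0) \<le> 1"
        using le[OF ij(1) that(2)] nz by (simp add: v_divide divide_le_eq_1_pos less_le)
      then have "v (A i j0 * (A i0 j / A i0 j0)) \<le> 1"
        using Suc.prems(3)[OF that(1) ij(2)] by (intro v_mult_le)
      then show "v (A i j0 * A i0 j / A i0 j0) \<le> 1" by simp
    qed
    then have IH: "kernel_frac k (X - {i0}) (Y - {j0}) ?A' = kernel_frac k (Y - {j0}) (X - {i0}) (\<lambda>j i. ?A' i j)"
      using Suc.hyps(2) Suc.prems ij by (intro Suc.hyps(1)) auto
    have int: "v (A i0 j0) \<le> 1" using Suc.prems ij by blast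
    have "kernel_frac k X Y A = phi k (A i0 j0) * kernel_frac k (X - {i0}) (Y - {j0}) ?A'"
      by (rule kernel_frac_pivot[where A = A]) (use Suc.prems ij nz int le in auto)
    moreover have "kernel_frac k Y X (\<lambda>j i. A i j)
        = phi k (A i0 j0) * kernel_frac k (Y - {j0}) (X - {i0}) (\<lambda>j i. A i j - A i0 j * A i j0 / A i0 j0)"
      by (rule kernel_frac_pivot[where A = "\<lambda>j i. A i j"]) (use Suc.prems ij nz int le in auto)
    ultimately show ?thesis using IH by (simp add: mult.commute)
  qed
qed

end

section \<open>The arrangement over the residue field\<close>

lemma mobius_sum:
  assumes "J \<in> L" "K \<in> L" "J \<subseteq> K" "finite K"
  shows "(\<Sum>G\<in>{G\<in>L. J \<subseteq> G \<and> G \<subseteq> K}. mobius L J G) = (if J = K then 1 else 0)"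
proof (cases "J = K")
  case True
  then have "{G\<in>L. J \<subseteq> G \<and> G \<subseteq> K} = {J}" using assms by auto
  then show ?thesis using assms True by (simp add: mobius.simps)
next
  case False
  have "{G\<in>L. J \<subseteq> G \<and> G \<subseteq> K} = insert K {G\<in>L. J \<subseteq> G \<and> G \<subset> K}" using assms by auto
  moreover have "finite {G\<in>L. J \<subseteq> G \<and> G \<subset> K}"
    by (rule finite_subset[of _ "Pow K"]) (use assms in auto)
  moreover have "mobius L J K = - (\<Sum>G\<in>{G\<in>L. J \<subseteq> G \<and> G \<subset> K}. mobius L J G)"
    using assms False by (subst mobius.simps) auto
  ultimately show ?thesis using False by (simp del: mobius.simps)
qed

text \<open>The target field is left open because the same integer data are used over
  \<open>F\<close> and over the rationals.\<close>

lemma echelon_divide: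
  assumes "C \<subseteq> {..<m}" "(of_int D :: 'b::field) \<noteq> 0"
    and delta: "\<And>c c'. c \<in> C \<Longrightarrow> c' \<in> C \<Longrightarrow> Z c c' = (if c = c' then D else 0)"
    and row: "\<And>j l. j \<in> J \<Longrightarrow> l < m \<Longrightarrow> D * a j l = (\<Sum>c\<in>C. a j c * Z c l)"
    and comb: "\<And>c l. c \<in> C \<Longrightarrow> Z c l = (\<Sum>j\<in>J. T c j * a j l)"
  shows "echelon a m J C (\<lambda>c l. if l < m then of_int (Z c l) / of_int D else 0 :: 'b)
    (\<lambda>c j. of_int (T c j) / of_int D)" (is "echelon a m J C ?E ?T")
proof -
  have "of_int (a j l) = (\<Sum>c\<in>C. of_int (a j c) * ?E c l)" if "j \<in> J" "l < m" for j l
  proof -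
    have "of_int D * of_int (a j l) = (of_int (\<Sum>c\<in>C. a j c * Z c l) :: 'b)"
      using row[OF that] by (metis of_int_mult)
    then have "of_int D * of_int (a j l) = of_int D * (\<Sum>c\<in>C. of_int (a j c) * ?E c l)"
      using assms(2) that by (simp add: sum_distrib_left)
    then show ?thesis using assms(2) by (metis mult_left_cancel)
  qed
  moreover have "?E c l = (\<Sum>j\<in>J. ?T c j * of_int (a j l))" if "c \<in> C" "l < m" for c l
    using that comb[OF that(1), of l] by (simp add: sum_divide_distrib)
  moreover have "?E c c' = (if c = c' then 1 else 0)" if "c \<in> C" "c' \<in> C" for c c'
    using that assms(1,2) delta[OF that] by auto
  moreover have "?E c l = 0" if "l \<ge> m" for c l using that by simp
  ultimately show ?thesis unfolding echelon_def using assms(1) by blast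
qed

section \<open>Integral echelon bases from the bound on the minors\<close>

locale hypertoric = nonarch_local_field v
  for v :: "'a::field \<Rightarrow> real" +
  fixes a :: "nat \<Rightarrow> nat \<Rightarrow> int" and n m :: nat
  assumes span: "\<forall>w::nat \<Rightarrow> rat. \<exists>c::nat \<Rightarrow> rat. \<forall>j<m. (\<Sum>i<n. c i * of_int (a i j)) = w j"
    and minors: "\<forall>R C. R \<subseteq> {..<n} \<and> C \<subseteq> {..<m} \<and> card R = card C \<and> card R \<ge> 1
                    \<longrightarrow> \<bar>minor a R C\<bar> < int (res_char v)"
begin

text \<open>\<open>res_char\<close> is the least positive integer in the maximal ideal, so smaller
  positive integers are units.\<close>

lemma v_of_int_unit:
  assumes "D \<noteq> 0" "\<bar>D\<bar> < int (res_char v)"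
  shows "v (of_int D) = 1"
proof -
  define k where "k = nat \<bar>D\<bar>"
  have k: "k > 0" "k < res_char v" using assms by (auto simp: k_def)
  have "of_nat k \<notin> maxideal v"
    using not_less_Least[OF k(2)[unfolded res_char_def]] k(1) by blast
  then have "v (of_nat k) = 1" using v_of_nat[of k] by (simp add: maxideal_def)
  moreover have "of_nat k = (of_int \<bar>D\<bar> :: 'a)" by (simp add: k_def)
  ultimately show ?thesis by (cases "D \<ge> 0") auto
qed

text \<open>The one place where the bound on the minors enters: \<open>D\<close> is 1 up to sign or
  a minor up to sign, hence a unit, and dividing by it preserves integrality.\<close>

lemma unit_echelon:
  assumes J: "J \<subseteq> {..<n}"
  obtains C :: "nat set" and D Z T where "C \<subseteq> {..<m}" "D \<noteq> 0" "v (of_int D) = 1"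
    "\<And>c c'. c \<in> C \<Longrightarrow> c' \<in> C \<Longrightarrow> Z c c' = (if c = c' then D else 0)"
    "\<And>j l. j \<in> J \<Longrightarrow> l < m \<Longrightarrow> D * a j l = (\<Sum>c\<in>C. a j c * Z c l)"
    "\<And>c l. c \<in> C \<Longrightarrow> Z c l = (\<Sum>j\<in>J. T c j * a j l)"
proof (rule integer_echelon[OF J, of m a])
  fix C D Z T assume Z: "C \<subseteq> {..<m}" "D \<noteq> 0"
    "\<bar>D\<bar> = 1 \<or> (\<exists>R C. R \<subseteq> {..<n} \<and> C \<subseteq> {..<m} \<and> card R = card C \<and> card R \<ge> 1 \<and> \<bar>D\<bar> = \<bar>minor a R C\<bar>)"
    "\<And>c c'. c \<in> C \<Longrightarrow> c' \<in> C \<Longrightarrow> Z c c' = (if c = c' then D else 0)"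
    "\<And>j l. j \<in> J \<Longrightarrow> l < m \<Longrightarrow> D * a j l = (\<Sum>c\<in>C. a j c * Z c l)"
    "\<And>c l. c \<in> C \<Longrightarrow> Z c l = (\<Sum>j\<in>J. T c j * a j l)"
  have "v (of_int D) = 1"
  proof (cases "\<bar>D\<bar> = 1")
    case True
    then have "D = 1 \<or> D = -1" by auto
    then show ?thesis by auto
  next
    case False
    then have "\<bar>D\<bar> < int (res_char v)" using Z(3) minors by metis
    then show ?thesis using v_of_int_unit Z(2) by blast
  qed
  then show thesis using that[of C D Z T] Z by blast
qed

lemma integral_echelon:
  assumes J: "J \<subseteq> {..<n}"
  obtains C and E T :: "nat \<Rightarrow> nat \<Rightarrow> 'a" where "echelon a m J C E T"
    "\<And>c l. v (E c l) \<le> 1" "\<And>c j. v (T c j) \<le> 1"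
proof (rule unit_echelon[OF J])
  fix C D Z T assume Z: "C \<subseteq> {..<m}" "D \<noteq> 0" "v (of_int D) = 1"
    "\<And>c c'. c \<in> C \<Longrightarrow> c' \<in> C \<Longrightarrow> Z c c' = (if c = c' then D else 0)"
    "\<And>j l. j \<in> J \<Longrightarrow> l < m \<Longrightarrow> D * a j l = (\<Sum>c\<in>C. a j c * Z c l)"
    "\<And>c l. c \<in> C \<Longrightarrow> Z c l = (\<Sum>j\<in>J. T c j * a j l)"
  then have nz: "(of_int D :: 'a) \<noteq> 0" by auto
  show thesis
    by (rule that[OF echelon_divide[where Z = Z and T = T, OF Z(1) nz Z(4,5,6)]])
       (auto simp: v_divide Z(3) v_of_int)
qed

text \<open>Spanning is assumed over the rationals while the rank is taken over \<open>F\<close>;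
  both echelon forms have the same pivot set \<open>C\<close>. A missing pivot \<open>l\<close>
  would give a rational vector \<open>w\<close> with \<open>w l = 1\<close> orthogonal to all
  \<open>a i\<close>, hence to the unit vector at \<open>l\<close>, which is a combination of
  them.\<close>

lemma rk_full: "rk TYPE('a) a m {..<n} = m"
proof (rule unit_echelon[OF order.refl])
  fix C D Z T assume Z: "C \<subseteq> {..<m}" "D \<noteq> 0" "v (of_int D) = 1"
    "\<And>c c'. c \<in> C \<Longrightarrow> c' \<in> C \<Longrightarrow> Z c c' = (if c = c' then D else 0)"
    "\<And>j l. j \<in> {..<n} \<Longrightarrow> l < m \<Longrightarrow> D * a j l = (\<Sum>c\<in>C. a j c * Z c l)"
    "\<And>c l. c \<in> C \<Longrightarrow> Z c l = (\<Sum>j\<in>{..<n}. T c j * a j l)"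
  then have nz: "(of_int D :: 'a) \<noteq> 0" "(of_int D :: rat) \<noteq> 0" by auto
  note rat = echelon_divide[where Z = Z and T = T, OF Z(1) nz(2) Z(4,5,6)]
  have "{..<m} \<subseteq> C"
  proof (rule ccontr)
    assume "\<not> {..<m} \<subseteq> C"
    then obtain l where l: "l < m" "l \<notin> C" by auto
    then have lC: "l \<in> {..<m} - C" by blast
    define w where "w = kernel_vec C (\<lambda>c l. if l < m then of_int (Z c l) / of_int D else 0 :: rat) l"
    have "w \<in> HJ TYPE(rat) a m {..<n}"
      unfolding w_def by (rule kernel_vec_in_HJ[OF rat lC])
    then have w0: "(\<Sum>j<m. w j * of_int (a i j)) = 0" if "i < n" for i
      using that by (simp add: HJ_def)
    have "\<exists>c. \<forall>j<m. (\<Sum>i<n. c i * of_int (a i j)) = (if j = l then 1 else 0 :: rat)"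
      by (rule span[THEN spec, of "\<lambda>j. if j = l then 1 else 0"])
    then obtain c where c: "\<forall>j<m. (\<Sum>i<n. c i * of_int (a i j)) = (if j = l then 1 else 0 :: rat)" ..
    have "(\<Sum>j<m. w j * (\<Sum>i<n. c i * of_int (a i j))) = (\<Sum>i<n. c i * (\<Sum>j<m. w j * of_int (a i j)))"
      unfolding sum_distrib_left by (subst sum.swap) (simp add: mult_ac)
    also have "\<dots> = 0" using w0 by simp
    also have "(\<Sum>j<m. w j * (\<Sum>i<n. c i * of_int (a i j))) = (\<Sum>j<m. if j = l then w l else 0)"
      using c by (intro sum.cong) auto
    also have "\<dots> = 1" using l by (simp add: w_def kernel_vec_def)
    finally show False by simp
  qed
  then have "C = {..<m}" using Z(1) by blast
  then show ?thesis
    using ech_rk[OF echelon_divide[where Z = Z and T = T, OF Z(1) nz(1) Z(4,5,6)]] by simp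
qed

abbreviation H :: "nat set \<Rightarrow> (nat \<Rightarrow> 'a) set" where "H \<equiv> HJ TYPE('a) a m"

lemma flat_subset: "I \<in> flats TYPE('a) a n m \<Longrightarrow> I \<subseteq> {..<n}"
  and flat_closed: "I \<in> flats TYPE('a) a n m \<Longrightarrow> i < n \<Longrightarrow> H I \<subseteq> H {i} \<Longrightarrow> i \<in> I"
  by (auto simp: flats_def is_flat_def)

lemma finite_flat: "I \<in> flats TYPE('a) a n m \<Longrightarrow> finite I"
  using flat_subset finite_subset by blast

lemma finite_flats: "finite (flats TYPE('a) a n m)"
  by (rule finite_subset[of _ "Pow {..<n}"]) (auto dest: flat_subset)

lemma full_flat: "{..<n} \<in> flats TYPE('a) a n m"
  by (auto simp: flats_def is_flat_def HJ_def)

lemma dim_H: "J \<subseteq> {..<n} \<Longrightarrow> dimF (H J) = m - rk TYPE('a) a m J"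
  by (rule integral_echelon[of J]) (auto simp: ech_dim_HJ ech_rk finite_subset)

lemma rank_le: "J \<subseteq> {..<n} \<Longrightarrow> rk TYPE('a) a m J \<le> m"
proof (rule integral_echelon[of J])
  fix C and E T :: "nat \<Rightarrow> nat \<Rightarrow> 'a" assume J: "J \<subseteq> {..<n}" and e: "echelon a m J C E T"
  have "card C \<le> card {..<m}" by (rule card_mono) (use ech_pivots[OF e] in auto)
  then show ?thesis using ech_rk[OF e] finite_subset[OF J] by simp
qed

lemma v_pair: "(\<And>l. l < m \<Longrightarrow> v (\<xi> l) \<le> 1) \<Longrightarrow> v (pair a m \<xi> i) \<le> 1"
  unfolding pair_def by (intro v_sum_le v_mult_le v_of_int) auto

text \<open>By integrality of the echelon basis, a point of \<open>H J\<close> over the residue field lifts to a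
  point of \<open>H J\<close> over the ring of integers, namely \<open>\<xi> - uniformizer * \<eta>\<close>.\<close>
lemma pair_divide_uniformizer:
  assumes J: "J \<subseteq> {..<n}" and \<xi>: "\<And>l. l < m \<Longrightarrow> v (\<xi> l) \<le> 1"
    and small: "\<And>j. j \<in> J \<Longrightarrow> v (pair a m \<xi> j) \<le> p"
  obtains \<eta> where "\<And>l. v (\<eta> l) \<le> 1" "\<And>j. j \<in> J \<Longrightarrow> pair a m \<xi> j = uniformizer * pair a m \<eta> j"
proof (rule integral_echelon[OF J])
  fix C and E T :: "nat \<Rightarrow> nat \<Rightarrow> 'a" assume e: "echelon a m J C E T"
    and int: "\<And>c l. v (E c l) \<le> 1" "\<And>c j. v (T c j) \<le> 1"
  \<comment> \<open>Supported on the pivots, where the echelon rows form the identity, so the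
    pairing of \<open>\<eta>\<close> with row \<open>c\<close> is just
    \<open>\<eta> c\<close>.\<close>
  define \<eta> where "\<eta> c = (if c \<in> C then (\<Sum>l<m. \<xi> l * E c l) / uniformizer else 0)" for c
  have \<eta>C: "(\<Sum>l<m. \<eta> l * E c l) = \<eta> c" if "c \<in> C" for c
  proof -
    have "(\<Sum>l\<in>{..<m} - C. \<eta> l * E c l) = 0"
      by (rule sum.neutral) (simp add: \<eta>_def)
    then show ?thesis using ech_split[OF e that, of \<eta>] by simp
  qed
  show thesis
  proof (rule that[of \<eta>])
    fix l
    show "v (\<eta> l) \<le> 1"
    proof (cases "l \<in> C")
      case True
      have "v (\<Sum>l'<m. \<xi> l' * E l l') \<le> p"
        unfolding ech_row_pair[OF e True] using int small
        by (intro v_sum_le v_mult_le) (auto simp: less_imp_le)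
      then show ?thesis using True by (simp add: \<eta>_def v_divide)
    qed (simp add: \<eta>_def)
  next
    fix j assume j: "j \<in> J"
    show "pair a m \<xi> j = uniformizer * pair a m \<eta> j"
    proof -
      have "pair a m \<xi> j = (\<Sum>c\<in>C. uniformizer * (of_int (a j c) * (\<Sum>l<m. \<eta> l * E c l)))"
        unfolding ech_pair[OF e j, of \<xi>]
      proof (rule sum.cong[OF refl])
        fix c assume c: "c \<in> C"
        show "of_int (a j c) * (\<Sum>l<m. \<xi> l * E c l) = uniformizer * (of_int (a j c) * (\<Sum>l<m. \<eta> l * E c l))"
          unfolding \<eta>C[OF c] using c by (simp add: \<eta>_def)
      qed
      then show ?thesis by (simp only: ech_pair[OF e j, of \<eta>] sum_distrib_left)
    qed
  qed
qed

section \<open>Strata of residue vectors and their sizes\<close>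

definition vanishing :: "nat set \<Rightarrow> (nat \<Rightarrow> 'a) \<Rightarrow> nat set" where
  "vanishing I \<xi> = {i \<in> I. v (pair a m \<xi> i) \<le> p}"

text \<open>If \<open>H J \<subseteq> H {i}\<close> over \<open>F\<close>, then \<open>a i\<close>
  is a combination of the echelon rows of \<open>J\<close> with the integer coefficients
  \<open>a i c\<close>. These rows pair with \<open>\<xi>\<close> into the maximal ideal, hence so
  does \<open>a i\<close>.\<close>

lemma vanishing_flat:
  assumes I: "I \<in> flats TYPE('a) a n m" and \<xi>: "\<And>l. l < m \<Longrightarrow> v (\<xi> l) \<le> 1"
  shows "vanishing I \<xi> \<in> flats TYPE('a) a n m"
proof -
  define J where "J = vanishing I \<xi>"
  have JI: "J \<subseteq> I" by (auto simp: J_def vanishing_def)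
  then have J: "J \<subseteq> {..<n}" using flat_subset[OF I] by blast
  have "i \<in> J" if i: "i < n" "H J \<subseteq> H {i}" for i
  proof (rule integral_echelon[OF J])
    fix C and E T :: "nat \<Rightarrow> nat \<Rightarrow> 'a" assume e: "echelon a m J C E T"
      and int: "\<And>c l. v (E c l) \<le> 1" "\<And>c j. v (T c j) \<le> 1"
    \<comment> \<open>\<open>vanishing\<close> only looks inside \<open>I\<close>, so
      \<open>i \<in> I\<close> has to be known first; it holds because \<open>I\<close> is a
      flat.\<close>
    have "H I \<subseteq> H J" using JI by (auto simp: HJ_def)
    then have "i \<in> I" using flat_closed[OF I i(1)] i(2) by blast
    have row: "v (\<Sum>l<m. \<xi> l * E c l) \<le> p" if "c \<in> C" for c
      unfolding ech_row_pair[OF e that] using int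
      by (intro v_sum_le v_mult_le) (auto simp: less_imp_le J_def vanishing_def)
    have "pair a m \<xi> i = (\<Sum>c\<in>C. of_int (a i c) * (\<Sum>l<m. \<xi> l * E c l))"
      by (rule pair_eq_of_row_eq) (rule ech_closure_row[OF e i(2)])
    also have "v \<dots> \<le> p"
      by (rule v_sum_le) (auto intro!: v_mult_le[OF v_of_int] row simp: less_imp_le)
    finally show "i \<in> J" using \<open>i \<in> I\<close> by (simp add: J_def vanishing_def)
  qed
  then have "J = {i \<in> {..<n}. H J \<subseteq> H {i}}" using J by (auto simp: HJ_def)
  then show ?thesis using J by (simp add: flats_def is_flat_def flip: J_def)
qed

lemma digit_vec: "\<xi> \<in> PiE {..<m} (\<lambda>_. digits) \<Longrightarrow> l < m \<Longrightarrow> v (\<xi> l) \<le> 1"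
  using v_digit by (auto simp: PiE_def)

text \<open>In echelon form the free coordinates are arbitrary digits, and they determine each pivot
  digit.\<close>

lemma card_residue_subspace:
  assumes J: "J \<subseteq> {..<n}"
  shows "real (card {\<xi> \<in> PiE {..<m} (\<lambda>_. digits). \<forall>j\<in>J. v (pair a m \<xi> j) \<le> p}) = q ^ (m - rk TYPE('a) a m J)"
proof (rule integral_echelon[OF J])
  fix C and E T :: "nat \<Rightarrow> nat \<Rightarrow> 'a" assume e: "echelon a m J C E T"
    and int: "\<And>c l. v (E c l) \<le> 1" "\<And>c j. v (T c j) \<le> 1"
  define S where "S \<xi> c = (\<Sum>l\<in>{..<m} - C. \<xi> l * E c l)" for \<xi> c
  have "(\<forall>j\<in>J. v (pair a m \<xi> j) \<le> p) \<longleftrightarrow> (\<forall>c\<in>C. v (\<xi> c + S \<xi> c) \<le> p)" for \<xi>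
  proof
    assume "\<forall>j\<in>J. v (pair a m \<xi> j) \<le> p"
    then show "\<forall>c\<in>C. v (\<xi> c + S \<xi> c) \<le> p"
      unfolding S_def using int
      by (auto simp: ech_split[OF e, symmetric] ech_row_pair[OF e] less_imp_le intro!: v_sum_le v_mult_le)
  next
    assume "\<forall>c\<in>C. v (\<xi> c + S \<xi> c) \<le> p"
    then show "\<forall>j\<in>J. v (pair a m \<xi> j) \<le> p"
      unfolding S_def ech_pair[OF e]
      by (auto simp: ech_split[OF e, symmetric] ech_pair[OF e] less_imp_le
          intro!: v_sum_le[where r = p and A = C] v_mult_le[OF v_of_int])
  qed
  then have set: "{\<xi> \<in> PiE {..<m} (\<lambda>_. digits). \<forall>j\<in>J. v (pair a m \<xi> j) \<le> p}
      = {\<xi> \<in> PiE {..<m} (\<lambda>_. digits). \<forall>c\<in>C. v (\<xi> c + S \<xi> c) \<le> p}" (is "?A = ?B") by blast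
  have S_cong: "S \<xi> c = S \<xi>' c" if "\<And>l. l \<in> {..<m} - C \<Longrightarrow> \<xi> l = \<xi>' l" for \<xi> \<xi>' c
    unfolding S_def using that by (intro sum.cong) auto
  have Sint: "v (S \<xi> c) \<le> 1" if "\<And>l. l \<in> {..<m} - C \<Longrightarrow> \<xi> l \<in> digits" for \<xi> c
    unfolding S_def using that int v_digit by (intro v_sum_le v_mult_le) auto
  have Cm: "C \<subseteq> {..<m}" by (rule ech_pivots[OF e])
  have bij: "bij_betw (\<lambda>\<xi>. restrict \<xi> ({..<m} - C)) ?B (PiE ({..<m} - C) (\<lambda>_. digits))"
  \<comment> \<open>Inverse map: the pivot digit is the representative of
    \<open>- S \<xi> l\<close>, since \<open>reps 1\<close> is the set of digits. \<open>S\<close>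
    ignores the pivot coordinates, so filling them in does not disturb it.\<close>
  proof (rule bij_betwI[where g = "\<lambda>\<xi>. \<lambda>l\<in>{..<m}. if l \<in> C then rep 1 (- S \<xi> l) else \<xi> l"], goal_cases)
    case 1
    then show ?case by auto
  next
    case 2
    show ?case
    proof
      fix \<xi> assume x: "\<xi> \<in> PiE ({..<m} - C) (\<lambda>_. digits)"
      let ?x = "\<lambda>l\<in>{..<m}. if l \<in> C then rep 1 (- S \<xi> l) else \<xi> l"
      have Sx: "v (- S \<xi> c) \<le> 1" for c using Sint[of \<xi> c] x by auto
      have "S ?x c = S \<xi> c" for c by (rule S_cong) auto
      moreover have "v (rep 1 (- S \<xi> c) + S \<xi> c) \<le> p" for c
        using rep(2)[OF Sx[of c], of 1] v_minus_commute[of "- S \<xi> c"] by (simp add: algebra_simps)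
      moreover have "rep 1 (- S \<xi> c) \<in> digits" for c
        using rep(1)[OF Sx[of c], of 1] reps_1 by simp
      ultimately show "?x \<in> ?B" using x Cm by (auto simp: PiE_iff)
    qed
  next
    case (3 \<xi>)
    have "rep 1 (- S (restrict \<xi> ({..<m} - C)) c) = \<xi> c" if c: "c \<in> C" for c
    proof (rule rep_eqI)
      have S: "S (restrict \<xi> ({..<m} - C)) c = S \<xi> c" by (rule S_cong) auto
      show "\<xi> c \<in> reps 1" using 3 c Cm reps_1 by auto
      show "v (- S (restrict \<xi> ({..<m} - C)) c) \<le> 1"
        using Sint[of \<xi> c] 3 unfolding S by auto
      have "v (\<xi> c + S \<xi> c) \<le> p" using 3 c by blast
      then show "v (- S (restrict \<xi> ({..<m} - C)) c - \<xi> c) \<le> p ^ 1"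
        unfolding S using v_uminus[of "\<xi> c + S \<xi> c"]
        by (metis add_uminus_conv_diff minus_add power_one_right)
    qed
    then show ?case using 3 by (auto simp: fun_eq_iff PiE_iff extensional_def)
  next
    case (4 \<xi>)
    then show ?case by (auto simp: fun_eq_iff PiE_iff extensional_def)
  qed
  have "card ({..<m} - C) = m - rk TYPE('a) a m J"
    using ech_rk[OF e] J Cm ech_pivot_finite[OF e] finite_subset[OF J] by (simp add: card_Diff_subset)
  then show ?thesis
    unfolding set bij_betw_same_card[OF bij] by (simp add: card_PiE card_digits)
qed

text \<open>Read off from point counts: more conditions leave fewer residue vectors, and the counts
  are powers of \<open>q\<close>.\<close>

lemma rank_mono:
  assumes "J \<subseteq> I" "I \<subseteq> {..<n}"
  shows "rk TYPE('a) a m J \<le> rk TYPE('a) a m I"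
proof -
  have "card {\<xi> \<in> PiE {..<m} (\<lambda>_. digits). \<forall>j\<in>I. v (pair a m \<xi> j) \<le> p}
      \<le> card {\<xi> \<in> PiE {..<m} (\<lambda>_. digits). \<forall>j\<in>J. v (pair a m \<xi> j) \<le> p}"
    using assms finite_digits by (intro card_mono) (auto intro!: finite_PiE)
  then have "q ^ (m - rk TYPE('a) a m I) \<le> q ^ (m - rk TYPE('a) a m J)"
    using card_residue_subspace[of I] card_residue_subspace[of J] assms
    by (auto simp only: of_nat_le_iff[where 'a = real, symmetric])
  then have "m - rk TYPE('a) a m I \<le> m - rk TYPE('a) a m J" by simp
  then show ?thesis using rank_le[of I] rank_le[OF order.trans[OF assms]] assms(2) by simp
qed

text \<open>The residue vectors vanishing at least on \<open>G\<close> are counted by the rank of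
  \<open>G\<close> and are partitioned by their exact vanishing flats \<open>K\<close> containing
  \<open>G\<close>; Moebius inversion isolates \<open>K = J\<close>. The exponents match because
  \<open>dimF (H G) - dimF (H I)\<close> is the rank of \<open>I\<close> minus that of
  \<open>G\<close>.\<close>

lemma card_residue_stratum:
  assumes I: "I \<in> flats TYPE('a) a n m" and J: "J \<in> flats TYPE('a) a n m" and JI: "J \<subseteq> I"
  shows "real (card {\<xi> \<in> PiE {..<m} (\<lambda>_. digits). vanishing I \<xi> = J})
    = q ^ (m - rk TYPE('a) a m I) * charpoly TYPE('a) a n m J I q"
proof -
  define X where "X = PiE {..<m} (\<lambda>_. digits)"
  define g where "g K = real (card {\<xi> \<in> X. vanishing I \<xi> = K})" for K
  have fX: "finite X" by (auto simp: X_def finite_digits intro!: finite_PiE)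
  have sub: "q ^ (m - rk TYPE('a) a m G) = (\<Sum>K\<in>{K\<in>flats TYPE('a) a n m. K \<subseteq> I}. if G \<subseteq> K then g K else 0)"
    if G: "G \<in> flats TYPE('a) a n m" "G \<subseteq> I" for G
  proof -
    have "q ^ (m - rk TYPE('a) a m G) = real (card {\<xi> \<in> X. \<forall>j\<in>G. v (pair a m \<xi> j) \<le> p})"
      unfolding X_def by (rule card_residue_subspace[symmetric]) (use flat_subset G in blast)
    also have "{\<xi> \<in> X. \<forall>j\<in>G. v (pair a m \<xi> j) \<le> p} = {\<xi> \<in> X. G \<subseteq> vanishing I \<xi>}"
      using G by (auto simp: vanishing_def)
    also have "real (card \<dots>) = (\<Sum>\<xi>\<in>X. if G \<subseteq> vanishing I \<xi> then 1 else 0)"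
      using fX by (simp add: sum.If_cases Int_def)
    also have "\<dots> = (\<Sum>K\<in>{K\<in>flats TYPE('a) a n m. K \<subseteq> I}. \<Sum>\<xi>\<in>{\<xi> \<in> X. vanishing I \<xi> = K}. if G \<subseteq> vanishing I \<xi> then 1 else 0)"
    proof (rule sum.group[symmetric])
      show "vanishing I ` X \<subseteq> {K \<in> flats TYPE('a) a n m. K \<subseteq> I}"
        using vanishing_flat[OF I] digit_vec by (auto simp: X_def vanishing_def)
    qed (use fX finite_flats in auto)
    also have "\<dots> = (\<Sum>K\<in>{K\<in>flats TYPE('a) a n m. K \<subseteq> I}. if G \<subseteq> K then g K else 0)"
      by (intro sum.cong) (auto simp: g_def)
    finally show ?thesis .
  qed
  let ?M = "{G\<in>flats TYPE('a) a n m. J \<subseteq> G \<and> G \<subseteq> I}"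
  have "q ^ (m - rk TYPE('a) a m I) * charpoly TYPE('a) a n m J I q = (\<Sum>G\<in>?M. of_int (mobius (flats TYPE('a) a n m) J G) * q ^ (m - rk TYPE('a) a m G))"
    unfolding charpoly_def sum_distrib_left
  proof (rule sum.cong[OF refl])
    fix G assume G: "G \<in> ?M"
    then have GI: "G \<subseteq> {..<n}" "I \<subseteq> {..<n}" using flat_subset I by auto
    have "m - rk TYPE('a) a m G = (m - rk TYPE('a) a m I) + (dimF (H G) - dimF (H I))"
      using rank_mono[of G I] rank_le[of I] G GI by (simp add: dim_H)
    then show "q ^ (m - rk TYPE('a) a m I) * (of_int (mobius (flats TYPE('a) a n m) J G) * q ^ (dimF (H G) - dimF (H I)))
        = of_int (mobius (flats TYPE('a) a n m) J G) * q ^ (m - rk TYPE('a) a m G)"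
      by (simp add: power_add del: mobius.simps)
  qed
  also have "\<dots> = (\<Sum>G\<in>?M. \<Sum>K\<in>{K\<in>flats TYPE('a) a n m. K \<subseteq> I}. if G \<subseteq> K then of_int (mobius (flats TYPE('a) a n m) J G) * g K else 0)"
    by (intro sum.cong) (auto simp: sub sum_distrib_left if_distrib cong: if_cong simp del: mobius.simps)
  also have "\<dots> = (\<Sum>K\<in>{K\<in>flats TYPE('a) a n m. K \<subseteq> I}. \<Sum>G\<in>?M. if G \<subseteq> K then of_int (mobius (flats TYPE('a) a n m) J G) * g K else 0)"
    by (rule sum.swap)
  also have "\<dots> = (\<Sum>K\<in>{K\<in>flats TYPE('a) a n m. K \<subseteq> I}. if K = J then g J else 0)"
  proof (rule sum.cong[OF refl])
    fix K assume K: "K \<in> {K\<in>flats TYPE('a) a n m. K \<subseteq> I}"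
    \<comment> \<open>For fixed \<open>K\<close> only the interval from \<open>J\<close> to
      \<open>K\<close> contributes, and the defining property of the Moebius function kills it
      unless \<open>K = J\<close>.\<close>
    have "(\<Sum>G\<in>?M. if G \<subseteq> K then of_int (mobius (flats TYPE('a) a n m) J G) * g K else 0)
        = (\<Sum>G\<in>{G\<in>flats TYPE('a) a n m. J \<subseteq> G \<and> G \<subseteq> K}. of_int (mobius (flats TYPE('a) a n m) J G) * g K)"
      using K finite_flats by (intro sum.mono_neutral_cong_right) (auto simp del: mobius.simps)
    also have "\<dots> = of_int (\<Sum>G\<in>{G\<in>flats TYPE('a) a n m. J \<subseteq> G \<and> G \<subseteq> K}. mobius (flats TYPE('a) a n m) J G) * g K"
      by (simp add: sum_distrib_right del: mobius.simps)
    also have "\<dots> = (if K = J then g J else 0)"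
    proof (cases "J \<subseteq> K")
      case True
      then show ?thesis using mobius_sum[OF J _ True] K finite_flat by (auto simp del: mobius.simps)
    next
      case False
      then have "{G\<in>flats TYPE('a) a n m. J \<subseteq> G \<and> G \<subseteq> K} = {}" by auto
      moreover have "K \<noteq> J" using False by blast
      ultimately show ?thesis by (simp only: sum.empty) simp
    qed
    finally show "(\<Sum>G\<in>?M. if G \<subseteq> K then of_int (mobius (flats TYPE('a) a n m) J G) * g K else 0) = (if K = J then g J else 0)" .
  qed
  also have "\<dots> = g J" using J JI finite_flats by simp
  finally show ?thesis by (simp add: g_def X_def)
qed

end

section \<open>Recursion over flats\<close>

context nonarch_local_field
begin

lemma phi_close:
  assumes "v (t - t') \<le> p ^ k"
  shows "phi k t = phi k t'"
proof -
  have "v t \<le> max (v (t - t')) (v t')" using v_add[of "t - t'" t'] by simp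
  moreover have "v t' \<le> max (v (t' - t)) (v t)" using v_add[of "t' - t" t] by simp
  ultimately have "max (v t) (p ^ k) = max (v t') (p ^ k)"
    using assms v_minus_commute[of t t'] by linarith
  then show ?thesis by (simp add: phi_def)
qed

lemma phi_unit: "v t = 1 \<Longrightarrow> phi k t = p ^ k"
  by (simp add: phi_def max_absorb1)

text \<open>Both \<open>v t\<close> and the threshold scale by \<open>p\<close>; this is what lowers
  the level in the recursion.\<close>

lemma phi_uniformizer: "phi (Suc k) (uniformizer * t) = phi k t"
proof -
  have "max (v (uniformizer * t)) (p ^ Suc k) = p * max (v t) (p ^ k)"
    by (simp add: v_mult max_mult_distrib_left less_imp_le)
  then show ?thesis by (simp add: phi_def)
qed

lemma phi_nonneg: "phi k t \<ge> 0"
  by (simp add: phi_def less_imp_le le_max_iff_disj)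

lemma phi_le_1: "phi k t \<le> 1"
  by (auto simp: phi_def divide_le_eq_1 less_max_iff_disj)

lemma phi_0: "v t \<le> 1 \<Longrightarrow> phi 0 t = 1"
  by (simp add: phi_def max_absorb2)

lemma sum_cube_Suc:
  fixes f :: "('i \<Rightarrow> 'a) \<Rightarrow> real"
  shows "(\<Sum>x\<in>PiE Y (\<lambda>_. reps (Suc k)). f x) =
    (\<Sum>x0\<in>PiE Y (\<lambda>_. digits). \<Sum>x\<in>PiE Y (\<lambda>_. reps k). f (\<lambda>l\<in>Y. x0 l + uniformizer * x l))"
proof -
  define g where "g = (\<lambda>(x0, x). \<lambda>l\<in>Y. x0 l + uniformizer * x l :: 'a)"
  let ?S = "PiE Y (\<lambda>_. digits) \<times> PiE Y (\<lambda>_. reps k)"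
  have inj: "inj_on g ?S"
  proof (rule inj_onI, clarsimp)
    fix x0 x y0 y
    assume S: "x0 \<in> PiE Y (\<lambda>_. digits)" "x \<in> PiE Y (\<lambda>_. reps k)"
      "y0 \<in> PiE Y (\<lambda>_. digits)" "y \<in> PiE Y (\<lambda>_. reps k)" and eq: "g (x0, x) = g (y0, y)"
    have "x0 l = y0 l \<and> x l = y l" if l: "l \<in> Y" for l
    proof -
      have "x0 l + uniformizer * x l = y0 l + uniformizer * y l"
        using fun_cong[OF eq, of l] l by (simp add: g_def)
      then have "(x0 l, x l) = (y0 l, y l)"
        using S l by (intro inj_onD[OF inj_on_digit_split[of k]]) (auto simp: PiE_iff)
      then show ?thesis by simp
    qed
    then show "x0 = y0 \<and> x = y" using PiE_ext[OF S(1,3)] PiE_ext[OF S(2,4)] by blast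
  qed
  have img: "g ` ?S = PiE Y (\<lambda>_. reps (Suc k))"
  proof (intro equalityI subsetI)
    fix x assume "x \<in> g ` ?S"
    then obtain x0 x' where x: "x0 \<in> PiE Y (\<lambda>_. digits)" "x' \<in> PiE Y (\<lambda>_. reps k)" "x = g (x0, x')"
      by auto
    show "x \<in> PiE Y (\<lambda>_. reps (Suc k))"
    proof (rule PiE_I)
      fix l assume l: "l \<in> Y"
      show "x l \<in> reps (Suc k)"
        using l x by (auto simp: g_def PiE_iff intro!: image_eqI[of _ _ "(x0 l, x' l)"])
    qed (simp add: x g_def)
  next
    fix x assume x: "x \<in> PiE Y (\<lambda>_. reps (Suc k))"
    have "\<forall>l\<in>Y. \<exists>c. fst c \<in> digits \<and> snd c \<in> reps k \<and> x l = fst c + uniformizer * snd c"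
    proof
      fix l assume "l \<in> Y"
      then have "x l \<in> (\<lambda>(d, e). d + uniformizer * e) ` (digits \<times> reps k)"
        using x by (metis PiE_mem reps.simps(2))
      then show "\<exists>c. fst c \<in> digits \<and> snd c \<in> reps k \<and> x l = fst c + uniformizer * snd c"
        by force
    qed
    then obtain c where c: "\<forall>l\<in>Y. fst (c l) \<in> digits \<and> snd (c l) \<in> reps k \<and>
        x l = fst (c l) + uniformizer * snd (c l)" by (rule bchoice[THEN exE])
    have "x = g (\<lambda>l\<in>Y. fst (c l), \<lambda>l\<in>Y. snd (c l))"
      using c x by (auto simp: g_def fun_eq_iff PiE_iff extensional_def)
    then show "x \<in> g ` ?S" using c by auto
  qed
  have "(\<Sum>x\<in>PiE Y (\<lambda>_. reps (Suc k)). f x) = (\<Sum>z\<in>?S. f (g z))"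
    unfolding img[symmetric] by (simp add: sum.reindex[OF inj])
  also have "\<dots> = (\<Sum>x0\<in>PiE Y (\<lambda>_. digits). \<Sum>x\<in>PiE Y (\<lambda>_. reps k). f (g (x0, x)))"
    unfolding sum.cartesian_product by (simp add: case_prod_unfold)
  finally show ?thesis by (simp add: g_def)
qed

text \<open>Translation permutes residues. The representatives need not be closed under addition, so
  the permutation is \<open>h\<close>, translation followed by \<open>rep k\<close>; periodicity of
  \<open>f\<close> makes the change of representative harmless.\<close>

lemma sum_cube_translate:
  fixes f :: "('i \<Rightarrow> 'a) \<Rightarrow> real"
  assumes fin: "finite Y" and \<eta>: "\<And>l. l \<in> Y \<Longrightarrow> v (\<eta> l) \<le> 1"
    and per: "\<And>x y. (\<And>l. l \<in> Y \<Longrightarrow> v (x l - y l) \<le> p ^ k) \<Longrightarrow> f x = f y"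
  shows "(\<Sum>x\<in>PiE Y (\<lambda>_. reps k). f (\<lambda>l. x l + \<eta> l)) = (\<Sum>x\<in>PiE Y (\<lambda>_. reps k). f x)"
proof -
  define S where "S = PiE Y (\<lambda>_. reps k)"
  define h where "h x = (\<lambda>l\<in>Y. rep k (x l + \<eta> l))" for x
  have int: "v (x l + \<eta> l) \<le> 1" if "x \<in> S" "l \<in> Y" for x l
    using that \<eta> v_reps[of "x l" k] by (intro v_add_le) (auto simp: S_def PiE_iff)
  have fS: "finite S" using fin by (simp add: S_def finite_PiE)
  have hS: "h ` S \<subseteq> S"
    using rep(1)[OF int] by (auto simp: h_def S_def)
  have inj: "inj_on h S"
  proof (rule inj_onI)
    fix x y assume xy: "x \<in> S" "y \<in> S" "h x = h y"
    show "x = y"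
    proof (rule PiE_ext)
      show "x \<in> PiE Y (\<lambda>_. reps k)" "y \<in> PiE Y (\<lambda>_. reps k)" using xy by (simp_all add: S_def)
      fix l assume l: "l \<in> Y"
      have eq: "rep k (x l + \<eta> l) = rep k (y l + \<eta> l)"
        using fun_cong[OF xy(3), of l] l by (simp add: h_def)
      have "v ((x l + \<eta> l) - (y l + \<eta> l)) \<le> p ^ k"
        using rep(2)[OF int[OF xy(1) l], of k] rep(2)[OF int[OF xy(2) l], of k]
        unfolding eq by (metis v_diff_trans v_minus_commute)
      then have "v (x l - y l) \<le> p ^ k" by simp
      then show "x l = y l" using reps_unique xy l by (metis PiE_mem S_def)
    qed
  qed
  have "h ` S = S" using endo_inj_surj[OF fS hS inj] .
  have "(\<Sum>x\<in>S. f (\<lambda>l. x l + \<eta> l)) = (\<Sum>x\<in>S. f (h x))"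
  proof (rule sum.cong[OF refl], rule per)
    fix x l assume "x \<in> S" "l \<in> Y"
    then show "v (x l + \<eta> l - h x l) \<le> p ^ k" using rep(2)[OF int] by (simp add: h_def)
  qed
  also have "\<dots> = (\<Sum>x\<in>h ` S. f x)" by (simp add: sum.reindex[OF inj])
  finally show ?thesis using \<open>h ` S = S\<close> by (simp add: S_def)
qed

end

lemma pair_restrict_add_mult:
  "pair a m (\<lambda>l\<in>{..<m}. x l + c * y l) i = pair a m x i + c * pair a m y i"
  by (simp add: pair_def algebra_simps sum.distrib sum_distrib_left)

lemma pair_add: "pair a m (\<lambda>l. x l + y l) i = pair a m x i + pair a m y i"
  by (simp add: pair_def algebra_simps sum.distrib)

lemma pair_diff: "pair a m (\<lambda>l. x l - y l) i = pair a m x i - pair a m y i"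
  by (simp add: pair_def algebra_simps sum_subtractf)

context hypertoric
begin

lemma phi_pair_close:
  assumes "\<And>l. l \<in> {..<m} \<Longrightarrow> v (x l - y l) \<le> p ^ k"
  shows "phi k (pair a m x i) = phi k (pair a m y i)"
proof (rule phi_close)
  have "v (pair a m (\<lambda>l. x l - y l) i) \<le> p ^ k"
    unfolding pair_def using assms by (intro v_sum_le v_mult_le' v_of_int) (auto simp: less_imp_le)
  then show "v (pair a m x i - pair a m y i) \<le> p ^ k" by (simp add: pair_diff)
qed

text \<open>Only the factors in \<open>I\<close> are kept, so that the recursion, which discards the
  indices pairing to units, stays inside one family.\<close>

definition dual_avg :: "nat \<Rightarrow> nat set \<Rightarrow> real" where
  "dual_avg k I = p ^ (k * m) * (\<Sum>\<xi>\<in>PiE {..<m} (\<lambda>_. reps k). \<Prod>i\<in>I. phi k (pair a m \<xi> i))"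

lemma rep_vec: "\<xi> \<in> PiE {..<m} (\<lambda>_. reps k) \<Longrightarrow> l < m \<Longrightarrow> v (\<xi> l) \<le> 1"
  using v_reps[of "\<xi> l" k] by (auto simp: PiE_iff)

lemma dual_avg_bounds: "0 \<le> dual_avg k I" "dual_avg k I \<le> 1"
proof -
  show "0 \<le> dual_avg k I"
    unfolding dual_avg_def by (intro mult_nonneg_nonneg sum_nonneg prod_nonneg) (auto simp: phi_nonneg less_imp_le)
  have "(\<Sum>\<xi>\<in>PiE {..<m} (\<lambda>_. reps k). \<Prod>i\<in>I. phi k (pair a m \<xi> i)) \<le> (\<Sum>\<xi>\<in>PiE {..<m} (\<lambda>_. reps k). 1)"
    by (intro sum_mono prod_le_1) (auto simp: phi_nonneg phi_le_1)
  also have "\<dots> = q ^ (k * m)" using card_cube[of "{..<m}" k] by simp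
  finally have "dual_avg k I \<le> p ^ (k * m) * q ^ (k * m)"
    unfolding dual_avg_def by (intro mult_left_mono) (simp_all add: less_imp_le)
  then show "dual_avg k I \<le> 1" by simp
qed

lemma dual_avg_0: "dual_avg 0 I = 1"
proof -
  have "(\<Sum>\<xi>\<in>PiE {..<m} (\<lambda>_. reps 0). \<Prod>i\<in>I. phi 0 (pair a m \<xi> i)) = (\<Sum>\<xi>\<in>PiE {..<m} (\<lambda>_. reps 0). 1)"
    using rep_vec[of _ 0] by (intro sum.cong prod.neutral ballI refl phi_0 v_pair) auto
  also have "\<dots> = 1" using card_cube[of "{..<m}" 0] by simp
  finally show ?thesis by (simp add: dual_avg_def)
qed

text \<open>Fixing the leading digits \<open>\<xi>0\<close> fixes the flat \<open>J\<close>. Each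
  index outside \<open>J\<close> pairs to a unit and contributes \<open>p ^ Suc k\<close>; the
  pairings inside \<open>J\<close> are divisible by the uniformizer and drop to level
  \<open>k\<close>, up to a shift by \<open>\<eta>\<close> that averaging removes.\<close>

lemma dual_avg_Suc:
  assumes I: "I \<in> flats TYPE('a) a n m"
  shows "dual_avg (Suc k) I = (\<Sum>J\<in>{J \<in> flats TYPE('a) a n m. J \<subseteq> I}.
    p ^ rk TYPE('a) a m I * charpoly TYPE('a) a n m J I q * p ^ (Suc k * (card I - card J)) * dual_avg k J)"
proof -
  define X where "X = PiE {..<m} (\<lambda>_. digits)"
  define S where "S J = (\<Sum>\<xi>\<in>PiE {..<m} (\<lambda>_. reps k). \<Prod>i\<in>J. phi k (pair a m \<xi> i))" for J
  have fX: "finite X" by (auto simp: X_def finite_digits intro!: finite_PiE)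
  have inner: "(\<Sum>\<xi>\<in>PiE {..<m} (\<lambda>_. reps k). \<Prod>i\<in>I. phi (Suc k) (pair a m (\<lambda>l\<in>{..<m}. \<xi>0 l + uniformizer * \<xi> l) i))
      = p ^ (Suc k * (card I - card (vanishing I \<xi>0))) * S (vanishing I \<xi>0)" if \<xi>0: "\<xi>0 \<in> X" for \<xi>0
  proof -
    define J where "J = vanishing I \<xi>0"
    have int: "l < m \<Longrightarrow> v (\<xi>0 l) \<le> 1" for l using digit_vec \<xi>0 by (simp add: X_def)
    have JI: "J \<subseteq> I" by (auto simp: J_def vanishing_def)
    then have J: "J \<subseteq> {..<n}" using flat_subset[OF I] by blast
    have fI: "finite I" by (rule finite_flat[OF I])
    obtain \<eta> where \<eta>: "\<And>l. v (\<eta> l) \<le> 1" "\<And>j. j \<in> J \<Longrightarrow> pair a m \<xi>0 j = uniformizer * pair a m \<eta> j"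
    proof (rule pair_divide_uniformizer[OF J int])
      show "v (pair a m \<xi>0 j) \<le> p" if "j \<in> J" for j using that by (simp add: J_def vanishing_def)
    qed blast+
    have "(\<Prod>i\<in>I. phi (Suc k) (pair a m (\<lambda>l\<in>{..<m}. \<xi>0 l + uniformizer * \<xi> l) i))
        = p ^ (Suc k * (card I - card J)) * (\<Prod>i\<in>J. phi k (pair a m (\<lambda>l. \<xi> l + \<eta> l) i))"
      if \<xi>: "\<xi> \<in> PiE {..<m} (\<lambda>_. reps k)" for \<xi>
    proof -
      let ?t = "\<lambda>i. pair a m \<xi>0 i + uniformizer * pair a m \<xi> i"
      have "phi (Suc k) (?t i) = p ^ Suc k" if i: "i \<in> I - J" for i
      proof (rule phi_unit)
        have "v (pair a m \<xi>0 i) \<le> 1" using int by (rule v_pair)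
        moreover have "\<not> v (pair a m \<xi>0 i) < 1"
          using i unfolding v_less_1_iff by (simp add: J_def vanishing_def)
        ultimately have u: "v (pair a m \<xi>0 i) = 1" by simp
        have "v (uniformizer * pair a m \<xi> i) \<le> p"
          using v_pair[of \<xi> i] rep_vec[OF \<xi>] by (intro v_mult_le') auto
        then have "v (pair a m \<xi>0 i - ?t i) < v (pair a m \<xi>0 i)"
          using u p_less_1 by (simp del: p_less_1)
        then show "v (?t i) = 1" using v_eq_of_close u by metis
      qed
      then have out: "(\<Prod>i\<in>I - J. phi (Suc k) (?t i)) = p ^ (Suc k * (card I - card J))"
        using JI fI by (simp add: card_Diff_subset finite_subset power_mult del: power_Suc mult_Suc)
      have "?t i = uniformizer * pair a m (\<lambda>l. \<xi> l + \<eta> l) i" if "i \<in> J" for i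
        using \<eta>(2)[OF that] by (simp add: pair_add algebra_simps)
      then have inn: "(\<Prod>i\<in>J. phi (Suc k) (?t i)) = (\<Prod>i\<in>J. phi k (pair a m (\<lambda>l. \<xi> l + \<eta> l) i))"
        by (intro prod.cong) (simp_all add: phi_uniformizer)
      have "(\<Prod>i\<in>I. phi (Suc k) (pair a m (\<lambda>l\<in>{..<m}. \<xi>0 l + uniformizer * \<xi> l) i))
          = (\<Prod>i\<in>I. phi (Suc k) (?t i))" by (simp only: pair_restrict_add_mult)
      also have "\<dots> = (\<Prod>i\<in>I - J. phi (Suc k) (?t i)) * (\<Prod>i\<in>J. phi (Suc k) (?t i))"
        by (rule prod.subset_diff[OF JI fI])
      finally show ?thesis by (simp only: out inn)
    qed
    then have "(\<Sum>\<xi>\<in>PiE {..<m} (\<lambda>_. reps k). \<Prod>i\<in>I. phi (Suc k) (pair a m (\<lambda>l\<in>{..<m}. \<xi>0 l + uniformizer * \<xi> l) i))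
      = p ^ (Suc k * (card I - card J)) * (\<Sum>\<xi>\<in>PiE {..<m} (\<lambda>_. reps k). \<Prod>i\<in>J. phi k (pair a m (\<lambda>l. \<xi> l + \<eta> l) i))"
      unfolding sum_distrib_left by (rule sum.cong[OF refl])
    also have "(\<Sum>\<xi>\<in>PiE {..<m} (\<lambda>_. reps k). \<Prod>i\<in>J. phi k (pair a m (\<lambda>l. \<xi> l + \<eta> l) i)) = S J"
      unfolding S_def
      by (rule sum_cube_translate[where f = "\<lambda>\<xi>. \<Prod>i\<in>J. phi k (pair a m \<xi> i)"])
         (auto simp: \<eta> intro!: prod.cong phi_pair_close)
    finally show ?thesis by (simp only: J_def)
  qed
  have "(\<Sum>\<xi>\<in>PiE {..<m} (\<lambda>_. reps (Suc k)). \<Prod>i\<in>I. phi (Suc k) (pair a m \<xi> i))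
      = (\<Sum>\<xi>0\<in>X. p ^ (Suc k * (card I - card (vanishing I \<xi>0))) * S (vanishing I \<xi>0))"
    unfolding sum_cube_Suc X_def[symmetric] by (rule sum.cong[OF refl inner])
  also have "\<dots> = (\<Sum>J\<in>{J \<in> flats TYPE('a) a n m. J \<subseteq> I}. \<Sum>\<xi>0\<in>{\<xi>0 \<in> X. vanishing I \<xi>0 = J}.
      p ^ (Suc k * (card I - card (vanishing I \<xi>0))) * S (vanishing I \<xi>0))"
  proof (rule sum.group[symmetric])
    show "vanishing I ` X \<subseteq> {J \<in> flats TYPE('a) a n m. J \<subseteq> I}"
      using vanishing_flat[OF I] digit_vec by (auto simp: X_def vanishing_def)
  qed (use fX finite_flats in auto)
  also have "\<dots> = (\<Sum>J\<in>{J \<in> flats TYPE('a) a n m. J \<subseteq> I}.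
      real (card {\<xi>0 \<in> X. vanishing I \<xi>0 = J}) * (p ^ (Suc k * (card I - card J)) * S J))"
    by (intro sum.cong) auto
  also have "\<dots> = (\<Sum>J\<in>{J \<in> flats TYPE('a) a n m. J \<subseteq> I}.
      q ^ (m - rk TYPE('a) a m I) * charpoly TYPE('a) a n m J I q * (p ^ (Suc k * (card I - card J)) * S J))"
    by (intro sum.cong) (auto simp: X_def card_residue_stratum[OF I])
  finally have main: "(\<Sum>\<xi>\<in>PiE {..<m} (\<lambda>_. reps (Suc k)). \<Prod>i\<in>I. phi (Suc k) (pair a m \<xi> i)) = \<dots>" .
  \<comment> \<open>Level \<open>k + 1\<close> is normalised by \<open>p ^ m\<close> more than level
    \<open>k\<close>. The power of \<open>q\<close> in the stratum size cancels all of it except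
    \<open>p\<close> to the rank of \<open>I\<close>.\<close>
  have pq: "p ^ (Suc k * m) * q ^ (m - rk TYPE('a) a m I) = p ^ rk TYPE('a) a m I * p ^ (k * m)"
  proof -
    have "m = rk TYPE('a) a m I + (m - rk TYPE('a) a m I)"
      using rank_le[OF flat_subset[OF I]] by simp
    then have "p ^ m = p ^ rk TYPE('a) a m I * p ^ (m - rk TYPE('a) a m I)"
      by (metis power_add)
    moreover have "p ^ (Suc k * m) = p ^ m * p ^ (k * m)" by (simp add: power_add)
    ultimately have "p ^ (Suc k * m) * q ^ (m - rk TYPE('a) a m I)
        = p ^ rk TYPE('a) a m I * p ^ (k * m) * (p ^ (m - rk TYPE('a) a m I) * q ^ (m - rk TYPE('a) a m I))"
      by (simp only: mult_ac)
    then show ?thesis by simp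
  qed
  have "dual_avg (Suc k) I = p ^ (Suc k * m) * (\<Sum>J\<in>{J \<in> flats TYPE('a) a n m. J \<subseteq> I}.
      q ^ (m - rk TYPE('a) a m I) * charpoly TYPE('a) a n m J I q * (p ^ (Suc k * (card I - card J)) * S J))"
    unfolding dual_avg_def main ..
  also have "\<dots> = (\<Sum>J\<in>{J \<in> flats TYPE('a) a n m. J \<subseteq> I}. p ^ (Suc k * m) *
      (q ^ (m - rk TYPE('a) a m I) * charpoly TYPE('a) a n m J I q * (p ^ (Suc k * (card I - card J)) * S J)))"
    by (rule sum_distrib_left)
  also have "\<dots> = (\<Sum>J\<in>{J \<in> flats TYPE('a) a n m. J \<subseteq> I}.
    p ^ rk TYPE('a) a m I * charpoly TYPE('a) a n m J I q * p ^ (Suc k * (card I - card J)) * dual_avg k J)"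
  proof (rule sum.cong[OF refl])
    fix J
    let ?c = "charpoly TYPE('a) a n m J I q" and ?e = "p ^ (Suc k * (card I - card J))"
    have "p ^ (Suc k * m) * (q ^ (m - rk TYPE('a) a m I) * ?c * (?e * S J))
        = (p ^ (Suc k * m) * q ^ (m - rk TYPE('a) a m I)) * (?c * (?e * S J))" by (simp only: mult.assoc)
    also have "\<dots> = p ^ rk TYPE('a) a m I * ?c * ?e * dual_avg k J"
      unfolding pq S_def dual_avg_def by (simp only: mult_ac)
    finally show "p ^ (Suc k * m) * (q ^ (m - rk TYPE('a) a m I) * ?c * (?e * S J))
      = p ^ rk TYPE('a) a m I * ?c * ?e * dual_avg k J" .
  qed
  finally show ?thesis .
qed

end

section \<open>Generating functions and chains of flats\<close>

text \<open>Unlike \<open>chains\<close>, it allows any top \<open>I\<close> and the empty chain;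
  both are needed to recurse on the first flat below \<open>I\<close>.\<close>

definition chains_from :: "nat set set \<Rightarrow> nat set \<Rightarrow> nat set list set" where
  "chains_from F I = {cs. set cs \<subseteq> F \<and> sorted_wrt (\<lambda>A B. B \<subset> A) (I # cs)}"

lemma chains_from_rec:
  "chains_from F I = insert [] (\<Union>J\<in>{J \<in> F. J \<subset> I}. (#) J ` chains_from F J)"
proof (intro equalityI subsetI)
  fix cs assume "cs \<in> chains_from F I"
  then show "cs \<in> insert [] (\<Union>J\<in>{J \<in> F. J \<subset> I}. (#) J ` chains_from F J)"
    by (cases cs) (auto simp: chains_from_def)
next
  fix cs assume "cs \<in> insert [] (\<Union>J\<in>{J \<in> F. J \<subset> I}. (#) J ` chains_from F J)"
  then consider "cs = []" | J ds where "cs = J # ds" "J \<in> F" "J \<subset> I" "ds \<in> chains_from F J"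
    by blast
  then show "cs \<in> chains_from F I"
  proof cases
    case 2
    then have "\<forall>A\<in>set ds. A \<subset> I" by (auto simp: chains_from_def dest: psubset_trans)
    then show ?thesis using 2 by (simp add: chains_from_def)
  qed (simp add: chains_from_def)
qed

lemma finite_chains_from: "finite I \<Longrightarrow> finite F \<Longrightarrow> finite (chains_from F I)"
proof (induction I rule: finite_psubset_induct)
  case (psubset I)
  then show ?case by (subst chains_from_rec) (auto intro!: finite_imageI)
qed

lemma sum_chains_from_rec:
  fixes w :: "nat set list \<Rightarrow> 'b::comm_monoid_add"
  assumes "finite F" "finite I"
  shows "(\<Sum>cs\<in>chains_from F I. w cs) = w [] + (\<Sum>J\<in>{J \<in> F. J \<subset> I}. \<Sum>cs\<in>chains_from F J. w (J # cs))"
proof -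
  have fin: "finite (chains_from F J)" if "J \<subset> I" for J
    using that assms by (intro finite_chains_from) (auto intro: finite_subset)
  have "(\<Sum>cs\<in>chains_from F I. w cs) = w [] + (\<Sum>cs\<in>(\<Union>J\<in>{J \<in> F. J \<subset> I}. (#) J ` chains_from F J). w cs)"
    using assms fin by (subst chains_from_rec, subst sum.insert) auto
  also have "(\<Sum>cs\<in>(\<Union>J\<in>{J \<in> F. J \<subset> I}. (#) J ` chains_from F J). w cs)
      = (\<Sum>J\<in>{J \<in> F. J \<subset> I}. \<Sum>cs\<in>(#) J ` chains_from F J. w cs)"
    using assms fin by (intro sum.UNION_disjoint) auto
  also have "\<dots> = (\<Sum>J\<in>{J \<in> F. J \<subset> I}. \<Sum>cs\<in>chains_from F J. w (J # cs))"
    by (rule sum.cong[OF refl]) (simp add: sum.reindex)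
  finally show ?thesis .
qed

context hypertoric
begin

text \<open>The weight frees the coefficients of the recursion from \<open>k\<close>: it turns
  \<open>p ^ (Suc k * (card I - card J))\<close> into \<open>p ^ (n - card J)\<close>. For the full
  set it equals 1.\<close>

definition scaled_avg :: "nat \<Rightarrow> nat set \<Rightarrow> real" where
  "scaled_avg k I = p ^ (k * (n - card I)) * dual_avg k I"

lemma scaled_avg_bounds: "0 \<le> scaled_avg k I" "scaled_avg k I \<le> 1"
  using dual_avg_bounds[of k I] unfolding scaled_avg_def
  by (auto intro!: mult_nonneg_nonneg mult_le_one simp: less_imp_le)

lemma scaled_avg_0: "scaled_avg 0 I = 1"
  by (simp add: scaled_avg_def dual_avg_0)

lemma scaled_avg_full: "scaled_avg k {..<n} = dual_avg k {..<n}"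
  by (simp add: scaled_avg_def)

lemma scaled_avg_Suc:
  assumes I: "I \<in> flats TYPE('a) a n m"
  shows "scaled_avg (Suc k) I = (\<Sum>J\<in>{J \<in> flats TYPE('a) a n m. J \<subseteq> I}.
    p ^ rk TYPE('a) a m I * charpoly TYPE('a) a n m J I q * p ^ (n - card J) * scaled_avg k J)"
  unfolding scaled_avg_def dual_avg_Suc[OF I] sum_distrib_left
proof (rule sum.cong[OF refl])
  fix J assume J: "J \<in> {J \<in> flats TYPE('a) a n m. J \<subseteq> I}"
  let ?r = "p ^ rk TYPE('a) a m I" and ?c = "charpoly TYPE('a) a n m J I q"
  have "card I \<le> card {..<n}" by (rule card_mono) (use flat_subset[OF I] in auto)
  moreover have "card J \<le> card I" by (rule card_mono) (use J finite_flat[OF I] in auto)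
  ultimately have "n - card I + (card I - card J) = n - card J" by simp
  then have "Suc k * (n - card I) + Suc k * (card I - card J) = (n - card J) + k * (n - card J)"
    by (metis add_mult_distrib2 mult_Suc)
  then have e: "p ^ (Suc k * (n - card I)) * p ^ (Suc k * (card I - card J)) = p ^ (n - card J) * p ^ (k * (n - card J))"
    by (metis power_add)
  have "p ^ (Suc k * (n - card I)) * (?r * ?c * p ^ (Suc k * (card I - card J)) * dual_avg k J)
      = ?r * ?c * (p ^ (Suc k * (n - card I)) * p ^ (Suc k * (card I - card J))) * dual_avg k J"
    by (simp only: mult_ac)
  also have "\<dots> = ?r * ?c * p ^ (n - card J) * (p ^ (k * (n - card J)) * dual_avg k J)"
    unfolding e by (simp only: mult_ac)
  finally show "p ^ (Suc k * (n - card I)) * (?r * ?c * p ^ (Suc k * (card I - card J)) * dual_avg k J)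
      = ?r * ?c * p ^ (n - card J) * (p ^ (k * (n - card J)) * dual_avg k J)" .
qed

section \<open>Generating functions and their triangular system\<close>

definition gen_fun :: "complex \<Rightarrow> nat set \<Rightarrow> complex" where
  "gen_fun u I = (\<Sum>k. u ^ k * of_real (scaled_avg k I))"

lemma summable_gen_fun:
  assumes "norm u < 1"
  shows "summable (\<lambda>k. u ^ k * of_real (scaled_avg k I) :: complex)"
proof (rule summable_comparison_test[OF _ summable_geometric[of "norm u"]])
  show "\<exists>N. \<forall>k\<ge>N. norm (u ^ k * of_real (scaled_avg k I) :: complex) \<le> norm u ^ k"
  proof (intro exI allI impI)
    fix k
    show "norm (u ^ k * of_real (scaled_avg k I) :: complex) \<le> norm u ^ k"
      using scaled_avg_bounds[of k I] by (simp add: norm_mult norm_power mult_left_le)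
  qed
qed (use assms in simp)

lemma gen_fun_tail:
  assumes "norm u < 1"
  shows "gen_fun u I = 1 + u * (\<Sum>k. u ^ k * of_real (scaled_avg (Suc k) I))"
    "summable (\<lambda>k. u ^ k * of_real (scaled_avg (Suc k) I) :: complex)"
proof -
  show sm: "summable (\<lambda>k. u ^ k * of_real (scaled_avg (Suc k) I) :: complex)"
  proof (rule summable_comparison_test[OF _ summable_geometric[of "norm u"]])
    show "\<exists>N. \<forall>k\<ge>N. norm (u ^ k * of_real (scaled_avg (Suc k) I) :: complex) \<le> norm u ^ k"
    proof (intro exI allI impI)
      fix k
      show "norm (u ^ k * of_real (scaled_avg (Suc k) I) :: complex) \<le> norm u ^ k"
        using scaled_avg_bounds[of "Suc k" I] by (simp add: norm_mult norm_power mult_left_le)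
    qed
  qed (use assms in simp)
  have "gen_fun u I = 1 + (\<Sum>k. u ^ Suc k * of_real (scaled_avg (Suc k) I))"
    using suminf_split_head[OF summable_gen_fun[OF assms, of I]] by (simp add: gen_fun_def scaled_avg_0)
  also have "(\<Sum>k. u ^ Suc k * of_real (scaled_avg (Suc k) I)) = u * (\<Sum>k. u ^ k * of_real (scaled_avg (Suc k) I) :: complex)"
    using suminf_mult[OF sm, of u] by (simp add: mult.assoc)
  finally show "gen_fun u I = 1 + u * (\<Sum>k. u ^ k * of_real (scaled_avg (Suc k) I))" .
qed

text \<open>The sum includes \<open>J = I\<close>, where \<open>charpoly\<close> is 1 and the
  coefficient is \<open>p\<close> to the power delta_I; this term is the source of the denominators
  of the chain formula.\<close>

lemma gen_fun_rec:
  assumes u: "norm u < 1" and I: "I \<in> flats TYPE('a) a n m"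
  shows "gen_fun u I = 1 + u * (\<Sum>J\<in>{J \<in> flats TYPE('a) a n m. J \<subseteq> I}.
    of_real (p ^ rk TYPE('a) a m I * charpoly TYPE('a) a n m J I q * p ^ (n - card J)) * gen_fun u J)"
proof -
  let ?F = "{J \<in> flats TYPE('a) a n m. J \<subseteq> I}"
  define c where "c J = p ^ rk TYPE('a) a m I * charpoly TYPE('a) a n m J I q * p ^ (n - card J)" for J
  have "(\<Sum>k. u ^ k * of_real (scaled_avg (Suc k) I) :: complex)
      = (\<Sum>k. \<Sum>J\<in>?F. of_real (c J) * (u ^ k * of_real (scaled_avg k J)))"
    unfolding scaled_avg_Suc[OF I] c_def[symmetric]
    by (intro suminf_cong) (simp add: sum_distrib_left mult_ac)
  also have "\<dots> = (\<Sum>J\<in>?F. \<Sum>k. of_real (c J) * (u ^ k * of_real (scaled_avg k J)))"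
    by (intro suminf_sum summable_mult summable_gen_fun u)
  also have "\<dots> = (\<Sum>J\<in>?F. of_real (c J) * gen_fun u J)"
    unfolding gen_fun_def by (intro sum.cong refl suminf_mult summable_gen_fun u)
  finally show ?thesis using gen_fun_tail(1)[OF u, of I] by (simp add: c_def)
qed

lemma charpoly_self: "I \<in> flats TYPE('a) a n m \<Longrightarrow> charpoly TYPE('a) a n m I I t = 1"
proof -
  assume I: "I \<in> flats TYPE('a) a n m"
  then have "{G \<in> flats TYPE('a) a n m. I \<subseteq> G \<and> G \<subseteq> I} = {I}" by auto
  then show ?thesis using I finite_flat[OF I] by (simp add: charpoly_def mobius.simps)
qed

text \<open>\<open>last (I # cs)\<close> gives the empty chain a weight too, governed by
  \<open>I\<close> itself.\<close>

definition chain_weight :: "complex \<Rightarrow> nat set \<Rightarrow> nat set list \<Rightarrow> complex" where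
  "chain_weight s I cs = of_real (inverse (q ^ (m - rk TYPE('a) a m (last (I # cs)))))
     * (\<Prod>i<length cs. of_real (charpoly TYPE('a) a n m (cs ! i) ((I # cs) ! i) q)
          / (of_real q powr (s + of_nat (deltaF TYPE('a) a n m (cs ! i))) - 1))"

lemma chain_weight_Cons:
  "chain_weight s I (J # cs) = of_real (charpoly TYPE('a) a n m J I q)
     / (of_real q powr (s + of_nat (deltaF TYPE('a) a n m J)) - 1) * chain_weight s J cs"
  by (simp add: chain_weight_def prod.lessThan_Suc_shift mult_ac del: of_real_inverse prod.lessThan_Suc)

lemma q_powr_neg:
  assumes "Re s > 0"
  defines "u \<equiv> complex_of_real q powr (- s)"
  shows "norm u < 1" "u \<noteq> 0" "complex_of_real q powr s = 1 / u"
    "complex_of_real q powr (s + of_nat d) = 1 / (u * of_real (p ^ d))"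
proof -
  have "norm u = q powr (- Re s)"
    unfolding u_def by (subst norm_powr_real_powr) (auto simp: less_imp_le)
  also have "\<dots> < 1" using assms by (intro powr_less_one) auto
  finally show "norm u < 1" .
  show "u \<noteq> 0" by (simp add: u_def)
  have qs: "complex_of_real q powr s = 1 / u" by (simp add: u_def powr_minus field_simps)
  then show "complex_of_real q powr s = 1 / u" .
  have "complex_of_real q powr of_nat d = of_real (q ^ d)"
    by (subst powr_nat') auto
  then show "complex_of_real q powr (s + of_nat d) = 1 / (u * of_real (p ^ d))"
    by (simp add: powr_add qs p_def power_one_over field_simps)
qed

text \<open>Keeps the denominators \<open>1 - u * p ^ d\<close> away from zero.\<close>

lemma norm_mult_p_power_less: "norm u < 1 \<Longrightarrow> norm (u * complex_of_real (p ^ d)) < 1"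
proof -
  assume u: "norm u < 1"
  have "norm (u * complex_of_real (p ^ d)) = norm u * p ^ d"
    by (simp add: norm_mult norm_power abs_of_pos)
  also have "\<dots> \<le> norm u * 1" by (intro mult_left_mono) auto
  finally show ?thesis using u by simp
qed

text \<open>Both sides obey the same recursion: the left by splitting off the first flat
  \<open>J\<close> below \<open>I\<close>, the right by moving the term \<open>J = I\<close> of
  \<open>gen_fun_rec\<close> to the other side. The factor in delta_J supplied by the induction
  hypothesis cancels the denominator belonging to \<open>J\<close>.\<close>

lemma sum_chain_weight:
  assumes s: "Re s > 0" and I: "I \<in> flats TYPE('a) a n m"
  defines "u \<equiv> complex_of_real q powr (- s)"
  shows "(\<Sum>cs\<in>chains_from (flats TYPE('a) a n m) I. chain_weight s I cs)
    = (1 - u * of_real (p ^ deltaF TYPE('a) a n m I)) * of_real (p ^ (m - rk TYPE('a) a m I)) * gen_fun u I"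
  using finite_flat[OF I] I
proof (induction I rule: finite_psubset_induct)
  case (psubset I)
  note u = q_powr_neg[OF s, folded u_def]
  let ?L = "flats TYPE('a) a n m"
  let ?\<chi> = "\<lambda>J. complex_of_real (charpoly TYPE('a) a n m J I q)"
  let ?r = "rk TYPE('a) a m" and ?d = "deltaF TYPE('a) a n m"
  have term_eq: "?\<chi> J / (of_real q powr (s + of_nat (?d J)) - 1) * (\<Sum>cs\<in>chains_from ?L J. chain_weight s J cs)
      = of_real (p ^ m) * (u * (?\<chi> J * of_real (p ^ (n - card J)) * gen_fun u J))"
    if J: "J \<in> ?L" "J \<subset> I" for J
  proof -
    \<comment> \<open>\<open>x\<close> is \<open>q\<close> to the power -(s + delta_J), so the
      denominator is \<open>1 / x - 1 = (1 - x) / x\<close>.\<close>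
    define x where "x = u * complex_of_real (p ^ ?d J)"
    have x: "x \<noteq> 0" "x \<noteq> 1"
      using u(2) norm_mult_p_power_less[OF u(1), of "?d J"] by (auto simp: x_def)
    have e1: "?\<chi> J / (1 / x - 1) * ((1 - x) * of_real (p ^ (m - ?r J)) * gen_fun u J)
        = ?\<chi> J * (x * of_real (p ^ (m - ?r J))) * gen_fun u J"
      using x by (simp add: divide_simps)
    \<comment> \<open>delta_J plus \<open>m\<close> minus the rank of \<open>J\<close> equals
      \<open>m + (n - card J)\<close>: the rank drops out.\<close>
    have e2: "x * of_real (p ^ (m - ?r J)) = u * of_real (p ^ m) * of_real (p ^ (n - card J))"
    proof -
      have "p ^ ?d J * p ^ (m - ?r J) = p ^ m * p ^ (n - card J)"
        using rank_le[OF flat_subset[OF J(1)]] by (simp add: deltaF_def add.commute flip: power_add)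
      then show ?thesis unfolding x_def by (metis mult.assoc of_real_mult)
    qed
    show ?thesis
      unfolding psubset.IH[OF J(2) J(1)] u(4) x_def[symmetric] e1 e2 by (simp only: mult_ac)
  qed
  have "(\<Sum>cs\<in>chains_from ?L I. chain_weight s I cs) = of_real (p ^ (m - ?r I))
      + (\<Sum>J\<in>{J \<in> ?L. J \<subset> I}. \<Sum>cs\<in>chains_from ?L J. chain_weight s I (J # cs))"
    using sum_chains_from_rec[OF finite_flats psubset.hyps, of "chain_weight s I"]
    by (simp add: chain_weight_def p_def power_one_over inverse_eq_divide)
  also have "(\<Sum>J\<in>{J \<in> ?L. J \<subset> I}. \<Sum>cs\<in>chains_from ?L J. chain_weight s I (J # cs))
      = (\<Sum>J\<in>{J \<in> ?L. J \<subset> I}. of_real (p ^ m) * (u * (?\<chi> J * of_real (p ^ (n - card J)) * gen_fun u J)))"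
  proof (rule sum.cong[OF refl])
    fix J assume "J \<in> {J \<in> ?L. J \<subset> I}"
    then show "(\<Sum>cs\<in>chains_from ?L J. chain_weight s I (J # cs))
        = of_real (p ^ m) * (u * (?\<chi> J * of_real (p ^ (n - card J)) * gen_fun u J))"
      unfolding chain_weight_Cons sum_distrib_left[symmetric] by (intro term_eq) auto
  qed
  also have "of_real (p ^ (m - ?r I)) + \<dots> = of_real (p ^ (m - ?r I)) *
      (1 + u * (\<Sum>J\<in>{J \<in> ?L. J \<subset> I}. of_real (p ^ ?r I) * ?\<chi> J * of_real (p ^ (n - card J)) * gen_fun u J))"
  proof -
    have "p ^ m = p ^ (m - ?r I) * p ^ ?r I"
      using rank_le[OF flat_subset[OF psubset.prems]] by (simp flip: power_add)
    then have "complex_of_real (p ^ m) = of_real (p ^ (m - ?r I)) * of_real (p ^ ?r I)"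
      by (simp only: of_real_mult)
    then show ?thesis by (simp only: distrib_left sum_distrib_left mult_1_right mult_1_left mult_ac)
  qed
  also have "1 + u * (\<Sum>J\<in>{J \<in> ?L. J \<subset> I}. of_real (p ^ ?r I) * ?\<chi> J * of_real (p ^ (n - card J)) * gen_fun u J)
      = (1 - u * of_real (p ^ ?d I)) * gen_fun u I"
  proof -
    have set: "{J \<in> ?L. J \<subseteq> I} = insert I {J \<in> ?L. J \<subset> I}" using psubset.prems by auto
    have "gen_fun u I = 1 + u * (\<Sum>J\<in>{J \<in> ?L. J \<subseteq> I}. of_real (p ^ ?r I) * ?\<chi> J * of_real (p ^ (n - card J)) * gen_fun u J)"
      using gen_fun_rec[OF u(1) psubset.prems] by (simp only: of_real_mult)
    also have "\<dots> = 1 + u * (of_real (p ^ ?d I) * gen_fun u I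
        + (\<Sum>J\<in>{J \<in> ?L. J \<subset> I}. of_real (p ^ ?r I) * ?\<chi> J * of_real (p ^ (n - card J)) * gen_fun u J))"
      unfolding set using finite_flats psubset.prems
      by (subst sum.insert) (auto simp: charpoly_self deltaF_def power_add)
    finally show ?thesis by (simp add: algebra_simps)
  qed
  finally show ?case by (simp only: mult_ac)
qed

end

section \<open>The moment map and its level sets\<close>

lemma sum_card_swap:
  assumes "finite A" "finite B"
  shows "(\<Sum>x\<in>A. card {y \<in> B. R x y}) = (\<Sum>y\<in>B. card {x \<in> A. R x y})"
proof -
  have "(\<Sum>x\<in>A. card {y \<in> B. R x y}) = (\<Sum>x\<in>A. \<Sum>y\<in>B. if R x y then 1 else 0)"
    using assms by (simp add: sum.If_cases Int_def)
  also have "\<dots> = (\<Sum>y\<in>B. \<Sum>x\<in>A. if R x y then 1 else 0)" by (rule sum.swap)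
  also have "\<dots> = (\<Sum>y\<in>B. card {x \<in> A. R x y})"
    using assms by (simp add: sum.If_cases Int_def)
  finally show ?thesis .
qed

context hypertoric
begin

definition zero_pairs :: "nat \<Rightarrow> ((nat \<Rightarrow> 'a) \<times> (nat \<Rightarrow> 'a)) set" where
  "zero_pairs k = {(x, y) \<in> PiE {..<n} (\<lambda>_. reps k) \<times> PiE {..<n} (\<lambda>_. reps k).
     \<forall>j<m. v (\<Sum>i<n. x i * y i * of_int (a i j)) \<le> p ^ k}"

text \<open>For fixed \<open>y\<close> the moment map is linear in \<open>x\<close>; transposing it turns the count of pairs
  \<open>(x, y)\<close> into a count of pairs \<open>(\<xi>, y)\<close>, in which the coordinates of \<open>y\<close> decouple.\<close>
lemma card_zero_pairs: "real (card (zero_pairs k)) = q ^ (k * n) * q ^ (k * n) * dual_avg k {..<n}"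
proof -
  define Q where "Q = PiE {..<n} (\<lambda>_. reps k)"
  define R where "R = PiE {..<m} (\<lambda>_. reps k)"
  have fin: "finite Q" "finite R" by (auto simp: Q_def R_def finite_PiE)
  have int: "v (y i * of_int (a i j)) \<le> 1" if "y \<in> Q" "i < n" for y i j
    using that v_reps[of "y i" k] by (intro v_mult_le v_of_int) (auto simp: Q_def PiE_iff)
  have "zero_pairs k = prod.swap ` (SIGMA y:Q. {x \<in> Q. \<forall>j<m. v (\<Sum>i<n. x i * y i * of_int (a i j)) \<le> p ^ k})"
    by (force simp: zero_pairs_def Q_def)
  then have "card (zero_pairs k) = card (SIGMA y:Q. {x \<in> Q. \<forall>j<m. v (\<Sum>i<n. x i * y i * of_int (a i j)) \<le> p ^ k})"
    by (simp add: card_image)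
  then have "real (card (zero_pairs k)) = (\<Sum>y\<in>Q. real (card {x \<in> Q. \<forall>j<m. v (\<Sum>i<n. x i * y i * of_int (a i j)) \<le> p ^ k}))"
    using fin by simp
  also have "\<dots> = (\<Sum>y\<in>Q. q ^ (k * n) * p ^ (k * m) * real (card {\<xi> \<in> R. \<forall>i<n. v (pair a m \<xi> i * y i) \<le> p ^ k}))"
  proof (rule sum.cong[OF refl])
    \<comment> \<open>\<open>x\<close> has \<open>n\<close> unknowns under \<open>m\<close>
      congruences, \<open>\<xi>\<close> has \<open>m\<close> unknowns under \<open>n\<close>
      congruences; the densities agree, so the counts differ only by a power of
      \<open>q\<close>.\<close>
    fix y assume y: "y \<in> Q"
    have "kernel_frac k {..<m} {..<n} (\<lambda>j i. y i * of_int (a i j)) = kernel_frac k {..<n} {..<m} (\<lambda>i j. y i * of_int (a i j))"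
      by (rule kernel_frac_transpose) (use int[OF y] in auto)
    moreover have "kernel_frac k {..<m} {..<n} (\<lambda>j i. y i * of_int (a i j))
        = real (card {x \<in> Q. \<forall>j<m. v (\<Sum>i<n. x i * y i * of_int (a i j)) \<le> p ^ k}) * p ^ (k * n)"
      by (simp add: kernel_frac_def Q_def Ball_def mult_ac)
    moreover have "kernel_frac k {..<n} {..<m} (\<lambda>i j. y i * of_int (a i j))
        = real (card {\<xi> \<in> R. \<forall>i<n. v (pair a m \<xi> i * y i) \<le> p ^ k}) * p ^ (k * m)"
      by (simp add: kernel_frac_def R_def pair_def Ball_def sum_distrib_left mult_ac)
    ultimately have *: "real (card {x \<in> Q. \<forall>j<m. v (\<Sum>i<n. x i * y i * of_int (a i j)) \<le> p ^ k}) * p ^ (k * n)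
        = real (card {\<xi> \<in> R. \<forall>i<n. v (pair a m \<xi> i * y i) \<le> p ^ k}) * p ^ (k * m)" by simp
    have "real (card {x \<in> Q. \<forall>j<m. v (\<Sum>i<n. x i * y i * of_int (a i j)) \<le> p ^ k})
      = q ^ (k * n) * (real (card {x \<in> Q. \<forall>j<m. v (\<Sum>i<n. x i * y i * of_int (a i j)) \<le> p ^ k}) * p ^ (k * n))"
      using q_power_p_power(1)[of "k * n"] by (simp add: mult_ac)
    then show "real (card {x \<in> Q. \<forall>j<m. v (\<Sum>i<n. x i * y i * of_int (a i j)) \<le> p ^ k})
      = q ^ (k * n) * p ^ (k * m) * real (card {\<xi> \<in> R. \<forall>i<n. v (pair a m \<xi> i * y i) \<le> p ^ k})"
      unfolding * by (simp only: mult_ac)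
  qed
  also have "\<dots> = q ^ (k * n) * p ^ (k * m) * real (\<Sum>y\<in>Q. card {\<xi> \<in> R. \<forall>i<n. v (pair a m \<xi> i * y i) \<le> p ^ k})"
    by (simp add: sum_distrib_left)
  finally have pairs: "real (card (zero_pairs k)) = q ^ (k * n) * p ^ (k * m)
      * real (\<Sum>y\<in>Q. card {\<xi> \<in> R. \<forall>i<n. v (pair a m \<xi> i * y i) \<le> p ^ k})" .
  \<comment> \<open>With \<open>\<xi>\<close> fixed instead of \<open>y\<close>, the conditions on
    the coordinates \<open>y i\<close> are independent, and the count becomes a product.\<close>
  have swap: "(\<Sum>y\<in>Q. card {\<xi> \<in> R. \<forall>i<n. v (pair a m \<xi> i * y i) \<le> p ^ k})
      = (\<Sum>\<xi>\<in>R. card {y \<in> Q. \<forall>i<n. v (pair a m \<xi> i * y i) \<le> p ^ k})"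
    by (rule sum_card_swap[OF fin])
  have fibre: "real (\<Sum>\<xi>\<in>R. card {y \<in> Q. \<forall>i<n. v (pair a m \<xi> i * y i) \<le> p ^ k})
      = (\<Sum>\<xi>\<in>R. q ^ (k * n) * (\<Prod>i<n. phi k (pair a m \<xi> i)))"
    unfolding of_nat_sum
  proof (rule sum.cong[OF refl])
    fix \<xi> assume \<xi>: "\<xi> \<in> R"
    have "{y \<in> Q. \<forall>i<n. v (pair a m \<xi> i * y i) \<le> p ^ k} = PiE {..<n} (\<lambda>i. {d \<in> reps k. v (pair a m \<xi> i * d) \<le> p ^ k})"
    proof (intro equalityI subsetI)
      fix y assume y: "y \<in> {y \<in> Q. \<forall>i<n. v (pair a m \<xi> i * y i) \<le> p ^ k}"
      show "y \<in> PiE {..<n} (\<lambda>i. {d \<in> reps k. v (pair a m \<xi> i * d) \<le> p ^ k})"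
      proof (rule PiE_I)
        have yQ: "y \<in> PiE {..<n} (\<lambda>_. reps k)" using y by (simp add: Q_def)
        fix i
        show "y i = undefined" if "i \<notin> {..<n}" using PiE_arb[OF yQ that] .
        show "y i \<in> {d \<in> reps k. v (pair a m \<xi> i * d) \<le> p ^ k}" if "i \<in> {..<n}"
          using PiE_mem[OF yQ that] y that by simp
      qed
    next
      fix y assume y: "y \<in> PiE {..<n} (\<lambda>i. {d \<in> reps k. v (pair a m \<xi> i * d) \<le> p ^ k})"
      have "y \<in> Q" unfolding Q_def
        using PiE_mem[OF y] PiE_arb[OF y] by (intro PiE_I) blast+
      then show "y \<in> {y \<in> Q. \<forall>i<n. v (pair a m \<xi> i * y i) \<le> p ^ k}"
        using PiE_mem[OF y] by simp
    qed
    then have "real (card {y \<in> Q. \<forall>i<n. v (pair a m \<xi> i * y i) \<le> p ^ k})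
        = (\<Prod>i<n. real (card {d \<in> reps k. v (pair a m \<xi> i * d) \<le> p ^ k}))"
      by (simp add: card_PiE)
    also have "\<dots> = (\<Prod>i<n. q ^ k * phi k (pair a m \<xi> i))"
    proof (rule prod.cong[OF refl])
      fix i
      have "v (pair a m \<xi> i) \<le> 1" using rep_vec \<xi> by (intro v_pair) (auto simp: R_def)
      then show "real (card {d \<in> reps k. v (pair a m \<xi> i * d) \<le> p ^ k}) = q ^ k * phi k (pair a m \<xi> i)"
        using card_reps_affine[of "pair a m \<xi> i" 0 k] by simp
    qed
    also have "\<dots> = q ^ (k * n) * (\<Prod>i<n. phi k (pair a m \<xi> i))"
      by (simp add: prod.distrib power_mult)
    finally show "real (card {y \<in> Q. \<forall>i<n. v (pair a m \<xi> i * y i) \<le> p ^ k}) = q ^ (k * n) * (\<Prod>i<n. phi k (pair a m \<xi> i))" .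
  qed
  show ?thesis
    unfolding pairs swap fibre by (simp add: dual_avg_def R_def sum_distrib_left[symmetric] mult_ac)
qed

lemma mu_norm_le_iff: "mu_norm v a n m x y \<le> p ^ k \<longleftrightarrow> (\<forall>j<m. v (\<Sum>i<n. x i * y i * of_int (a i j)) \<le> p ^ k)"
  unfolding mu_norm_def by (subst Max_le_iff) (auto simp: less_imp_le)

lemma mu_norm_cases:
  assumes "\<And>i. i < n \<Longrightarrow> v (x i) \<le> 1" "\<And>i. i < n \<Longrightarrow> v (y i) \<le> 1"
  obtains "mu_norm v a n m x y = 0" | l where "mu_norm v a n m x y = p ^ l"
proof -
  have "mu_norm v a n m x y \<in> insert 0 ((\<lambda>j. v (\<Sum>i<n. x i * y i * of_int (a i j))) ` {..<m})"
    unfolding mu_norm_def by (rule Max_in) auto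
  then consider "mu_norm v a n m x y = 0" | j where "mu_norm v a n m x y = v (\<Sum>i<n. x i * y i * of_int (a i j))"
    by auto
  then show thesis
  proof cases
    case 2
    have le: "v (\<Sum>i<n. x i * y i * of_int (a i j)) \<le> 1"
      using assms by (intro v_sum_le v_mult_le v_of_int) auto
    show thesis
    proof (cases "(\<Sum>i<n. x i * y i * of_int (a i j)) = 0")
      case True
      then show thesis using 2 by (intro that(1)) simp
    next
      case False
      then obtain l where "v (\<Sum>i<n. x i * y i * of_int (a i j)) = p ^ l"
        using v_cases_integral[OF le] by blast
      then show thesis using 2 by (intro that(2)) simp
    qed
  qed (rule that)
qed

end

section \<open>Haar measure of balls and boxes\<close>

locale hypertoric_haar = hypertoric v a n m
  for v :: "'a::field \<Rightarrow> real" and a n m +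
  fixes nu :: "'a measure"
  assumes haar: "haar_O v nu"
begin

definition ball :: "nat \<Rightarrow> 'a \<Rightarrow> 'a set" where
  "ball k x = {y \<in> ringO v. v (y - x) \<le> p ^ k}"

lemma space_nu: "space nu = ringO v"
  and emeasure_nu: "emeasure nu (ringO v) = 1"
  using haar unfolding haar_O_def by blast+

lemma ball_sets: "v x \<le> 1 \<Longrightarrow> ball k x \<in> sets nu"
proof -
  assume x: "v x \<le> 1"
  have "sets nu = sigma_sets (ringO v) {{y \<in> ringO v. v (y - x) \<le> r} | x r. x \<in> ringO v}"
    using haar unfolding haar_O_def by blast
  moreover have "ball k x \<in> {{y \<in> ringO v. v (y - x) \<le> r} | x r. x \<in> ringO v}"
    using x unfolding ball_def ringO_def by blast
  ultimately show ?thesis by (simp add: sigma_sets.Basic)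
qed

sublocale nu: finite_measure nu
  by standard (simp add: space_nu emeasure_nu)

lemma ball_translate:
  assumes "v x \<le> 1"
  shows "ball k x = (\<lambda>y. y + x) ` ball k 0"
proof (intro equalityI subsetI)
  fix y assume y: "y \<in> ball k x"
  then have "y - x \<in> ball k 0" using assms by (auto simp: ball_def ringO_def intro: v_diff_le)
  then show "y \<in> (\<lambda>y. y + x) ` ball k 0" by (rule rev_image_eqI) simp
next
  fix y assume "y \<in> (\<lambda>y. y + x) ` ball k 0"
  then show "y \<in> ball k x" using assms by (auto simp: ball_def ringO_def intro: v_add_le)
qed

text \<open>The balls around the \<open>q ^ k\<close> representatives partition the ring of integers
  and are translates of each other, so each has an equal share of the total mass 1.\<close>

lemma measure_ball:
  assumes x: "v x \<le> 1"
  shows "measure nu (ball k x) = p ^ k"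
proof -
  have tr: "measure nu (ball k d) = measure nu (ball k 0)" if d: "v d \<le> 1" for d
  proof -
    have "\<forall>A\<in>sets nu. \<forall>b\<in>ringO v. (\<lambda>x. x + b) ` A \<in> sets nu \<and> emeasure nu ((\<lambda>x. x + b) ` A) = emeasure nu A"
      using haar unfolding haar_O_def by blast
    then have "emeasure nu ((\<lambda>x. x + d) ` ball k 0) = emeasure nu (ball k 0)"
      using ball_sets[of 0 k] d by (simp add: ringO_def)
    then show ?thesis unfolding ball_translate[OF d] measure_def by simp
  qed
  have "ringO v = (\<Union>d\<in>reps k. ball k d)"
    using reps_exists by (auto simp: ball_def ringO_def)
  then have "1 = measure nu (\<Union>d\<in>reps k. ball k d)"
    using emeasure_nu by (simp add: measure_def)
  also have "\<dots> = (\<Sum>d\<in>reps k. measure nu (ball k d))"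
  proof (rule nu.finite_measure_finite_Union)
    show "ball k ` reps k \<subseteq> sets nu" using ball_sets v_reps by blast
    show "disjoint_family_on (ball k) (reps k)"
      unfolding disjoint_family_on_def
    proof (intro ballI impI)
      fix d e assume de: "d \<in> reps k" "e \<in> reps k" "d \<noteq> e"
      have "\<not> (v (y - d) \<le> p ^ k \<and> v (y - e) \<le> p ^ k)" for y
        using de reps_unique v_diff_trans v_minus_commute by metis
      then show "ball k d \<inter> ball k e = {}" by (auto simp: ball_def)
    qed
  qed simp
  also have "\<dots> = (\<Sum>d\<in>reps k. measure nu (ball k 0))"
    by (rule sum.cong[OF refl]) (rule tr[OF v_reps])
  also have "\<dots> = q ^ k * measure nu (ball k 0)" by (simp add: card_reps)
  finally have "p ^ k * 1 = p ^ k * (q ^ k * measure nu (ball k 0))" by simp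
  then have "measure nu (ball k 0) = p ^ k"
    using q_power_p_power(2)[of k] by (simp add: mult.assoc[symmetric] del: q_power_p_power)
  then show ?thesis using tr[OF x] by simp
qed

abbreviation cube_measure :: "(nat \<Rightarrow> 'a) measure" where
  "cube_measure \<equiv> PiM {..<n} (\<lambda>_. nu)"

abbreviation pair_measure_O :: "((nat \<Rightarrow> 'a) \<times> (nat \<Rightarrow> 'a)) measure" where
  "pair_measure_O \<equiv> cube_measure \<Otimes>\<^sub>M cube_measure"

definition box :: "nat \<Rightarrow> (nat \<Rightarrow> 'a) \<Rightarrow> (nat \<Rightarrow> 'a) set" where
  "box k x = PiE {..<n} (\<lambda>i. ball k (x i))"

sublocale prod_nu: product_sigma_finite "\<lambda>_. nu"
  by standard

lemma emeasure_cube: "emeasure cube_measure (space cube_measure) = 1"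
  unfolding space_PiM using prod_nu.emeasure_PiM[of "{..<n}" "\<lambda>_. space nu"]
  by (simp add: space_nu emeasure_nu sets.top[of nu, unfolded space_nu])

sublocale cube: finite_measure cube_measure
  by standard (simp add: emeasure_cube)

lemma rep_vec_n: "x \<in> PiE {..<n} (\<lambda>_. reps k) \<Longrightarrow> i < n \<Longrightarrow> v (x i) \<le> 1"
  using v_reps[of "x i" k] by (auto simp: PiE_iff)

lemma box_sets: "x \<in> PiE {..<n} (\<lambda>_. reps k) \<Longrightarrow> box k x \<in> sets cube_measure"
  unfolding box_def using rep_vec_n by (intro sets_PiM_I_finite) (auto intro!: ball_sets)

lemma emeasure_box:
  assumes x: "x \<in> PiE {..<n} (\<lambda>_. reps k)"
  shows "emeasure cube_measure (box k x) = ennreal (p ^ (k * n))"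
proof -
  have "emeasure cube_measure (box k x) = (\<Prod>i<n. emeasure nu (ball k (x i)))"
    unfolding box_def using rep_vec_n[OF x] by (intro prod_nu.emeasure_PiM) (auto intro!: ball_sets)
  also have "\<dots> = (\<Prod>i<n. ennreal (p ^ k))"
    using rep_vec_n[OF x] by (intro prod.cong) (auto simp: nu.emeasure_eq_measure measure_ball)
  also have "\<dots> = ennreal (p ^ (k * n))"
    by (simp add: ennreal_power less_imp_le power_mult)
  finally show ?thesis .
qed

lemma measure_box_pair:
  assumes "x \<in> PiE {..<n} (\<lambda>_. reps k)" "y \<in> PiE {..<n} (\<lambda>_. reps k)"
  shows "measure pair_measure_O (box k x \<times> box k y) = p ^ (k * n) * p ^ (k * n)"
proof -
  have "emeasure pair_measure_O (box k x \<times> box k y) = ennreal (p ^ (k * n)) * ennreal (p ^ (k * n))"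
    using assms by (simp add: cube.emeasure_pair_measure_Times box_sets emeasure_box)
  also have "\<dots> = ennreal (p ^ (k * n) * p ^ (k * n))"
    by (simp add: ennreal_mult less_imp_le)
  finally show ?thesis by (simp add: measure_def less_imp_le)
qed

lemma space_pair: "space pair_measure_O = PiE {..<n} (\<lambda>_. ringO v) \<times> PiE {..<n} (\<lambda>_. ringO v)"
  by (simp add: space_pair_measure space_PiM space_nu)

lemma finite_measure_pair: "finite_measure pair_measure_O"
proof
  have "emeasure pair_measure_O (space pair_measure_O) = 1"
    unfolding space_pair_measure by (simp add: cube.emeasure_pair_measure_Times emeasure_cube)
  then show "emeasure pair_measure_O (space pair_measure_O) \<noteq> \<infinity>" by simp
qed

section \<open>Volumes of the sublevel sets of the moment map\<close>

definition sublevel :: "nat \<Rightarrow> ((nat \<Rightarrow> 'a) \<times> (nat \<Rightarrow> 'a)) set" where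
  "sublevel k = {(x, y) \<in> space pair_measure_O. mu_norm v a n m x y \<le> p ^ k}"

text \<open>By bilinearity the moment map modulo level \<open>k\<close> depends only on
  \<open>x\<close> and \<open>y\<close> modulo level \<open>k\<close>, so the sublevel set is a
  finite union of boxes around representatives. This gives both its measurability and its
  volume.\<close>

lemma sublevel_eq: "sublevel k = (\<Union>(x, y)\<in>zero_pairs k. box k x \<times> box k y)"
proof -
  have close: "v ((\<Sum>i<n. x i * y i * of_int (a i j)) - (\<Sum>i<n. x' i * y' i * of_int (a i j))) \<le> p ^ k"
    if "\<And>i. i < n \<Longrightarrow> v (x i) \<le> 1" "\<And>i. i < n \<Longrightarrow> v (y' i) \<le> 1"
      "\<And>i. i < n \<Longrightarrow> v (x i - x' i) \<le> p ^ k" "\<And>i. i < n \<Longrightarrow> v (y i - y' i) \<le> p ^ k" for x y x' y' j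
  proof -
    have "(\<Sum>i<n. x i * y i * of_int (a i j)) - (\<Sum>i<n. x' i * y' i * of_int (a i j))
        = (\<Sum>i<n. (x i * (y i - y' i) + (x i - x' i) * y' i) * of_int (a i j))"
      by (simp add: sum_subtractf[symmetric] algebra_simps)
    also have "v \<dots> \<le> p ^ k"
      by (intro v_sum_le v_mult_le'[OF _ v_of_int] v_add_le)
         (auto simp: less_imp_le that intro!: v_mult_le[OF that(1) that(4)] v_mult_le'[OF that(3) that(2)])
    finally show ?thesis .
  qed
  show ?thesis
  proof (intro equalityI subsetI)
    fix z assume z: "z \<in> sublevel k"
    obtain x y where xy: "z = (x, y)" by (cases z)
    have O: "x \<in> PiE {..<n} (\<lambda>_. ringO v)" "y \<in> PiE {..<n} (\<lambda>_. ringO v)"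
      and le: "\<forall>j<m. v (\<Sum>i<n. x i * y i * of_int (a i j)) \<le> p ^ k"
      using z by (auto simp: xy sublevel_def space_pair mu_norm_le_iff)
    define x' where "x' = (\<lambda>i\<in>{..<n}. rep k (x i))"
    define y' where "y' = (\<lambda>i\<in>{..<n}. rep k (y i))"
    have vO: "v (x i) \<le> 1" "v (y i) \<le> 1" if "i < n" for i
      using O that by (auto simp: PiE_iff ringO_def)
    have x': "x' \<in> PiE {..<n} (\<lambda>_. reps k)" "y' \<in> PiE {..<n} (\<lambda>_. reps k)"
      using vO rep(1) by (auto simp: x'_def y'_def)
    have cl: "v (x i - x' i) \<le> p ^ k" "v (y i - y' i) \<le> p ^ k" if "i < n" for i
      using vO[OF that] rep(2) that by (auto simp: x'_def y'_def)
    have "v (\<Sum>i<n. x' i * y' i * of_int (a i j)) \<le> p ^ k" if "j < m" for j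
    proof -
      have "v ((\<Sum>i<n. x i * y i * of_int (a i j)) - ((\<Sum>i<n. x i * y i * of_int (a i j)) - (\<Sum>i<n. x' i * y' i * of_int (a i j)))) \<le> p ^ k"
        by (rule v_diff_le[OF le[rule_format, OF that] close]) (auto intro: vO cl rep_vec_n[OF x'(2)])
      then show ?thesis by simp
    qed
    then have "(x', y') \<in> zero_pairs k" using x' by (auto simp: zero_pairs_def)
    moreover have "z \<in> box k x' \<times> box k y'"
      using O cl by (auto simp: xy box_def ball_def PiE_iff)
    ultimately show "z \<in> (\<Union>(x, y)\<in>zero_pairs k. box k x \<times> box k y)" by blast
  next
    fix z assume "z \<in> (\<Union>(x, y)\<in>zero_pairs k. box k x \<times> box k y)"
    then obtain x' y' x y where z: "z = (x, y)" "(x', y') \<in> zero_pairs k" "x \<in> box k x'" "y \<in> box k y'"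
      by auto
    have x': "x' \<in> PiE {..<n} (\<lambda>_. reps k)" "y' \<in> PiE {..<n} (\<lambda>_. reps k)"
      and le: "\<forall>j<m. v (\<Sum>i<n. x' i * y' i * of_int (a i j)) \<le> p ^ k"
      using z(2) by (auto simp: zero_pairs_def)
    have O: "x \<in> PiE {..<n} (\<lambda>_. ringO v)" "y \<in> PiE {..<n} (\<lambda>_. ringO v)"
      using z(3,4) by (auto simp: box_def ball_def PiE_iff)
    have cl: "v (x i - x' i) \<le> p ^ k" "v (y i - y' i) \<le> p ^ k" "v (x i) \<le> 1" if "i < n" for i
      using z(3,4) that by (auto simp: box_def ball_def PiE_iff ringO_def)
    have "v (\<Sum>i<n. x i * y i * of_int (a i j)) \<le> p ^ k" if "j < m" for j
    proof -
      have "v (((\<Sum>i<n. x i * y i * of_int (a i j)) - (\<Sum>i<n. x' i * y' i * of_int (a i j))) + (\<Sum>i<n. x' i * y' i * of_int (a i j))) \<le> p ^ k"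
        by (rule v_add_le[OF close le[rule_format, OF that]]) (auto intro: cl rep_vec_n[OF x'(2)])
      then show ?thesis by simp
    qed
    then show "z \<in> sublevel k" using O by (auto simp: z(1) sublevel_def space_pair mu_norm_le_iff)
  qed
qed

lemma finite_zero_pairs: "finite (zero_pairs k)"
  by (rule finite_subset[of _ "PiE {..<n} (\<lambda>_. reps k) \<times> PiE {..<n} (\<lambda>_. reps k)"])
     (auto simp: zero_pairs_def intro!: finite_PiE)

lemma zero_pairs_box_sets: "(x, y) \<in> zero_pairs k \<Longrightarrow> box k x \<times> box k y \<in> sets pair_measure_O"
  by (auto simp: zero_pairs_def intro!: pair_measureI box_sets)

lemma sublevel_sets: "sublevel k \<in> sets pair_measure_O"
  unfolding sublevel_eq using finite_zero_pairs zero_pairs_box_sets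
  by (intro sets.finite_UN) auto

lemma box_inter:
  assumes "x \<in> PiE {..<n} (\<lambda>_. reps k)" "y \<in> PiE {..<n} (\<lambda>_. reps k)" "z \<in> box k x" "z \<in> box k y"
  shows "x = y"
proof (rule PiE_ext[OF assms(1,2)])
  fix i assume i: "i \<in> {..<n}"
  have "v (z i - x i) \<le> p ^ k" "v (z i - y i) \<le> p ^ k"
    using assms(3,4) i by (auto simp: box_def ball_def PiE_iff)
  then have "v (x i - y i) \<le> p ^ k" using v_diff_trans v_minus_commute by metis
  then show "x i = y i" using reps_unique assms(1,2) i by (metis PiE_mem)
qed

lemma measure_sublevel: "measure pair_measure_O (sublevel k) = dual_avg k {..<n}"
proof -
  interpret pm: finite_measure pair_measure_O by (rule finite_measure_pair)
  have "measure pair_measure_O (sublevel k) = (\<Sum>z\<in>zero_pairs k. measure pair_measure_O (case z of (x, y) \<Rightarrow> box k x \<times> box k y))"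
    unfolding sublevel_eq
  proof (rule pm.finite_measure_finite_Union[OF finite_zero_pairs])
    show "(\<lambda>(x, y). box k x \<times> box k y) ` zero_pairs k \<subseteq> sets pair_measure_O"
      using zero_pairs_box_sets by auto
    show "disjoint_family_on (\<lambda>(x, y). box k x \<times> box k y) (zero_pairs k)"
      unfolding disjoint_family_on_def
      using box_inter by (auto simp: zero_pairs_def)
  qed
  also have "\<dots> = (\<Sum>z\<in>zero_pairs k. p ^ (k * n) * p ^ (k * n))"
    by (intro sum.cong) (auto simp: zero_pairs_def measure_box_pair)
  also have "\<dots> = real (card (zero_pairs k)) * (p ^ (k * n) * p ^ (k * n))" by simp
  also have "\<dots> = (q ^ (k * n) * p ^ (k * n)) * (q ^ (k * n) * p ^ (k * n)) * dual_avg k {..<n}"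
    unfolding card_zero_pairs by (simp only: mult_ac)
  finally show ?thesis by simp
qed

lemma sublevel_antimono: "sublevel (Suc k) \<subseteq> sublevel k"
proof -
  have "p ^ Suc k \<le> p ^ k" by (rule power_decreasing) (auto simp: less_imp_le)
  then show ?thesis by (auto simp: sublevel_def simp del: power_Suc intro: order.trans)
qed

text \<open>Complex \<open>powr\<close> behaves multiplicatively here because the base is a positive
  real, whose principal logarithm is real.\<close>

lemma of_real_p_power_powr: "complex_of_real (p ^ l) powr s = (complex_of_real q powr (- s)) ^ l"
proof -
  have "Ln (complex_of_real (p ^ l)) = of_real (ln (p ^ l))" by (rule Ln_of_real) simp
  also have "ln (p ^ l) = - (real l * ln q)"
    by (simp add: ln_realpow p_def ln_div)
  finally have "complex_of_real (p ^ l) powr s = exp (of_nat l * (- s * of_real (ln q)))"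
    by (simp add: powr_def mult_ac)
  also have "\<dots> = exp (- s * of_real (ln q)) ^ l" by (rule exp_of_nat_mult)
  also have "exp (- s * of_real (ln q)) = complex_of_real q powr (- s)"
    by (simp add: powr_def Ln_of_real)
  finally show ?thesis .
qed

text \<open>On the shell between levels \<open>k\<close> and \<open>k + 1\<close> the integrand is
  the constant \<open>u ^ k\<close>, so the integral is a difference of two series; the shifted one
  is the generating function minus 1, divided by \<open>u\<close>, because level 0 has volume
  1.\<close>

lemma integral_eq_gen_fun:
  assumes s: "Re s > 0"
  defines "u \<equiv> complex_of_real q powr (- s)"
  shows "hypertoric_integral v nu a n m s = gen_fun u {..<n} - (gen_fun u {..<n} - 1) / u"
proof -
  interpret pm: finite_measure pair_measure_O by (rule finite_measure_pair)
  note u = q_powr_neg[OF s, folded u_def]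
  define f where "f = (\<lambda>(x, y). complex_of_real (mu_norm v a n m x y) powr s)"
  define shell where "shell k = sublevel k - sublevel (Suc k)" for k
  \<comment> \<open>Partial sums over shells. Zeros of the moment map lie in no shell, and there
    \<open>0 powr s = 0\<close> agrees with the empty contribution; at all other points the sequence
    is eventually constant.\<close>
  define F where "F K z = (\<Sum>k<K. indicator (shell k) z *\<^sub>R u ^ k)" for K z
  have shell_sets: "shell k \<in> sets pair_measure_O" for k
    unfolding shell_def using sublevel_sets by blast
  have F_meas: "F K \<in> borel_measurable pair_measure_O" for K
    unfolding F_def using shell_sets by (intro borel_measurable_sum borel_measurable_scaleR borel_measurable_indicator) auto
  have F_value: "(\<exists>K0. \<forall>K\<ge>K0. F K z = f z) \<and> (\<forall>K. norm (F K z) \<le> 1)" if z: "z \<in> space pair_measure_O" for z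
  proof -
    obtain x y where xy: "z = (x, y)" by (cases z)
    have O: "v (x i) \<le> 1" "v (y i) \<le> 1" if "i < n" for i
      using z that by (auto simp: xy space_pair PiE_iff ringO_def)
    have mem: "z \<in> sublevel k \<longleftrightarrow> mu_norm v a n m x y \<le> p ^ k" for k
      using z by (auto simp: sublevel_def xy)
    show ?thesis
    proof (rule mu_norm_cases[OF O])
      assume 0: "mu_norm v a n m x y = 0"
      then have "F K z = 0" for K
        unfolding F_def by (intro sum.neutral) (auto simp: shell_def mem less_imp_le simp del: power_Suc)
      moreover have "f z = 0" using 0 by (simp add: f_def xy)
      ultimately show ?thesis by simp
    next
      fix l assume l: "mu_norm v a n m x y = p ^ l"
      have "z \<in> shell k \<longleftrightarrow> k = l" for k
        unfolding shell_def Diff_iff mem l by (subst (1 2) power_decreasing_iff) auto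
      then have ind: "indicator (shell k) z = (if k = l then 1 else 0 :: real)" for k
        by (simp add: indicator_def)
      have Fz: "F K z = (if l < K then u ^ l else 0)" for K
        unfolding F_def ind by (simp add: if_distrib[where f = "\<lambda>c. c *\<^sub>R _"] cong: if_cong)
      have "f z = u ^ l" using l by (simp only: f_def xy prod.case of_real_p_power_powr u_def)
      then have "\<forall>K\<ge>Suc l. F K z = f z" by (simp add: Fz)
      moreover have "norm (F K z) \<le> 1" for K
        using u(1) by (simp add: Fz norm_power power_le_one)
      ultimately show ?thesis by blast
    qed auto
  qed
  have lim: "(\<lambda>K. F K z) \<longlonglongrightarrow> f z" if z: "z \<in> space pair_measure_O" for z
  proof -
    have "eventually (\<lambda>K. F K z = f z) sequentially"
      using F_value[OF z] by (auto simp: eventually_sequentially)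
    then show ?thesis by (rule tendsto_eventually)
  qed
  have "f \<in> borel_measurable pair_measure_O"
    by (rule borel_measurable_LIMSEQ_metric[OF F_meas lim])
  \<comment> \<open>The constant 1 dominates: a point lies in at most one shell, and
    \<open>u\<close> has norm below 1.\<close>
  then have "(\<lambda>K. integral\<^sup>L pair_measure_O (F K)) \<longlonglongrightarrow> integral\<^sup>L pair_measure_O f"
    using F_meas lim F_value
    by (intro integral_dominated_convergence[where w = "\<lambda>_. 1"]) auto
  moreover have "integral\<^sup>L pair_measure_O (F K)
      = (\<Sum>k<K. u ^ k * of_real (scaled_avg k {..<n})) - (\<Sum>k<K. u ^ k * of_real (scaled_avg (Suc k) {..<n}))" for K
  proof -
    have "has_bochner_integral pair_measure_O (F K) (\<Sum>k<K. measure pair_measure_O (shell k) *\<^sub>R u ^ k)"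
      unfolding F_def
      by (intro has_bochner_integral_sum has_bochner_integral_indicator shell_sets)
         (simp add: pm.emeasure_eq_measure)
    then have "integral\<^sup>L pair_measure_O (F K) = (\<Sum>k<K. u ^ k * of_real (measure pair_measure_O (shell k)))"
      by (simp add: has_bochner_integral_integral_eq scaleR_conv_of_real mult.commute)
    also have "\<dots> = (\<Sum>k<K. u ^ k * of_real (scaled_avg k {..<n}) - u ^ k * of_real (scaled_avg (Suc k) {..<n}))"
      unfolding shell_def
      by (subst pm.finite_measure_Diff)
         (auto simp: sublevel_sets sublevel_antimono measure_sublevel scaled_avg_full algebra_simps)
    finally show ?thesis by (simp add: sum_subtractf)
  qed
  moreover have "(\<lambda>K. (\<Sum>k<K. u ^ k * of_real (scaled_avg k {..<n})) - (\<Sum>k<K. u ^ k * of_real (scaled_avg (Suc k) {..<n})))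
      \<longlonglongrightarrow> gen_fun u {..<n} - (\<Sum>k. u ^ k * of_real (scaled_avg (Suc k) {..<n}))"
    unfolding gen_fun_def
    by (intro tendsto_diff summable_LIMSEQ summable_gen_fun gen_fun_tail(2) u(1))
  ultimately have "integral\<^sup>L pair_measure_O f = gen_fun u {..<n} - (\<Sum>k. u ^ k * of_real (scaled_avg (Suc k) {..<n}))"
    using LIMSEQ_unique by simp
  moreover have "(\<Sum>k. u ^ k * of_real (scaled_avg (Suc k) {..<n})) = (gen_fun u {..<n} - 1) / u"
    using gen_fun_tail(1)[OF u(1), of "{..<n}"] u(2) by (simp add: field_simps)
  ultimately show ?thesis by (simp add: hypertoric_integral_def f_def)
qed

lemma chains_eq: "chains_from (flats TYPE('a) a n m) {..<n} = insert [] (chains TYPE('a) a n m)"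
  by (auto simp: chains_from_def chains_def)

text \<open>The sum over chains and the integral are both affine in \<open>G\<close>, the generating
  function of the full set; eliminating \<open>G\<close> gives the formula, whose first summand
  collects the constant terms.\<close>

theorem hypertoric_integral_formula:
  assumes s: "Re s > 0"
  shows "hypertoric_integral v nu a n m s =
       (complex_of_real (q ^ m) - 1) / (complex_of_real (q ^ m) - complex_of_real q powr (- s))
       + (1 - complex_of_real q powr s) / (1 - complex_of_real q powr (- (s + of_nat m)))
         * (\<Sum>cs\<in>chains TYPE('a) a n m.
              complex_of_real (inverse (q ^ (m - rk TYPE('a) a m (last cs))))
              * (\<Prod>i<length cs.
                   complex_of_real (charpoly TYPE('a) a n m (cs ! i) (({..<n} # cs) ! i) q)
                   / (complex_of_real q powr (s + of_nat (deltaF TYPE('a) a n m (cs ! i))) - 1)))"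
    (is "_ = _ + _ * ?S")
proof -
  define u where "u = complex_of_real q powr (- s)"
  define G where "G = gen_fun u {..<n}"
  define P where "P = complex_of_real (p ^ m)"
  note u = q_powr_neg[OF s, folded u_def]
  have fin: "finite (chains TYPE('a) a n m)"
    using finite_chains_from[OF _ finite_flats, of "{..<n}"] chains_eq by simp
  have "?S = (\<Sum>cs\<in>chains TYPE('a) a n m. chain_weight s {..<n} cs)"
    by (intro sum.cong) (auto simp: chain_weight_def chains_def)
  moreover have "1 + (\<Sum>cs\<in>chains TYPE('a) a n m. chain_weight s {..<n} cs) = (1 - u * P) * G"
  proof -
    \<comment> \<open>For the full set the rank is \<open>m\<close> because the arrangement is
      essential, so delta is \<open>m\<close> as well and the empty chain has weight 1.\<close>
    have "(\<Sum>cs\<in>chains_from (flats TYPE('a) a n m) {..<n}. chain_weight s {..<n} cs) = (1 - u * P) * G"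
      using sum_chain_weight[OF s full_flat] by (simp add: u_def G_def P_def deltaF_def rk_full)
    moreover have "chain_weight s {..<n} [] = 1" by (simp add: chain_weight_def rk_full)
    moreover have "[] \<notin> chains TYPE('a) a n m" by (simp add: chains_def)
    ultimately show ?thesis using fin by (simp add: chains_eq)
  qed
  ultimately have S: "1 + ?S = (1 - u * P) * G" by simp
  have nz: "1 - u * P \<noteq> 0" "P \<noteq> 0"
    using norm_mult_p_power_less[OF u(1), of m] by (auto simp: P_def)
  have q: "complex_of_real (q ^ m) = 1 / P" by (simp add: P_def p_def power_one_over)
  have qsm: "complex_of_real q powr (- (s + of_nat m)) = u * P"
    unfolding powr_minus u(4) by (simp add: P_def)
  have "1 / P - u \<noteq> 0" using nz by (simp add: field_simps)
  then have first: "(1 / P - 1) / (1 / P - u) = (1 - P) / (1 - u * P)"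
    using nz by (simp add: field_simps)
  have S': "?S = (1 - u * P) * G - 1" using S by (simp add: algebra_simps)
  have "G - (G - 1) / u = (1 - P) / (1 - u * P) + (1 - 1 / u) / (1 - u * P) * ((1 - u * P) * G - 1)"
    using nz u(2) by (simp add: divide_simps) (simp add: algebra_simps)
  then show ?thesis
    unfolding integral_eq_gen_fun[OF s] S' u_def[symmetric] G_def[symmetric] q u(3) qsm first .
qed

end

theorem mainTheorem3:
  fixes absF :: "'a::field \<Rightarrow> real" and nu :: "'a measure"
    and a :: "nat \<Rightarrow> nat \<Rightarrow> int" and n m :: nat and s :: complex
  assumes lf: "local_field absF"
    and haar: "haar_O absF nu"
    and span: "\<forall>w::nat \<Rightarrow> rat. \<exists>c::nat \<Rightarrow> rat. \<forall>j<m. (\<Sum>i<n. c i * of_int (a i j)) = w j"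
    and minors: "\<forall>R C. R \<subseteq> {..<n} \<and> C \<subseteq> {..<m} \<and> card R = card C \<and> card R \<ge> 1
                    \<longrightarrow> \<bar>minor a R C\<bar> < int (res_char absF)"
    and s: "Re s > 0"
  shows "hypertoric_integral absF nu a n m s =
     (let q = real (res_card absF); T = TYPE('a) in
       (complex_of_real (q ^ m) - 1) / (complex_of_real (q ^ m) - complex_of_real q powr (- s))
       + (1 - complex_of_real q powr s) / (1 - complex_of_real q powr (- (s + of_nat m)))
         * (\<Sum>cs\<in>chains T a n m.
              complex_of_real (inverse (q ^ (m - rk T a m (last cs))))
              * (\<Prod>i<length cs.
                   complex_of_real (charpoly T a n m (cs ! i) (({..<n} # cs) ! i) q)
                   / (complex_of_real q powr (s + of_nat (deltaF T a n m (cs ! i))) - 1))))"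
proof -
  interpret hypertoric_haar absF a n m nu
    by unfold_locales (fact lf span minors haar)+
  show ?thesis
    unfolding Let_def using hypertoric_integral_formula[OF s] unfolding q_def .
qed

end
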